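(* Let $\mathcal M$ be a Green 2-functor for a spannable pair $(\mathbb G;\mathbb J)$, let $i\colon H\to G$ be in $\mathbb J$, and let $A:=i_!(\mathbf 1_H)=i_*(\mathbf 1_H)$. Then: (1) The family of composite isomorphisms $$\sigma_X\colon A\otimes X\xrightarrow[\sim]{\mathrm{Rp}^2_{\mathbf 1,X}}i_*(\mathbf 1\otimes i^*X)\cong i_*(i^*X\otimes\mathbf 1)\xrightarrow[\sim]{\mathrm{Lp}^1_{X,\mathbf 1}}X\otimes A$$ defines a half-braiding $\sigma$ on $A$ in the monoidal category $\mathcal M(G)$. In case $\mathcal M$ is braided, $\sigma$ coincides with the given braiding on $\mathcal M(G)$. (2) The canonical Frobenius structure on $A$ turns $(A,\sigma)$ into a special commutative Frobenius object in the monoidal center $\mathcal Z(\mathcal M(G))$. (3) The right projection maps $\mathrm{Rp}^2\colon A\otimes(-)\Rightarrow i_*i^*$ and $\mathrm{Rp}^1\colon(-)\otimes A\Rightarrow i_*i^*$ are isomorphisms of colax monoidal and lax monoidal endofunctors of $\mathcal M(G)$.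
   Context: Fix a commutative ring $\Bbbk$. $\mathbb A$ denotes either $\mathsf{ADD}_\Bbbk$, the 2-category of (possibly large) additive $\Bbbk$-linear categories, $\Bbbk$-linear functors and natural transformations, or its full 2-subcategory $\mathsf{ADD}_\Bbbk^{ic}$ of idempotent complete ones. A spannable pair $(\mathbb G;\mathbb J)$ consists of: (1) an essentially small $(2,1)$-category $\mathbb G$ (Hom categories are small groupoids; up to equivalence only a small set of objects), which (2) is extensive (it has finite coproducts and for all $G,H$ the pseudofunctor $\mathbb G/G\times\mathbb G/H\to\mathbb G/(G\sqcup H)$, $(u,v)\mapsto u\sqcup v$, is a biequivalence); (3) a 2-full 2-subcategory $\mathbb J\subseteq\mathbb G$ containing all equivalences and closed under isomorphic 1-cells, such that (4) for $i\colon H\to G$ in $\mathbb J$ and any $u\colon K\to G$ there is a pseudopullback ("Mackey square") $p\colon P\to H$, $q\colon P\to K$, $\gamma\colon ip\overset{\sim}{\Rightarrow}uq$, with $q\in\mathbb J$; and (5) for every finite family $u_\ell\colon H_\ell\to G$, the induced $\sqcup_\ell H_\ell\to G$ is in $\mathbb J$ iff every $u_\ell$ is. A Mackey 2-functor for $(\mathbb G;\mathbb J)$ is a 2-functor $\mathcal M\colon\mathbb G^{op}\to\mathbb A$ (write $u^*=\mathcal M(u)$) such that: (1) it sends finite coproducts to direct sums; (2) for $i\in\mathbb J$, $i^*$ has a left adjoint $i_!$ and a right adjoint $i_*$; (3) for every Mackey square with $i,q\in\mathbb J$ the mates $\gamma_!\colon q_!p^*\Rightarrow u^*i_!$ and $(\gamma^{-1})_*\colon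 u^*i_*\Rightarrow q_*p^*$ are invertible; (4) $i_!\simeq i_*$ for $i\in\mathbb J$. Standing assumption: all Mackey 2-functors are rectified, i.e. come with chosen adjunctions $(i_!\dashv i^*,{}^\ell\eta,{}^\ell\varepsilon)$ and $(i^*\dashv i_*,{}^r\eta,{}^r\varepsilon)$ for $i\in\mathbb J$ with $i_!=i_*$ as functors, the pseudofunctors $i\mapsto i_!$ and $i\mapsto i_*$ on $\mathbb J$ equal, $(\gamma_!)^{-1}=(\gamma^{-1})_*$ for all Mackey squares, and ${}^r\varepsilon\circ{}^\ell\eta=\mathrm{id}$. A Green 2-functor for $(\mathbb G;\mathbb J)$ is a Mackey 2-functor $\mathcal M$ together with a lift of $\mathcal M$ to a 2-functor into monoidal categories in $\mathbb A$ (tensor product $\otimes$ $\Bbbk$-bilinear, unit $\mathbf 1_G$), $\Bbbk$-linear strong monoidal functors $u^*$ (write $\otimes_u\colon u^*(X\otimes X')\xrightarrow{\sim}u^*X\otimes u^*X'$) and monoidal transformations, satisfying the projection formulas: for all $i\in\mathbb J$, the maps $\mathrm{Rp}^1_{X,Y}=i_*(i^*X\otimes{}^r\varepsilon)\circ i_*(\otimes_i)\circ{}^r\eta\colon X\otimes i_*Y\to i_*(i^*X\otimes Y)$ and $\mathrm{Rp}^2_{Y,X}=i_*({}^r\varepsilon\otimes i^*X)\circ i_*(\otimes_i)\circ{}^r\eta\colon i_*Y\otimes X\to i_*(Y\otimes i^*X)$ are inverse to $\mathrm{Lp}^1_{X,Y}={}^\ell\varepsilon\circ i_!(\otimes_i^{-1})\circ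 i_!(i^*X\otimes{}^\ell\eta)$ and $\mathrm{Lp}^2_{Y,X}={}^\ell\varepsilon\circ i_!(\otimes_i^{-1})\circ i_!({}^\ell\eta\otimes i^*X)$ respectively. It is braided if the lift is to braided monoidal categories and braided strong monoidal functors. Canonical structures: the right adjoint $i_*$ of the strong monoidal functor $i^*$ is lax monoidal via $i_*X\otimes i_*Y\xrightarrow{{}^r\eta}i_*i^*(i_*X\otimes i_*Y)\cong i_*(i^*i_*X\otimes i^*i_*Y)\xrightarrow{i_*({}^r\varepsilon\otimes{}^r\varepsilon)}i_*(X\otimes Y)$ and $\mathbf 1_G\xrightarrow{{}^r\eta}i_*i^*\mathbf 1_G\cong i_*\mathbf 1_H$; dually the left adjoint $i_!$ is colax monoidal. At $\mathbf 1_H$ these give the multiplication $\mu$ and unit $\iota$, resp. the comultiplication $\delta$ and counit $\epsilon$, of $A$; this is the canonical (special) Frobenius structure on $A$. A Frobenius object is an object with a monoid and a comonoid structure such that $(A\otimes\mu)(\delta\otimes A)=\delta\mu=(\mu\otimes A)(A\otimes\delta)$; it is special if $\mu\delta=\mathrm{id}_A$, and commutative (in a braided category) if its monoid is. A half-braiding on $A\in\mathcal C$ is a natural family of isomorphisms $\sigma_X\colon A\otimes X\to X\otimes A$ with $\sigma_{X\otimes Y}=(X\otimes\sigma_Y)(\sigma_X\otimes Y)$. The monoidal (Drinfeld) center $\mathcal Z(\mathcal C)$ is the braided monoidal category of objects equipped with half-braidings, with morphisms commuting with the half-braidings. In (3), the projection maps are taken at $Y=\mathbf 1$ (and composed with $i_*(\mathbf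 1\otimes i^*X)\cong i_*i^*X\cong i_*(i^*X\otimes\mathbf 1)$). The functor $i_*i^*=i_!i^*$ is lax monoidal as the composite of the strong functor $i^*$ with the lax functor $i_*$, and colax monoidal as the composite of $i^*$ with the colax functor $i_!$. The functor $A\otimes(-)$ has the lax structure $A\otimes X\otimes A\otimes Y\xrightarrow{A\otimes\sigma_X^{-1}\otimes Y}A\otimes A\otimes X\otimes Y\xrightarrow{\mu}A\otimes X\otimes Y$ with unit map $\iota$, and the colax structure $A\otimes X\otimes Y\xrightarrow{\delta}A\otimes A\otimes X\otimes Y\xrightarrow{A\otimes\sigma_X\otimes Y}A\otimes X\otimes A\otimes Y$ with counit map $\epsilon$; the functor $(-)\otimes A$ has the analogous structures, using $\sigma_Y$ and $\sigma_Y^{-1}$. *)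

theory Defs
  imports "HOL-Algebra.Module" "HOL-Library.FuncSet"
begin

section \<open>Categories, functors and natural transformations\<close>

record ('x, 'm) cat =
  Ob :: "'x set"
  Mor :: "'m set"
  Dom :: "'m \<Rightarrow> 'x"
  Cod :: "'m \<Rightarrow> 'x"
  Idn :: "'x \<Rightarrow> 'm"
  Cmp :: "'m \<Rightarrow> 'm \<Rightarrow> 'm"  (infixr \<open>\<cdot>\<index>\<close> 70)

definition Hom :: "('x, 'm, 'z) cat_scheme \<Rightarrow> 'x \<Rightarrow> 'x \<Rightarrow> 'm set" where
  "Hom C X Y = {f \<in> Mor C. Dom C f = X \<and> Cod C f = Y}"

definition category :: "('x, 'm, 'z) cat_scheme \<Rightarrow> bool" where
  "category C \<longleftrightarrow>
     (\<forall>f\<in>Mor C. Dom C f \<in> Ob C \<and> Cod C f \<in> Ob C) \<and>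
     (\<forall>X\<in>Ob C. Idn C X \<in> Hom C X X) \<and>
     (\<forall>X Y Z f g. f \<in> Hom C X Y \<longrightarrow> g \<in> Hom C Y Z \<longrightarrow> g \<cdot>\<^bsub>C\<^esub> f \<in> Hom C X Z) \<and>
     (\<forall>X Y f. f \<in> Hom C X Y \<longrightarrow> f \<cdot>\<^bsub>C\<^esub> Idn C X = f \<and> Idn C Y \<cdot>\<^bsub>C\<^esub> f = f) \<and>
     (\<forall>W X Y Z f g h. f \<in> Hom C W X \<longrightarrow> g \<in> Hom C X Y \<longrightarrow> h \<in> Hom C Y Z \<longrightarrow>
        (h \<cdot>\<^bsub>C\<^esub> g) \<cdot>\<^bsub>C\<^esub> f = h \<cdot>\<^bsub>C\<^esub> (g \<cdot>\<^bsub>C\<^esub> f))"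

definition inverse_mors :: "('x, 'm, 'z) cat_scheme \<Rightarrow> 'm \<Rightarrow> 'm \<Rightarrow> bool" where
  "inverse_mors C f g \<longleftrightarrow>
     f \<in> Mor C \<and> g \<in> Hom C (Cod C f) (Dom C f) \<and>
     g \<cdot>\<^bsub>C\<^esub> f = Idn C (Dom C f) \<and> f \<cdot>\<^bsub>C\<^esub> g = Idn C (Cod C f)"

definition is_iso :: "('x, 'm, 'z) cat_scheme \<Rightarrow> 'm \<Rightarrow> bool" where
  "is_iso C f \<longleftrightarrow> (\<exists>g. inverse_mors C f g)"

definition inv_mor :: "('x, 'm, 'z) cat_scheme \<Rightarrow> 'm \<Rightarrow> 'm" where
  "inv_mor C f = (THE g. inverse_mors C f g)"

definition isomorphic_obs :: "('x, 'm, 'z) cat_scheme \<Rightarrow> 'x \<Rightarrow> 'x \<Rightarrow> bool" where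
  "isomorphic_obs C X Y \<longleftrightarrow> (\<exists>f\<in>Hom C X Y. is_iso C f)"

record ('x, 'm, 'y, 'n) funct =
  fo :: "'x \<Rightarrow> 'y"
  fm :: "'m \<Rightarrow> 'n"

definition is_functor ::
  "('x, 'm, 'z) cat_scheme \<Rightarrow> ('y, 'n, 'w) cat_scheme \<Rightarrow> ('x, 'm, 'y, 'n, 'v) funct_scheme \<Rightarrow> bool" where
  "is_functor C D F \<longleftrightarrow>
     category C \<and> category D \<and>
     (\<forall>X\<in>Ob C. fo F X \<in> Ob D) \<and>
     (\<forall>X Y f. f \<in> Hom C X Y \<longrightarrow> fm F f \<in> Hom D (fo F X) (fo F Y)) \<and>
     (\<forall>X\<in>Ob C. fm F (Idn C X) = Idn D (fo F X)) \<and>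
     (\<forall>X Y Z f g. f \<in> Hom C X Y \<longrightarrow> g \<in> Hom C Y Z \<longrightarrow>
        fm F (g \<cdot>\<^bsub>C\<^esub> f) = fm F g \<cdot>\<^bsub>D\<^esub> fm F f)"

definition id_funct :: "('x, 'm, 'x, 'm) funct" where
  "id_funct = \<lparr>fo = (\<lambda>X. X), fm = (\<lambda>f. f)\<rparr>"

definition comp_funct ::
  "('y, 'n, 'u, 'l, 'v) funct_scheme \<Rightarrow> ('x, 'm, 'y, 'n, 'w) funct_scheme \<Rightarrow> ('x, 'm, 'u, 'l) funct" where
  "comp_funct F G = \<lparr>fo = (\<lambda>X. fo F (fo G X)), fm = (\<lambda>f. fm F (fm G f))\<rparr>"

definition eq_funct ::
  "('x, 'm, 'z) cat_scheme \<Rightarrow> ('x, 'm, 'y, 'n, 'v) funct_scheme \<Rightarrow> ('x, 'm, 'y, 'n, 'w) funct_scheme \<Rightarrow> bool" where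
  "eq_funct C F G \<longleftrightarrow> (\<forall>X\<in>Ob C. fo F X = fo G X) \<and> (\<forall>f\<in>Mor C. fm F f = fm G f)"

definition nat_transf ::
  "('x, 'm, 'z) cat_scheme \<Rightarrow> ('y, 'n, 'w) cat_scheme \<Rightarrow> ('x, 'm, 'y, 'n, 'v) funct_scheme \<Rightarrow>
   ('x, 'm, 'y, 'n, 'u) funct_scheme \<Rightarrow> ('x \<Rightarrow> 'n) \<Rightarrow> bool" where
  "nat_transf C D F G \<tau> \<longleftrightarrow>
     (\<forall>X\<in>Ob C. \<tau> X \<in> Hom D (fo F X) (fo G X)) \<and>
     (\<forall>X Y f. f \<in> Hom C X Y \<longrightarrow> fm G f \<cdot>\<^bsub>D\<^esub> \<tau> X = \<tau> Y \<cdot>\<^bsub>D\<^esub> fm F f)"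

definition nat_iso ::
  "('x, 'm, 'z) cat_scheme \<Rightarrow> ('y, 'n, 'w) cat_scheme \<Rightarrow> ('x, 'm, 'y, 'n, 'v) funct_scheme \<Rightarrow>
   ('x, 'm, 'y, 'n, 'u) funct_scheme \<Rightarrow> ('x \<Rightarrow> 'n) \<Rightarrow> bool" where
  "nat_iso C D F G \<tau> \<longleftrightarrow> nat_transf C D F G \<tau> \<and> (\<forall>X\<in>Ob C. is_iso D (\<tau> X))"

definition adjunction ::
  "('x, 'm, 'z) cat_scheme \<Rightarrow> ('y, 'n, 'w) cat_scheme \<Rightarrow> ('x, 'm, 'y, 'n, 'v) funct_scheme \<Rightarrow>
   ('y, 'n, 'x, 'm, 'u) funct_scheme \<Rightarrow> ('x \<Rightarrow> 'm) \<Rightarrow> ('y \<Rightarrow> 'n) \<Rightarrow> bool" where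
  \<comment> \<open>\<open>L : C \<rightarrow> D\<close> is left adjoint to \<open>R : D \<rightarrow> C\<close>\<close>
  "adjunction C D L R \<eta> \<epsilon> \<longleftrightarrow>
     is_functor C D L \<and> is_functor D C R \<and>
     nat_transf C C id_funct (comp_funct R L) \<eta> \<and>
     nat_transf D D (comp_funct L R) id_funct \<epsilon> \<and>
     (\<forall>X\<in>Ob C. \<epsilon> (fo L X) \<cdot>\<^bsub>D\<^esub> fm L (\<eta> X) = Idn D (fo L X)) \<and>
     (\<forall>Y\<in>Ob D. fm R (\<epsilon> Y) \<cdot>\<^bsub>C\<^esub> \<eta> (fo R Y) = Idn C (fo R Y))"


section \<open>Additive linear categories\<close>

record ('k, 'x, 'm) lin =
  madd :: "'m \<Rightarrow> 'm \<Rightarrow> 'm"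
  mzero :: "'x \<Rightarrow> 'x \<Rightarrow> 'm"
  msmult :: "'k \<Rightarrow> 'm \<Rightarrow> 'm"

text \<open>The multiplicative fields of the \<^type>\<open>module\<close> record play no role in
  the locale \<^locale>\<open>Module.module\<close>.\<close>

definition hom_module ::
  "('k, 'x, 'm) lin \<Rightarrow> ('x, 'm, 'z) cat_scheme \<Rightarrow> 'x \<Rightarrow> 'x \<Rightarrow> ('k, 'm) module" where
  "hom_module L C X Y =
     \<lparr>carrier = Hom C X Y, monoid.mult = (\<lambda>_ _. undefined), one = undefined,
      zero = mzero L X Y, add = madd L, smult = msmult L\<rparr>"

definition linear_category ::
  "('k, 'r) ring_scheme \<Rightarrow> ('k, 'x, 'm) lin \<Rightarrow> ('x, 'm, 'z) cat_scheme \<Rightarrow> bool" where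
  "linear_category K L C \<longleftrightarrow>
     category C \<and>
     (\<forall>X\<in>Ob C. \<forall>Y\<in>Ob C. Module.module K (hom_module L C X Y)) \<and>
     (\<forall>X Y Z f f' g. f \<in> Hom C X Y \<longrightarrow> f' \<in> Hom C X Y \<longrightarrow> g \<in> Hom C Y Z \<longrightarrow>
        g \<cdot>\<^bsub>C\<^esub> madd L f f' = madd L (g \<cdot>\<^bsub>C\<^esub> f) (g \<cdot>\<^bsub>C\<^esub> f')) \<and>
     (\<forall>X Y Z f g g'. f \<in> Hom C X Y \<longrightarrow> g \<in> Hom C Y Z \<longrightarrow> g' \<in> Hom C Y Z \<longrightarrow>
        madd L g g' \<cdot>\<^bsub>C\<^esub> f = madd L (g \<cdot>\<^bsub>C\<^esub> f) (g' \<cdot>\<^bsub>C\<^esub> f)) \<and>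
     (\<forall>X Y Z f g a. f \<in> Hom C X Y \<longrightarrow> g \<in> Hom C Y Z \<longrightarrow> a \<in> carrier K \<longrightarrow>
        msmult L a g \<cdot>\<^bsub>C\<^esub> f = msmult L a (g \<cdot>\<^bsub>C\<^esub> f) \<and>
        g \<cdot>\<^bsub>C\<^esub> msmult L a f = msmult L a (g \<cdot>\<^bsub>C\<^esub> f))"

definition additive_category ::
  "('k, 'r) ring_scheme \<Rightarrow> ('k, 'x, 'm) lin \<Rightarrow> ('x, 'm, 'z) cat_scheme \<Rightarrow> bool" where
  "additive_category K L C \<longleftrightarrow>
     linear_category K L C \<and>
     (\<exists>Z\<in>Ob C. Idn C Z = mzero L Z Z) \<and>
     (\<forall>X\<in>Ob C. \<forall>Y\<in>Ob C. \<exists>S\<in>Ob C.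
        \<exists>i\<in>Hom C X S. \<exists>j\<in>Hom C Y S. \<exists>p\<in>Hom C S X. \<exists>q\<in>Hom C S Y.
          p \<cdot>\<^bsub>C\<^esub> i = Idn C X \<and> q \<cdot>\<^bsub>C\<^esub> j = Idn C Y \<and>
          q \<cdot>\<^bsub>C\<^esub> i = mzero L X Y \<and> p \<cdot>\<^bsub>C\<^esub> j = mzero L Y X \<and>
          madd L (i \<cdot>\<^bsub>C\<^esub> p) (j \<cdot>\<^bsub>C\<^esub> q) = Idn C S)"

definition idempotent_complete :: "('x, 'm, 'z) cat_scheme \<Rightarrow> bool" where
  "idempotent_complete C \<longleftrightarrow>
     (\<forall>X\<in>Ob C. \<forall>e\<in>Hom C X X. e \<cdot>\<^bsub>C\<^esub> e = e \<longrightarrow>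
        (\<exists>Y\<in>Ob C. \<exists>r\<in>Hom C X Y. \<exists>s\<in>Hom C Y X. s \<cdot>\<^bsub>C\<^esub> r = e \<and> r \<cdot>\<^bsub>C\<^esub> s = Idn C Y))"

text \<open>Membership in the target 2-category: all additive \<open>K\<close>-linear categories if
  \<open>ic\<close> is false, only the idempotent complete ones if \<open>ic\<close> is true.\<close>

definition in_target ::
  "bool \<Rightarrow> ('k, 'r) ring_scheme \<Rightarrow> ('k, 'x, 'm) lin \<Rightarrow> ('x, 'm, 'z) cat_scheme \<Rightarrow> bool" where
  "in_target ic K L C \<longleftrightarrow> additive_category K L C \<and> (ic \<longrightarrow> idempotent_complete C)"

definition linear_functor ::
  "('k, 'r) ring_scheme \<Rightarrow> ('k, 'x, 'm) lin \<Rightarrow> ('x, 'm, 'z) cat_scheme \<Rightarrow>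
   ('k, 'y, 'n) lin \<Rightarrow> ('y, 'n, 'w) cat_scheme \<Rightarrow> ('x, 'm, 'y, 'n, 'v) funct_scheme \<Rightarrow> bool" where
  "linear_functor K L C L' D F \<longleftrightarrow>
     is_functor C D F \<and>
     (\<forall>X Y f g. f \<in> Hom C X Y \<longrightarrow> g \<in> Hom C X Y \<longrightarrow>
        fm F (madd L f g) = madd L' (fm F f) (fm F g)) \<and>
     (\<forall>X Y f a. f \<in> Hom C X Y \<longrightarrow> a \<in> carrier K \<longrightarrow>
        fm F (msmult L a f) = msmult L' a (fm F f))"


section \<open>Monoidal categories\<close>

record ('x, 'm) moncat = "('x, 'm) cat" +
  tob :: "'x \<Rightarrow> 'x \<Rightarrow> 'x"  (infixr \<open>\<otimes>\<^sub>o\<index>\<close> 75)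
  tmor :: "'m \<Rightarrow> 'm \<Rightarrow> 'm"  (infixr \<open>\<otimes>\<^sub>m\<index>\<close> 75)
  unit :: "'x"
  assc :: "'x \<Rightarrow> 'x \<Rightarrow> 'x \<Rightarrow> 'm"
  lun :: "'x \<Rightarrow> 'm"
  run :: "'x \<Rightarrow> 'm"

abbreviation iassc :: "('x, 'm, 'z) moncat_scheme \<Rightarrow> 'x \<Rightarrow> 'x \<Rightarrow> 'x \<Rightarrow> 'm" where
  "iassc C X Y Z \<equiv> inv_mor C (assc C X Y Z)"

text \<open>Orientations: \<open>assc C X Y Z : (X \<otimes> Y) \<otimes> Z \<rightarrow> X \<otimes> (Y \<otimes> Z)\<close>,
  \<open>lun C X : 1 \<otimes> X \<rightarrow> X\<close>, \<open>run C X : X \<otimes> 1 \<rightarrow> X\<close>.\<close>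

definition monoidal_category :: "('x, 'm, 'z) moncat_scheme \<Rightarrow> bool" where
  "monoidal_category C \<longleftrightarrow>
     category C \<and> unit C \<in> Ob C \<and>
     (\<forall>X\<in>Ob C. \<forall>Y\<in>Ob C. X \<otimes>\<^sub>o\<^bsub>C\<^esub> Y \<in> Ob C \<and>
        Idn C X \<otimes>\<^sub>m\<^bsub>C\<^esub> Idn C Y = Idn C (X \<otimes>\<^sub>o\<^bsub>C\<^esub> Y)) \<and>
     (\<forall>X X' Y Y' f g. f \<in> Hom C X X' \<longrightarrow> g \<in> Hom C Y Y' \<longrightarrow>
        f \<otimes>\<^sub>m\<^bsub>C\<^esub> g \<in> Hom C (X \<otimes>\<^sub>o\<^bsub>C\<^esub> Y) (X' \<otimes>\<^sub>o\<^bsub>C\<^esub> Y')) \<and>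
     (\<forall>X X' X'' Y Y' Y'' f f' g g'.
        f \<in> Hom C X X' \<longrightarrow> f' \<in> Hom C X' X'' \<longrightarrow> g \<in> Hom C Y Y' \<longrightarrow> g' \<in> Hom C Y' Y'' \<longrightarrow>
        (f' \<cdot>\<^bsub>C\<^esub> f) \<otimes>\<^sub>m\<^bsub>C\<^esub> (g' \<cdot>\<^bsub>C\<^esub> g) = (f' \<otimes>\<^sub>m\<^bsub>C\<^esub> g') \<cdot>\<^bsub>C\<^esub> (f \<otimes>\<^sub>m\<^bsub>C\<^esub> g)) \<and>
     (\<forall>X\<in>Ob C. \<forall>Y\<in>Ob C. \<forall>Z\<in>Ob C.
        assc C X Y Z \<in> Hom C ((X \<otimes>\<^sub>o\<^bsub>C\<^esub> Y) \<otimes>\<^sub>o\<^bsub>C\<^esub> Z) (X \<otimes>\<^sub>o\<^bsub>C\<^esub> (Y \<otimes>\<^sub>o\<^bsub>C\<^esub> Z)) \<and>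
        is_iso C (assc C X Y Z)) \<and>
     (\<forall>X X' Y Y' Z Z' f g h. f \<in> Hom C X X' \<longrightarrow> g \<in> Hom C Y Y' \<longrightarrow> h \<in> Hom C Z Z' \<longrightarrow>
        assc C X' Y' Z' \<cdot>\<^bsub>C\<^esub> ((f \<otimes>\<^sub>m\<^bsub>C\<^esub> g) \<otimes>\<^sub>m\<^bsub>C\<^esub> h) =
        (f \<otimes>\<^sub>m\<^bsub>C\<^esub> (g \<otimes>\<^sub>m\<^bsub>C\<^esub> h)) \<cdot>\<^bsub>C\<^esub> assc C X Y Z) \<and>
     (\<forall>X\<in>Ob C. lun C X \<in> Hom C (unit C \<otimes>\<^sub>o\<^bsub>C\<^esub> X) X \<and> is_iso C (lun C X)) \<and>
     (\<forall>X\<in>Ob C. run C X \<in> Hom C (X \<otimes>\<^sub>o\<^bsub>C\<^esub> unit C) X \<and> is_iso C (run C X)) \<and>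
     (\<forall>X Y f. f \<in> Hom C X Y \<longrightarrow>
        f \<cdot>\<^bsub>C\<^esub> lun C X = lun C Y \<cdot>\<^bsub>C\<^esub> (Idn C (unit C) \<otimes>\<^sub>m\<^bsub>C\<^esub> f) \<and>
        f \<cdot>\<^bsub>C\<^esub> run C X = run C Y \<cdot>\<^bsub>C\<^esub> (f \<otimes>\<^sub>m\<^bsub>C\<^esub> Idn C (unit C))) \<and>
     (\<forall>W\<in>Ob C. \<forall>X\<in>Ob C. \<forall>Y\<in>Ob C. \<forall>Z\<in>Ob C.
        (Idn C W \<otimes>\<^sub>m\<^bsub>C\<^esub> assc C X Y Z) \<cdot>\<^bsub>C\<^esub> assc C W (X \<otimes>\<^sub>o\<^bsub>C\<^esub> Y) Z \<cdot>\<^bsub>C\<^esub> (assc C W X Y \<otimes>\<^sub>m\<^bsub>C\<^esub> Idn C Z) =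
        assc C W X (Y \<otimes>\<^sub>o\<^bsub>C\<^esub> Z) \<cdot>\<^bsub>C\<^esub> assc C (W \<otimes>\<^sub>o\<^bsub>C\<^esub> X) Y Z) \<and>
     (\<forall>X\<in>Ob C. \<forall>Y\<in>Ob C.
        (Idn C X \<otimes>\<^sub>m\<^bsub>C\<^esub> lun C Y) \<cdot>\<^bsub>C\<^esub> assc C X (unit C) Y = run C X \<otimes>\<^sub>m\<^bsub>C\<^esub> Idn C Y)"

definition bilinear_tensor ::
  "('k, 'r) ring_scheme \<Rightarrow> ('k, 'x, 'm) lin \<Rightarrow> ('x, 'm, 'z) moncat_scheme \<Rightarrow> bool" where
  "bilinear_tensor K L C \<longleftrightarrow>
     (\<forall>X X' Y Y' f f' g. f \<in> Hom C X X' \<longrightarrow> f' \<in> Hom C X X' \<longrightarrow> g \<in> Hom C Y Y' \<longrightarrow>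
        madd L f f' \<otimes>\<^sub>m\<^bsub>C\<^esub> g = madd L (f \<otimes>\<^sub>m\<^bsub>C\<^esub> g) (f' \<otimes>\<^sub>m\<^bsub>C\<^esub> g)) \<and>
     (\<forall>X X' Y Y' f g g'. f \<in> Hom C X X' \<longrightarrow> g \<in> Hom C Y Y' \<longrightarrow> g' \<in> Hom C Y Y' \<longrightarrow>
        f \<otimes>\<^sub>m\<^bsub>C\<^esub> madd L g g' = madd L (f \<otimes>\<^sub>m\<^bsub>C\<^esub> g) (f \<otimes>\<^sub>m\<^bsub>C\<^esub> g')) \<and>
     (\<forall>X X' Y Y' f g a. f \<in> Hom C X X' \<longrightarrow> g \<in> Hom C Y Y' \<longrightarrow> a \<in> carrier K \<longrightarrow>
        msmult L a f \<otimes>\<^sub>m\<^bsub>C\<^esub> g = msmult L a (f \<otimes>\<^sub>m\<^bsub>C\<^esub> g) \<and>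
        f \<otimes>\<^sub>m\<^bsub>C\<^esub> msmult L a g = msmult L a (f \<otimes>\<^sub>m\<^bsub>C\<^esub> g))"

text \<open>A functor with structure maps. The same record carries lax structures
  (\<open>fmul F X Y : F X \<otimes> F Y \<rightarrow> F (X \<otimes> Y)\<close>, \<open>fun0 F : 1 \<rightarrow> F 1\<close>) and colax
  structures (\<open>fmul F X Y : F (X \<otimes> Y) \<rightarrow> F X \<otimes> F Y\<close>, \<open>fun0 F : F 1 \<rightarrow> 1\<close>).
  A strong monoidal functor is recorded by its invertible colax structure.\<close>

record ('x, 'm, 'y, 'n) mfunct = "('x, 'm, 'y, 'n) funct" +
  fmul :: "'x \<Rightarrow> 'x \<Rightarrow> 'n"
  fun0 :: "'n"

definition lax_monoidal ::
  "('x, 'm, 'z) moncat_scheme \<Rightarrow> ('y, 'n, 'w) moncat_scheme \<Rightarrow> ('x, 'm, 'y, 'n) mfunct \<Rightarrow> bool" where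
  "lax_monoidal C D F \<longleftrightarrow>
     is_functor C D F \<and>
     (\<forall>X\<in>Ob C. \<forall>Y\<in>Ob C.
        fmul F X Y \<in> Hom D (fo F X \<otimes>\<^sub>o\<^bsub>D\<^esub> fo F Y) (fo F (X \<otimes>\<^sub>o\<^bsub>C\<^esub> Y))) \<and>
     (\<forall>X X' Y Y' f g. f \<in> Hom C X X' \<longrightarrow> g \<in> Hom C Y Y' \<longrightarrow>
        fm F (f \<otimes>\<^sub>m\<^bsub>C\<^esub> g) \<cdot>\<^bsub>D\<^esub> fmul F X Y = fmul F X' Y' \<cdot>\<^bsub>D\<^esub> (fm F f \<otimes>\<^sub>m\<^bsub>D\<^esub> fm F g)) \<and>
     fun0 F \<in> Hom D (unit D) (fo F (unit C)) \<and>
     (\<forall>X\<in>Ob C. \<forall>Y\<in>Ob C. \<forall>Z\<in>Ob C.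
        fm F (assc C X Y Z) \<cdot>\<^bsub>D\<^esub> fmul F (X \<otimes>\<^sub>o\<^bsub>C\<^esub> Y) Z \<cdot>\<^bsub>D\<^esub> (fmul F X Y \<otimes>\<^sub>m\<^bsub>D\<^esub> Idn D (fo F Z)) =
        fmul F X (Y \<otimes>\<^sub>o\<^bsub>C\<^esub> Z) \<cdot>\<^bsub>D\<^esub> (Idn D (fo F X) \<otimes>\<^sub>m\<^bsub>D\<^esub> fmul F Y Z)
          \<cdot>\<^bsub>D\<^esub> assc D (fo F X) (fo F Y) (fo F Z)) \<and>
     (\<forall>X\<in>Ob C.
        fm F (lun C X) \<cdot>\<^bsub>D\<^esub> fmul F (unit C) X \<cdot>\<^bsub>D\<^esub> (fun0 F \<otimes>\<^sub>m\<^bsub>D\<^esub> Idn D (fo F X)) = lun D (fo F X) \<and>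
        fm F (run C X) \<cdot>\<^bsub>D\<^esub> fmul F X (unit C) \<cdot>\<^bsub>D\<^esub> (Idn D (fo F X) \<otimes>\<^sub>m\<^bsub>D\<^esub> fun0 F) = run D (fo F X))"

definition colax_monoidal ::
  "('x, 'm, 'z) moncat_scheme \<Rightarrow> ('y, 'n, 'w) moncat_scheme \<Rightarrow> ('x, 'm, 'y, 'n) mfunct \<Rightarrow> bool" where
  "colax_monoidal C D F \<longleftrightarrow>
     is_functor C D F \<and>
     (\<forall>X\<in>Ob C. \<forall>Y\<in>Ob C.
        fmul F X Y \<in> Hom D (fo F (X \<otimes>\<^sub>o\<^bsub>C\<^esub> Y)) (fo F X \<otimes>\<^sub>o\<^bsub>D\<^esub> fo F Y)) \<and>
     (\<forall>X X' Y Y' f g. f \<in> Hom C X X' \<longrightarrow> g \<in> Hom C Y Y' \<longrightarrow>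
        (fm F f \<otimes>\<^sub>m\<^bsub>D\<^esub> fm F g) \<cdot>\<^bsub>D\<^esub> fmul F X Y = fmul F X' Y' \<cdot>\<^bsub>D\<^esub> fm F (f \<otimes>\<^sub>m\<^bsub>C\<^esub> g)) \<and>
     fun0 F \<in> Hom D (fo F (unit C)) (unit D) \<and>
     (\<forall>X\<in>Ob C. \<forall>Y\<in>Ob C. \<forall>Z\<in>Ob C.
        assc D (fo F X) (fo F Y) (fo F Z) \<cdot>\<^bsub>D\<^esub> (fmul F X Y \<otimes>\<^sub>m\<^bsub>D\<^esub> Idn D (fo F Z))
          \<cdot>\<^bsub>D\<^esub> fmul F (X \<otimes>\<^sub>o\<^bsub>C\<^esub> Y) Z =
        (Idn D (fo F X) \<otimes>\<^sub>m\<^bsub>D\<^esub> fmul F Y Z) \<cdot>\<^bsub>D\<^esub> fmul F X (Y \<otimes>\<^sub>o\<^bsub>C\<^esub> Z) \<cdot>\<^bsub>D\<^esub> fm F (assc C X Y Z)) \<and>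
     (\<forall>X\<in>Ob C.
        lun D (fo F X) \<cdot>\<^bsub>D\<^esub> (fun0 F \<otimes>\<^sub>m\<^bsub>D\<^esub> Idn D (fo F X)) \<cdot>\<^bsub>D\<^esub> fmul F (unit C) X = fm F (lun C X) \<and>
        run D (fo F X) \<cdot>\<^bsub>D\<^esub> (Idn D (fo F X) \<otimes>\<^sub>m\<^bsub>D\<^esub> fun0 F) \<cdot>\<^bsub>D\<^esub> fmul F X (unit C) = fm F (run C X))"

definition strong_monoidal ::
  "('x, 'm, 'z) moncat_scheme \<Rightarrow> ('y, 'n, 'w) moncat_scheme \<Rightarrow> ('x, 'm, 'y, 'n) mfunct \<Rightarrow> bool" where
  "strong_monoidal C D F \<longleftrightarrow>
     colax_monoidal C D F \<and>
     (\<forall>X\<in>Ob C. \<forall>Y\<in>Ob C. is_iso D (fmul F X Y)) \<and> is_iso D (fun0 F)"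

definition lax_transf ::
  "('x, 'm, 'z) moncat_scheme \<Rightarrow> ('y, 'n, 'w) moncat_scheme \<Rightarrow>
   ('x, 'm, 'y, 'n) mfunct \<Rightarrow> ('x, 'm, 'y, 'n) mfunct \<Rightarrow> ('x \<Rightarrow> 'n) \<Rightarrow> bool" where
  "lax_transf C D F G \<tau> \<longleftrightarrow>
     nat_transf C D F G \<tau> \<and>
     (\<forall>X\<in>Ob C. \<forall>Y\<in>Ob C.
        \<tau> (X \<otimes>\<^sub>o\<^bsub>C\<^esub> Y) \<cdot>\<^bsub>D\<^esub> fmul F X Y = fmul G X Y \<cdot>\<^bsub>D\<^esub> (\<tau> X \<otimes>\<^sub>m\<^bsub>D\<^esub> \<tau> Y)) \<and>
     \<tau> (unit C) \<cdot>\<^bsub>D\<^esub> fun0 F = fun0 G"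

definition colax_transf ::
  "('x, 'm, 'z) moncat_scheme \<Rightarrow> ('y, 'n, 'w) moncat_scheme \<Rightarrow>
   ('x, 'm, 'y, 'n) mfunct \<Rightarrow> ('x, 'm, 'y, 'n) mfunct \<Rightarrow> ('x \<Rightarrow> 'n) \<Rightarrow> bool" where
  "colax_transf C D F G \<tau> \<longleftrightarrow>
     nat_transf C D F G \<tau> \<and>
     (\<forall>X\<in>Ob C. \<forall>Y\<in>Ob C.
        fmul G X Y \<cdot>\<^bsub>D\<^esub> \<tau> (X \<otimes>\<^sub>o\<^bsub>C\<^esub> Y) = (\<tau> X \<otimes>\<^sub>m\<^bsub>D\<^esub> \<tau> Y) \<cdot>\<^bsub>D\<^esub> fmul F X Y) \<and>
     fun0 G \<cdot>\<^bsub>D\<^esub> \<tau> (unit C) = fun0 F"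

definition lax_monoidal_iso ::
  "('x, 'm, 'z) moncat_scheme \<Rightarrow> ('y, 'n, 'w) moncat_scheme \<Rightarrow>
   ('x, 'm, 'y, 'n) mfunct \<Rightarrow> ('x, 'm, 'y, 'n) mfunct \<Rightarrow> ('x \<Rightarrow> 'n) \<Rightarrow> bool" where
  "lax_monoidal_iso C D F G \<tau> \<longleftrightarrow>
     lax_monoidal C D F \<and> lax_monoidal C D G \<and> lax_transf C D F G \<tau> \<and> nat_iso C D F G \<tau>"

definition colax_monoidal_iso ::
  "('x, 'm, 'z) moncat_scheme \<Rightarrow> ('y, 'n, 'w) moncat_scheme \<Rightarrow>
   ('x, 'm, 'y, 'n) mfunct \<Rightarrow> ('x, 'm, 'y, 'n) mfunct \<Rightarrow> ('x \<Rightarrow> 'n) \<Rightarrow> bool" where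
  "colax_monoidal_iso C D F G \<tau> \<longleftrightarrow>
     colax_monoidal C D F \<and> colax_monoidal C D G \<and> colax_transf C D F G \<tau> \<and> nat_iso C D F G \<tau>"

definition eq_mfunct ::
  "('x, 'm, 'z) cat_scheme \<Rightarrow> ('x, 'm, 'y, 'n) mfunct \<Rightarrow> ('x, 'm, 'y, 'n) mfunct \<Rightarrow> bool" where
  "eq_mfunct C F G \<longleftrightarrow>
     eq_funct C F G \<and> (\<forall>X\<in>Ob C. \<forall>Y\<in>Ob C. fmul F X Y = fmul G X Y) \<and> fun0 F = fun0 G"

definition id_mfunct :: "('x, 'm, 'z) moncat_scheme \<Rightarrow> ('x, 'm, 'x, 'm) mfunct" where
  "id_mfunct C = \<lparr>fo = (\<lambda>X. X), fm = (\<lambda>f. f),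
     fmul = (\<lambda>X Y. Idn C (X \<otimes>\<^sub>o\<^bsub>C\<^esub> Y)), fun0 = Idn C (unit C)\<rparr>"

definition comp_lax ::
  "('u, 'l, 'z) cat_scheme \<Rightarrow> ('y, 'n, 'u, 'l) mfunct \<Rightarrow> ('x, 'm, 'y, 'n) mfunct \<Rightarrow> ('x, 'm, 'u, 'l) mfunct" where
  "comp_lax E F G = \<lparr>fo = (\<lambda>X. fo F (fo G X)), fm = (\<lambda>f. fm F (fm G f)),
     fmul = (\<lambda>X Y. fm F (fmul G X Y) \<cdot>\<^bsub>E\<^esub> fmul F (fo G X) (fo G Y)),
     fun0 = fm F (fun0 G) \<cdot>\<^bsub>E\<^esub> fun0 F\<rparr>"

definition comp_colax ::
  "('u, 'l, 'z) cat_scheme \<Rightarrow> ('y, 'n, 'u, 'l) mfunct \<Rightarrow> ('x, 'm, 'y, 'n) mfunct \<Rightarrow> ('x, 'm, 'u, 'l) mfunct" where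
  "comp_colax E F G = \<lparr>fo = (\<lambda>X. fo F (fo G X)), fm = (\<lambda>f. fm F (fm G f)),
     fmul = (\<lambda>X Y. fmul F (fo G X) (fo G Y) \<cdot>\<^bsub>E\<^esub> fm F (fmul G X Y)),
     fun0 = fun0 F \<cdot>\<^bsub>E\<^esub> fm F (fun0 G)\<rparr>"

definition strong_as_lax ::
  "('y, 'n, 'z) cat_scheme \<Rightarrow> ('x, 'm, 'y, 'n) mfunct \<Rightarrow> ('x, 'm, 'y, 'n) mfunct" where
  "strong_as_lax D F = F\<lparr>fmul := (\<lambda>X Y. inv_mor D (fmul F X Y)), fun0 := inv_mor D (fun0 F)\<rparr>"

text \<open>The canonical lax (colax) structure on a right (left) adjoint of a strong
  monoidal functor \<open>F : C \<rightarrow> D\<close>.\<close>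

definition right_adjoint_lax ::
  "('x, 'm, 'z) moncat_scheme \<Rightarrow> ('y, 'n, 'w) moncat_scheme \<Rightarrow> ('x, 'm, 'y, 'n) mfunct \<Rightarrow>
   ('y, 'n, 'x, 'm) funct \<Rightarrow> ('x \<Rightarrow> 'm) \<Rightarrow> ('y \<Rightarrow> 'n) \<Rightarrow> ('y, 'n, 'x, 'm) mfunct" where
  "right_adjoint_lax C D F R \<eta> \<epsilon> = \<lparr>fo = fo R, fm = fm R,
     fmul = (\<lambda>X Y. fm R (\<epsilon> X \<otimes>\<^sub>m\<^bsub>D\<^esub> \<epsilon> Y) \<cdot>\<^bsub>C\<^esub> fm R (fmul F (fo R X) (fo R Y))
                     \<cdot>\<^bsub>C\<^esub> \<eta> (fo R X \<otimes>\<^sub>o\<^bsub>C\<^esub> fo R Y)),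
     fun0 = fm R (fun0 F) \<cdot>\<^bsub>C\<^esub> \<eta> (unit C)\<rparr>"

definition left_adjoint_colax ::
  "('x, 'm, 'z) moncat_scheme \<Rightarrow> ('y, 'n, 'w) moncat_scheme \<Rightarrow> ('x, 'm, 'y, 'n) mfunct \<Rightarrow>
   ('y, 'n, 'x, 'm) funct \<Rightarrow> ('y \<Rightarrow> 'n) \<Rightarrow> ('x \<Rightarrow> 'm) \<Rightarrow> ('y, 'n, 'x, 'm) mfunct" where
  "left_adjoint_colax C D F L \<eta> \<epsilon> = \<lparr>fo = fo L, fm = fm L,
     fmul = (\<lambda>X Y. \<epsilon> (fo L X \<otimes>\<^sub>o\<^bsub>C\<^esub> fo L Y)
                     \<cdot>\<^bsub>C\<^esub> fm L (inv_mor D (fmul F (fo L X) (fo L Y))) \<cdot>\<^bsub>C\<^esub> fm L (\<eta> X \<otimes>\<^sub>m\<^bsub>D\<^esub> \<eta> Y)),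
     fun0 = \<epsilon> (unit C) \<cdot>\<^bsub>C\<^esub> fm L (inv_mor D (fun0 F))\<rparr>"


section \<open>Braidings, half-braidings, the monoidal center\<close>

definition braiding :: "('x, 'm, 'z) moncat_scheme \<Rightarrow> ('x \<Rightarrow> 'x \<Rightarrow> 'm) \<Rightarrow> bool" where
  "braiding C \<beta> \<longleftrightarrow>
     (\<forall>X\<in>Ob C. \<forall>Y\<in>Ob C.
        \<beta> X Y \<in> Hom C (X \<otimes>\<^sub>o\<^bsub>C\<^esub> Y) (Y \<otimes>\<^sub>o\<^bsub>C\<^esub> X) \<and> is_iso C (\<beta> X Y)) \<and>
     (\<forall>X X' Y Y' f g. f \<in> Hom C X X' \<longrightarrow> g \<in> Hom C Y Y' \<longrightarrow>
        (g \<otimes>\<^sub>m\<^bsub>C\<^esub> f) \<cdot>\<^bsub>C\<^esub> \<beta> X Y = \<beta> X' Y' \<cdot>\<^bsub>C\<^esub> (f \<otimes>\<^sub>m\<^bsub>C\<^esub> g)) \<and>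
     (\<forall>X\<in>Ob C. \<forall>Y\<in>Ob C. \<forall>Z\<in>Ob C.
        \<beta> X (Y \<otimes>\<^sub>o\<^bsub>C\<^esub> Z) =
          iassc C Y Z X \<cdot>\<^bsub>C\<^esub> (Idn C Y \<otimes>\<^sub>m\<^bsub>C\<^esub> \<beta> X Z) \<cdot>\<^bsub>C\<^esub> assc C Y X Z
            \<cdot>\<^bsub>C\<^esub> (\<beta> X Y \<otimes>\<^sub>m\<^bsub>C\<^esub> Idn C Z) \<cdot>\<^bsub>C\<^esub> iassc C X Y Z \<and>
        \<beta> (X \<otimes>\<^sub>o\<^bsub>C\<^esub> Y) Z =
          assc C Z X Y \<cdot>\<^bsub>C\<^esub> (\<beta> X Z \<otimes>\<^sub>m\<^bsub>C\<^esub> Idn C Y) \<cdot>\<^bsub>C\<^esub> iassc C X Z Y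
            \<cdot>\<^bsub>C\<^esub> (Idn C X \<otimes>\<^sub>m\<^bsub>C\<^esub> \<beta> Y Z) \<cdot>\<^bsub>C\<^esub> assc C X Y Z)"

definition braided_functor ::
  "('x, 'm, 'z) moncat_scheme \<Rightarrow> ('x \<Rightarrow> 'x \<Rightarrow> 'm) \<Rightarrow> ('y, 'n, 'w) moncat_scheme \<Rightarrow> ('y \<Rightarrow> 'y \<Rightarrow> 'n) \<Rightarrow>
   ('x, 'm, 'y, 'n) mfunct \<Rightarrow> bool" where
  "braided_functor C \<beta> D \<beta>' F \<longleftrightarrow>
     strong_monoidal C D F \<and>
     (\<forall>X\<in>Ob C. \<forall>Y\<in>Ob C.
        \<beta>' (fo F X) (fo F Y) \<cdot>\<^bsub>D\<^esub> fmul F X Y = fmul F Y X \<cdot>\<^bsub>D\<^esub> fm F (\<beta> X Y))"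

definition half_braiding :: "('x, 'm, 'z) moncat_scheme \<Rightarrow> 'x \<Rightarrow> ('x \<Rightarrow> 'm) \<Rightarrow> bool" where
  "half_braiding C A \<sigma> \<longleftrightarrow>
     A \<in> Ob C \<and>
     (\<forall>X\<in>Ob C. \<sigma> X \<in> Hom C (A \<otimes>\<^sub>o\<^bsub>C\<^esub> X) (X \<otimes>\<^sub>o\<^bsub>C\<^esub> A) \<and> is_iso C (\<sigma> X)) \<and>
     (\<forall>X Y f. f \<in> Hom C X Y \<longrightarrow>
        (f \<otimes>\<^sub>m\<^bsub>C\<^esub> Idn C A) \<cdot>\<^bsub>C\<^esub> \<sigma> X = \<sigma> Y \<cdot>\<^bsub>C\<^esub> (Idn C A \<otimes>\<^sub>m\<^bsub>C\<^esub> f)) \<and>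
     (\<forall>X\<in>Ob C. \<forall>Y\<in>Ob C.
        \<sigma> (X \<otimes>\<^sub>o\<^bsub>C\<^esub> Y) =
          iassc C X Y A \<cdot>\<^bsub>C\<^esub> (Idn C X \<otimes>\<^sub>m\<^bsub>C\<^esub> \<sigma> Y) \<cdot>\<^bsub>C\<^esub> assc C X A Y
            \<cdot>\<^bsub>C\<^esub> (\<sigma> X \<otimes>\<^sub>m\<^bsub>C\<^esub> Idn C Y) \<cdot>\<^bsub>C\<^esub> iassc C A X Y)"

text \<open>The Drinfeld center. Half-braidings are required to be extensional functions,
  so that objects of the center are determined by the components at objects of \<open>C\<close>;
  morphisms carry their source and target.\<close>

type_synonym ('x, 'm) cob = "'x \<times> ('x \<Rightarrow> 'm)"
type_synonym ('x, 'm) cmor = "('x, 'm) cob \<times> 'm \<times> ('x, 'm) cob"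

definition center_obs :: "('x, 'm, 'z) moncat_scheme \<Rightarrow> ('x, 'm) cob set" where
  "center_obs C = {(X, \<sigma>). half_braiding C X \<sigma> \<and> \<sigma> \<in> extensional (Ob C)}"

definition center_mors :: "('x, 'm, 'z) moncat_scheme \<Rightarrow> ('x, 'm) cmor set" where
  "center_mors C = {((X, \<sigma>), f, (Y, \<tau>)).
     (X, \<sigma>) \<in> center_obs C \<and> (Y, \<tau>) \<in> center_obs C \<and> f \<in> Hom C X Y \<and>
     (\<forall>Z\<in>Ob C. \<tau> Z \<cdot>\<^bsub>C\<^esub> (f \<otimes>\<^sub>m\<^bsub>C\<^esub> Idn C Z) = (Idn C Z \<otimes>\<^sub>m\<^bsub>C\<^esub> f) \<cdot>\<^bsub>C\<^esub> \<sigma> Z)}"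

definition center_tob :: "('x, 'm, 'z) moncat_scheme \<Rightarrow> ('x, 'm) cob \<Rightarrow> ('x, 'm) cob \<Rightarrow> ('x, 'm) cob" where
  "center_tob C P Q =
     (fst P \<otimes>\<^sub>o\<^bsub>C\<^esub> fst Q,
      \<lambda>Z\<in>Ob C. assc C Z (fst P) (fst Q) \<cdot>\<^bsub>C\<^esub> (snd P Z \<otimes>\<^sub>m\<^bsub>C\<^esub> Idn C (fst Q))
        \<cdot>\<^bsub>C\<^esub> iassc C (fst P) Z (fst Q) \<cdot>\<^bsub>C\<^esub> (Idn C (fst P) \<otimes>\<^sub>m\<^bsub>C\<^esub> snd Q Z)
        \<cdot>\<^bsub>C\<^esub> assc C (fst P) (fst Q) Z)"

definition center_unit :: "('x, 'm, 'z) moncat_scheme \<Rightarrow> ('x, 'm) cob" where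
  "center_unit C = (unit C, \<lambda>Z\<in>Ob C. inv_mor C (run C Z) \<cdot>\<^bsub>C\<^esub> lun C Z)"

definition center :: "('x, 'm, 'z) moncat_scheme \<Rightarrow> (('x, 'm) cob, ('x, 'm) cmor) moncat" where
  "center C =
     \<lparr>Ob = center_obs C,
      Mor = center_mors C,
      Dom = fst,
      Cod = (\<lambda>(P, f, Q). Q),
      Idn = (\<lambda>P. (P, Idn C (fst P), P)),
      Cmp = (\<lambda>(Q, g, R) (P, f, Q'). (P, g \<cdot>\<^bsub>C\<^esub> f, R)),
      tob = center_tob C,
      tmor = (\<lambda>(P, f, Q) (P', f', Q').
                (center_tob C P P', f \<otimes>\<^sub>m\<^bsub>C\<^esub> f', center_tob C Q Q')),
      unit = center_unit C,
      assc = (\<lambda>P Q R. (center_tob C (center_tob C P Q) R,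
                        assc C (fst P) (fst Q) (fst R),
                        center_tob C P (center_tob C Q R))),
      lun = (\<lambda>P. (center_tob C (center_unit C) P, lun C (fst P), P)),
      run = (\<lambda>P. (center_tob C P (center_unit C), run C (fst P), P))\<rparr>"

definition center_braiding ::
  "('x, 'm, 'z) moncat_scheme \<Rightarrow> ('x, 'm) cob \<Rightarrow> ('x, 'm) cob \<Rightarrow> ('x, 'm) cmor" where
  "center_braiding C P Q = (center_tob C P Q, snd P (fst Q), center_tob C Q P)"


section \<open>Frobenius objects\<close>

definition monoid_object :: "('x, 'm, 'z) moncat_scheme \<Rightarrow> 'x \<Rightarrow> 'm \<Rightarrow> 'm \<Rightarrow> bool" where
  "monoid_object C A \<mu> \<iota> \<longleftrightarrow>
     A \<in> Ob C \<and> \<mu> \<in> Hom C (A \<otimes>\<^sub>o\<^bsub>C\<^esub> A) A \<and> \<iota> \<in> Hom C (unit C) A \<and>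
     \<mu> \<cdot>\<^bsub>C\<^esub> (\<mu> \<otimes>\<^sub>m\<^bsub>C\<^esub> Idn C A) = \<mu> \<cdot>\<^bsub>C\<^esub> (Idn C A \<otimes>\<^sub>m\<^bsub>C\<^esub> \<mu>) \<cdot>\<^bsub>C\<^esub> assc C A A A \<and>
     \<mu> \<cdot>\<^bsub>C\<^esub> (\<iota> \<otimes>\<^sub>m\<^bsub>C\<^esub> Idn C A) = lun C A \<and>
     \<mu> \<cdot>\<^bsub>C\<^esub> (Idn C A \<otimes>\<^sub>m\<^bsub>C\<^esub> \<iota>) = run C A"

definition comonoid_object :: "('x, 'm, 'z) moncat_scheme \<Rightarrow> 'x \<Rightarrow> 'm \<Rightarrow> 'm \<Rightarrow> bool" where
  "comonoid_object C A \<delta> \<epsilon> \<longleftrightarrow>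
     A \<in> Ob C \<and> \<delta> \<in> Hom C A (A \<otimes>\<^sub>o\<^bsub>C\<^esub> A) \<and> \<epsilon> \<in> Hom C A (unit C) \<and>
     assc C A A A \<cdot>\<^bsub>C\<^esub> (\<delta> \<otimes>\<^sub>m\<^bsub>C\<^esub> Idn C A) \<cdot>\<^bsub>C\<^esub> \<delta> = (Idn C A \<otimes>\<^sub>m\<^bsub>C\<^esub> \<delta>) \<cdot>\<^bsub>C\<^esub> \<delta> \<and>
     lun C A \<cdot>\<^bsub>C\<^esub> (\<epsilon> \<otimes>\<^sub>m\<^bsub>C\<^esub> Idn C A) \<cdot>\<^bsub>C\<^esub> \<delta> = Idn C A \<and>
     run C A \<cdot>\<^bsub>C\<^esub> (Idn C A \<otimes>\<^sub>m\<^bsub>C\<^esub> \<epsilon>) \<cdot>\<^bsub>C\<^esub> \<delta> = Idn C A"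

definition frobenius_object ::
  "('x, 'm, 'z) moncat_scheme \<Rightarrow> 'x \<Rightarrow> 'm \<Rightarrow> 'm \<Rightarrow> 'm \<Rightarrow> 'm \<Rightarrow> bool" where
  "frobenius_object C A \<mu> \<iota> \<delta> \<epsilon> \<longleftrightarrow>
     monoid_object C A \<mu> \<iota> \<and> comonoid_object C A \<delta> \<epsilon> \<and>
     (Idn C A \<otimes>\<^sub>m\<^bsub>C\<^esub> \<mu>) \<cdot>\<^bsub>C\<^esub> assc C A A A \<cdot>\<^bsub>C\<^esub> (\<delta> \<otimes>\<^sub>m\<^bsub>C\<^esub> Idn C A) = \<delta> \<cdot>\<^bsub>C\<^esub> \<mu> \<and>
     (\<mu> \<otimes>\<^sub>m\<^bsub>C\<^esub> Idn C A) \<cdot>\<^bsub>C\<^esub> iassc C A A A \<cdot>\<^bsub>C\<^esub> (Idn C A \<otimes>\<^sub>m\<^bsub>C\<^esub> \<delta>) = \<delta> \<cdot>\<^bsub>C\<^esub> \<mu>"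

definition special_commutative_frobenius ::
  "('x, 'm, 'z) moncat_scheme \<Rightarrow> ('x \<Rightarrow> 'x \<Rightarrow> 'm) \<Rightarrow> 'x \<Rightarrow> 'm \<Rightarrow> 'm \<Rightarrow> 'm \<Rightarrow> 'm \<Rightarrow> bool" where
  "special_commutative_frobenius C \<beta> A \<mu> \<iota> \<delta> \<epsilon> \<longleftrightarrow>
     frobenius_object C A \<mu> \<iota> \<delta> \<epsilon> \<and> \<mu> \<cdot>\<^bsub>C\<^esub> \<delta> = Idn C A \<and> \<mu> \<cdot>\<^bsub>C\<^esub> \<beta> A A = \<mu>"


section \<open>Strict 2-categories\<close>

record ('o, 'a, 'c) two_cat =
  Obj :: "'o set"
  Arr :: "'a set"
  src :: "'a \<Rightarrow> 'o"
  trg :: "'a \<Rightarrow> 'o"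
  id1 :: "'o \<Rightarrow> 'a"
  cmp1 :: "'a \<Rightarrow> 'a \<Rightarrow> 'a"  (infixr \<open>\<circ>\<^sub>1\<index>\<close> 75)
  Cell :: "'c set"
  dom2 :: "'c \<Rightarrow> 'a"
  cod2 :: "'c \<Rightarrow> 'a"
  id2 :: "'a \<Rightarrow> 'c"
  vcmp :: "'c \<Rightarrow> 'c \<Rightarrow> 'c"  (infixr \<open>\<circ>\<^sub>v\<index>\<close> 65)
  hcmp :: "'c \<Rightarrow> 'c \<Rightarrow> 'c"  (infixr \<open>\<circ>\<^sub>h\<index>\<close> 70)

definition hom1 :: "('o, 'a, 'c) two_cat \<Rightarrow> 'o \<Rightarrow> 'o \<Rightarrow> 'a set" where
  "hom1 T X Y = {f \<in> Arr T. src T f = X \<and> trg T f = Y}"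

definition hom2 :: "('o, 'a, 'c) two_cat \<Rightarrow> 'a \<Rightarrow> 'a \<Rightarrow> 'c set" where
  "hom2 T f g = {\<alpha> \<in> Cell T. dom2 T \<alpha> = f \<and> cod2 T \<alpha> = g}"

definition inverse_cells :: "('o, 'a, 'c) two_cat \<Rightarrow> 'c \<Rightarrow> 'c \<Rightarrow> bool" where
  "inverse_cells T \<alpha> \<beta> \<longleftrightarrow>
     \<alpha> \<in> Cell T \<and> \<beta> \<in> hom2 T (cod2 T \<alpha>) (dom2 T \<alpha>) \<and>
     \<beta> \<circ>\<^sub>v\<^bsub>T\<^esub> \<alpha> = id2 T (dom2 T \<alpha>) \<and> \<alpha> \<circ>\<^sub>v\<^bsub>T\<^esub> \<beta> = id2 T (cod2 T \<alpha>)"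

definition iso2 :: "('o, 'a, 'c) two_cat \<Rightarrow> 'a \<Rightarrow> 'a \<Rightarrow> 'c set" where
  "iso2 T f g = {\<alpha> \<in> hom2 T f g. \<exists>\<beta>. inverse_cells T \<alpha> \<beta>}"

definition inv2 :: "('o, 'a, 'c) two_cat \<Rightarrow> 'c \<Rightarrow> 'c" where
  "inv2 T \<alpha> = (THE \<beta>. inverse_cells T \<alpha> \<beta>)"

definition two_category :: "('o, 'a, 'c) two_cat \<Rightarrow> bool" where
  "two_category T \<longleftrightarrow>
     (\<forall>f\<in>Arr T. src T f \<in> Obj T \<and> trg T f \<in> Obj T) \<and>
     (\<forall>X\<in>Obj T. id1 T X \<in> hom1 T X X) \<and>
     (\<forall>X Y Z f g. f \<in> hom1 T X Y \<longrightarrow> g \<in> hom1 T Y Z \<longrightarrow> g \<circ>\<^sub>1\<^bsub>T\<^esub> f \<in> hom1 T X Z) \<and>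
     (\<forall>X Y f. f \<in> hom1 T X Y \<longrightarrow> f \<circ>\<^sub>1\<^bsub>T\<^esub> id1 T X = f \<and> id1 T Y \<circ>\<^sub>1\<^bsub>T\<^esub> f = f) \<and>
     (\<forall>W X Y Z f g h. f \<in> hom1 T W X \<longrightarrow> g \<in> hom1 T X Y \<longrightarrow> h \<in> hom1 T Y Z \<longrightarrow>
        (h \<circ>\<^sub>1\<^bsub>T\<^esub> g) \<circ>\<^sub>1\<^bsub>T\<^esub> f = h \<circ>\<^sub>1\<^bsub>T\<^esub> (g \<circ>\<^sub>1\<^bsub>T\<^esub> f)) \<and>
     (\<forall>\<alpha>\<in>Cell T. dom2 T \<alpha> \<in> Arr T \<and> cod2 T \<alpha> \<in> Arr T \<and>
        src T (dom2 T \<alpha>) = src T (cod2 T \<alpha>) \<and> trg T (dom2 T \<alpha>) = trg T (cod2 T \<alpha>)) \<and>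
     (\<forall>f\<in>Arr T. id2 T f \<in> hom2 T f f) \<and>
     (\<forall>f g h \<alpha> \<beta>. \<alpha> \<in> hom2 T f g \<longrightarrow> \<beta> \<in> hom2 T g h \<longrightarrow> \<beta> \<circ>\<^sub>v\<^bsub>T\<^esub> \<alpha> \<in> hom2 T f h) \<and>
     (\<forall>f g \<alpha>. \<alpha> \<in> hom2 T f g \<longrightarrow> \<alpha> \<circ>\<^sub>v\<^bsub>T\<^esub> id2 T f = \<alpha> \<and> id2 T g \<circ>\<^sub>v\<^bsub>T\<^esub> \<alpha> = \<alpha>) \<and>
     (\<forall>f g h k \<alpha> \<beta> \<gamma>. \<alpha> \<in> hom2 T f g \<longrightarrow> \<beta> \<in> hom2 T g h \<longrightarrow> \<gamma> \<in> hom2 T h k \<longrightarrow>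
        (\<gamma> \<circ>\<^sub>v\<^bsub>T\<^esub> \<beta>) \<circ>\<^sub>v\<^bsub>T\<^esub> \<alpha> = \<gamma> \<circ>\<^sub>v\<^bsub>T\<^esub> (\<beta> \<circ>\<^sub>v\<^bsub>T\<^esub> \<alpha>)) \<and>
     (\<forall>f f' g g' \<alpha> \<beta>. \<alpha> \<in> hom2 T f f' \<longrightarrow> \<beta> \<in> hom2 T g g' \<longrightarrow> src T g = trg T f \<longrightarrow>
        \<beta> \<circ>\<^sub>h\<^bsub>T\<^esub> \<alpha> \<in> hom2 T (g \<circ>\<^sub>1\<^bsub>T\<^esub> f) (g' \<circ>\<^sub>1\<^bsub>T\<^esub> f')) \<and>
     (\<forall>f\<in>Arr T. \<forall>g\<in>Arr T. src T g = trg T f \<longrightarrow>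
        id2 T g \<circ>\<^sub>h\<^bsub>T\<^esub> id2 T f = id2 T (g \<circ>\<^sub>1\<^bsub>T\<^esub> f)) \<and>
     (\<forall>f f' f'' g g' g'' \<alpha> \<alpha>' \<beta> \<beta>'.
        \<alpha> \<in> hom2 T f f' \<longrightarrow> \<alpha>' \<in> hom2 T f' f'' \<longrightarrow> \<beta> \<in> hom2 T g g' \<longrightarrow> \<beta>' \<in> hom2 T g' g'' \<longrightarrow>
        src T g = trg T f \<longrightarrow>
        (\<beta>' \<circ>\<^sub>v\<^bsub>T\<^esub> \<beta>) \<circ>\<^sub>h\<^bsub>T\<^esub> (\<alpha>' \<circ>\<^sub>v\<^bsub>T\<^esub> \<alpha>) = (\<beta>' \<circ>\<^sub>h\<^bsub>T\<^esub> \<alpha>') \<circ>\<^sub>v\<^bsub>T\<^esub> (\<beta> \<circ>\<^sub>h\<^bsub>T\<^esub> \<alpha>)) \<and>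
     (\<forall>f f' \<alpha>. \<alpha> \<in> hom2 T f f' \<longrightarrow>
        \<alpha> \<circ>\<^sub>h\<^bsub>T\<^esub> id2 T (id1 T (src T f)) = \<alpha> \<and> id2 T (id1 T (trg T f)) \<circ>\<^sub>h\<^bsub>T\<^esub> \<alpha> = \<alpha>) \<and>
     (\<forall>f f' g g' h h' \<alpha> \<beta> \<gamma>. \<alpha> \<in> hom2 T f f' \<longrightarrow> \<beta> \<in> hom2 T g g' \<longrightarrow> \<gamma> \<in> hom2 T h h' \<longrightarrow>
        src T g = trg T f \<longrightarrow> src T h = trg T g \<longrightarrow>
        (\<gamma> \<circ>\<^sub>h\<^bsub>T\<^esub> \<beta>) \<circ>\<^sub>h\<^bsub>T\<^esub> \<alpha> = \<gamma> \<circ>\<^sub>h\<^bsub>T\<^esub> (\<beta> \<circ>\<^sub>h\<^bsub>T\<^esub> \<alpha>))"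

definition two_one_category :: "('o, 'a, 'c) two_cat \<Rightarrow> bool" where
  "two_one_category T \<longleftrightarrow> two_category T \<and> (\<forall>\<alpha>\<in>Cell T. \<exists>\<beta>. inverse_cells T \<alpha> \<beta>)"

definition equivalence1 :: "('o, 'a, 'c) two_cat \<Rightarrow> 'a \<Rightarrow> bool" where
  "equivalence1 T f \<longleftrightarrow>
     f \<in> Arr T \<and>
     (\<exists>g\<in>hom1 T (trg T f) (src T f).
        iso2 T (g \<circ>\<^sub>1\<^bsub>T\<^esub> f) (id1 T (src T f)) \<noteq> {} \<and> iso2 T (f \<circ>\<^sub>1\<^bsub>T\<^esub> g) (id1 T (trg T f)) \<noteq> {})"

text \<open>A pseudofunctor is a biequivalence iff it is essentially surjective up to internal
  equivalence and locally an equivalence of categories. The compositors and unitors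
  do not enter this condition, so the pseudofunctor is given by its action on objects,
  1-cells and 2-cells.\<close>

definition biequivalence ::
  "('o, 'a, 'c) two_cat \<Rightarrow> ('p, 'b, 'd) two_cat \<Rightarrow> ('o \<Rightarrow> 'p) \<Rightarrow> ('a \<Rightarrow> 'b) \<Rightarrow> ('c \<Rightarrow> 'd) \<Rightarrow> bool" where
  "biequivalence S T F0 F1 F2 \<longleftrightarrow>
     (\<forall>X\<in>Obj S. F0 X \<in> Obj T) \<and>
     (\<forall>X Y f. f \<in> hom1 S X Y \<longrightarrow> F1 f \<in> hom1 T (F0 X) (F0 Y)) \<and>
     (\<forall>f g \<alpha>. \<alpha> \<in> hom2 S f g \<longrightarrow> F2 \<alpha> \<in> hom2 T (F1 f) (F1 g)) \<and>
     (\<forall>f\<in>Arr S. F2 (id2 S f) = id2 T (F1 f)) \<and>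
     (\<forall>f g h \<alpha> \<beta>. \<alpha> \<in> hom2 S f g \<longrightarrow> \<beta> \<in> hom2 S g h \<longrightarrow>
        F2 (\<beta> \<circ>\<^sub>v\<^bsub>S\<^esub> \<alpha>) = F2 \<beta> \<circ>\<^sub>v\<^bsub>T\<^esub> F2 \<alpha>) \<and>
     (\<forall>Y\<in>Obj T. \<exists>X\<in>Obj S. \<exists>e\<in>hom1 T (F0 X) Y. equivalence1 T e) \<and>
     (\<forall>X\<in>Obj S. \<forall>Y\<in>Obj S. \<forall>g\<in>hom1 T (F0 X) (F0 Y). \<exists>f\<in>hom1 S X Y. iso2 T (F1 f) g \<noteq> {}) \<and>
     (\<forall>X\<in>Obj S. \<forall>Y\<in>Obj S. \<forall>f\<in>hom1 S X Y. \<forall>g\<in>hom1 S X Y.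
        bij_betw F2 (hom2 S f g) (hom2 T (F1 f) (F1 g)))"

definition prod_two_cat ::
  "('o, 'a, 'c) two_cat \<Rightarrow> ('p, 'b, 'd) two_cat \<Rightarrow> ('o \<times> 'p, 'a \<times> 'b, 'c \<times> 'd) two_cat" where
  "prod_two_cat S T =
     \<lparr>Obj = Obj S \<times> Obj T,
      Arr = Arr S \<times> Arr T,
      src = map_prod (src S) (src T),
      trg = map_prod (trg S) (trg T),
      id1 = map_prod (id1 S) (id1 T),
      cmp1 = (\<lambda>(g, g') (f, f'). (g \<circ>\<^sub>1\<^bsub>S\<^esub> f, g' \<circ>\<^sub>1\<^bsub>T\<^esub> f')),
      Cell = Cell S \<times> Cell T,
      dom2 = map_prod (dom2 S) (dom2 T),
      cod2 = map_prod (cod2 S) (cod2 T),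
      id2 = map_prod (id2 S) (id2 T),
      vcmp = (\<lambda>(\<beta>, \<beta>') (\<alpha>, \<alpha>'). (\<beta> \<circ>\<^sub>v\<^bsub>S\<^esub> \<alpha>, \<beta>' \<circ>\<^sub>v\<^bsub>T\<^esub> \<alpha>')),
      hcmp = (\<lambda>(\<beta>, \<beta>') (\<alpha>, \<alpha>'). (\<beta> \<circ>\<^sub>h\<^bsub>S\<^esub> \<alpha>, \<beta>' \<circ>\<^sub>h\<^bsub>T\<^esub> \<alpha>'))\<rparr>"

text \<open>The pseudo-slice \<open>T/G\<close>: a 1-cell from \<open>u\<close> to \<open>v\<close> is a 1-cell \<open>f\<close> with an invertible
  2-cell \<open>\<phi> : u \<Rightarrow> v f\<close>, stored as \<open>(u, f, \<phi>, v)\<close>; a 2-cell from \<open>(u, f, \<phi>, v)\<close> to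
  \<open>(u, g, \<psi>, v)\<close> is a 2-cell \<open>\<alpha> : f \<Rightarrow> g\<close> with \<open>(v \<alpha>) \<phi> = \<psi>\<close>.\<close>

type_synonym ('a, 'c) slice_arr = "'a \<times> 'a \<times> 'c \<times> 'a"
type_synonym ('a, 'c) slice_cell = "('a, 'c) slice_arr \<times> 'c \<times> ('a, 'c) slice_arr"

definition slice_arrs :: "('o, 'a, 'c) two_cat \<Rightarrow> 'o \<Rightarrow> ('a, 'c) slice_arr set" where
  "slice_arrs T G = {(u, f, \<phi>, v). u \<in> Arr T \<and> v \<in> Arr T \<and> trg T u = G \<and> trg T v = G \<and>
     f \<in> hom1 T (src T u) (src T v) \<and> \<phi> \<in> iso2 T u (v \<circ>\<^sub>1\<^bsub>T\<^esub> f)}"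

definition slice_cells :: "('o, 'a, 'c) two_cat \<Rightarrow> 'o \<Rightarrow> ('a, 'c) slice_cell set" where
  "slice_cells T G = {((u, f, \<phi>, v), \<alpha>, (u', g, \<psi>, v')).
     u = u' \<and> v = v' \<and> (u, f, \<phi>, v) \<in> slice_arrs T G \<and> (u, g, \<psi>, v) \<in> slice_arrs T G \<and>
     \<alpha> \<in> hom2 T f g \<and> (id2 T v \<circ>\<^sub>h\<^bsub>T\<^esub> \<alpha>) \<circ>\<^sub>v\<^bsub>T\<^esub> \<phi> = \<psi>}"

definition slice_cmp ::
  "('o, 'a, 'c) two_cat \<Rightarrow> ('a, 'c) slice_arr \<Rightarrow> ('a, 'c) slice_arr \<Rightarrow> ('a, 'c) slice_arr" where
  "slice_cmp T = (\<lambda>(v, g, \<psi>, w) (u, f, \<phi>, v').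
     (u, g \<circ>\<^sub>1\<^bsub>T\<^esub> f, (\<psi> \<circ>\<^sub>h\<^bsub>T\<^esub> id2 T f) \<circ>\<^sub>v\<^bsub>T\<^esub> \<phi>, w))"

definition slice :: "('o, 'a, 'c) two_cat \<Rightarrow> 'o \<Rightarrow> ('a, ('a, 'c) slice_arr, ('a, 'c) slice_cell) two_cat" where
  "slice T G =
     \<lparr>Obj = {u \<in> Arr T. trg T u = G},
      Arr = slice_arrs T G,
      src = (\<lambda>(u, f, \<phi>, v). u),
      trg = (\<lambda>(u, f, \<phi>, v). v),
      id1 = (\<lambda>u. (u, id1 T (src T u), id2 T u, u)),
      cmp1 = slice_cmp T,
      Cell = slice_cells T G,
      dom2 = (\<lambda>(x, \<alpha>, y). x),
      cod2 = (\<lambda>(x, \<alpha>, y). y),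
      id2 = (\<lambda>(u, f, \<phi>, v). ((u, f, \<phi>, v), id2 T f, (u, f, \<phi>, v))),
      vcmp = (\<lambda>(y, \<beta>, z) (x, \<alpha>, y'). (x, \<beta> \<circ>\<^sub>v\<^bsub>T\<^esub> \<alpha>, z)),
      hcmp = (\<lambda>(x', \<beta>, y') (x, \<alpha>, y). (slice_cmp T x' x, \<beta> \<circ>\<^sub>h\<^bsub>T\<^esub> \<alpha>, slice_cmp T y' y))\<rparr>"

text \<open>Bicategorical coproducts: restriction along the family \<open>inc 0, \<dots>, inc (n - 1)\<close> is an
  equivalence from the Hom category at \<open>C\<close> to the product of the Hom categories at \<open>D l\<close>.\<close>

definition is_coproduct ::
  "('o, 'a, 'c) two_cat \<Rightarrow> nat \<Rightarrow> (nat \<Rightarrow> 'o) \<Rightarrow> 'o \<Rightarrow> (nat \<Rightarrow> 'a) \<Rightarrow> bool" where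
  "is_coproduct T n D C inc \<longleftrightarrow>
     C \<in> Obj T \<and> (\<forall>l<n. D l \<in> Obj T \<and> inc l \<in> hom1 T (D l) C) \<and>
     (\<forall>Z\<in>Obj T.
        (\<forall>us. (\<forall>l<n. us l \<in> hom1 T (D l) Z) \<longrightarrow>
           (\<exists>w\<in>hom1 T C Z. \<forall>l<n. iso2 T (w \<circ>\<^sub>1\<^bsub>T\<^esub> inc l) (us l) \<noteq> {})) \<and>
        (\<forall>w\<in>hom1 T C Z. \<forall>w'\<in>hom1 T C Z. \<forall>\<phi>.
           (\<forall>l<n. \<phi> l \<in> hom2 T (w \<circ>\<^sub>1\<^bsub>T\<^esub> inc l) (w' \<circ>\<^sub>1\<^bsub>T\<^esub> inc l)) \<longrightarrow>
           (\<exists>!\<chi>. \<chi> \<in> hom2 T w w' \<and> (\<forall>l<n. \<chi> \<circ>\<^sub>h\<^bsub>T\<^esub> id2 T (inc l) = \<phi> l))))"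

definition has_finite_coproducts :: "('o, 'a, 'c) two_cat \<Rightarrow> bool" where
  "has_finite_coproducts T \<longleftrightarrow>
     (\<forall>n D. (\<forall>l<n. D l \<in> Obj T) \<longrightarrow> (\<exists>C inc. is_coproduct T n D C inc))"

text \<open>Chosen binary coproducts and the resulting pseudofunctor
  \<open>T/G \<times> T/H \<rightarrow> T/(G \<squnion> H)\<close>; another choice gives an equivalent pseudofunctor.\<close>

definition pair2 :: "'b \<Rightarrow> 'b \<Rightarrow> nat \<Rightarrow> 'b" where
  "pair2 x y = (\<lambda>l. if l = 0 then x else y)"

definition csum :: "('o, 'a, 'c) two_cat \<Rightarrow> 'o \<Rightarrow> 'o \<Rightarrow> 'o \<times> (nat \<Rightarrow> 'a)" where
  "csum T X Y = (SOME (C, inc). is_coproduct T 2 (pair2 X Y) C inc)"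

abbreviation csum_ob :: "('o, 'a, 'c) two_cat \<Rightarrow> 'o \<Rightarrow> 'o \<Rightarrow> 'o" where
  "csum_ob T X Y \<equiv> fst (csum T X Y)"

abbreviation csum_inc :: "('o, 'a, 'c) two_cat \<Rightarrow> 'o \<Rightarrow> 'o \<Rightarrow> nat \<Rightarrow> 'a" where
  "csum_inc T X Y \<equiv> snd (csum T X Y)"

definition sum1 :: "('o, 'a, 'c) two_cat \<Rightarrow> 'a \<Rightarrow> 'a \<Rightarrow> 'a \<times> (nat \<Rightarrow> 'c)" where
  "sum1 T f g = (SOME (w, \<theta>).
     w \<in> hom1 T (csum_ob T (src T f) (src T g)) (csum_ob T (trg T f) (trg T g)) \<and>
     (\<forall>l<2. \<theta> l \<in> iso2 T (w \<circ>\<^sub>1\<^bsub>T\<^esub> csum_inc T (src T f) (src T g) l)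
                        (csum_inc T (trg T f) (trg T g) l \<circ>\<^sub>1\<^bsub>T\<^esub> pair2 f g l)))"

abbreviation sum_arr :: "('o, 'a, 'c) two_cat \<Rightarrow> 'a \<Rightarrow> 'a \<Rightarrow> 'a" where
  "sum_arr T f g \<equiv> fst (sum1 T f g)"

abbreviation sum_tri :: "('o, 'a, 'c) two_cat \<Rightarrow> 'a \<Rightarrow> 'a \<Rightarrow> nat \<Rightarrow> 'c" where
  "sum_tri T f g \<equiv> snd (sum1 T f g)"

definition slice_sum_arr ::
  "('o, 'a, 'c) two_cat \<Rightarrow> ('a, 'c) slice_arr \<times> ('a, 'c) slice_arr \<Rightarrow> ('a, 'c) slice_arr" where
  "slice_sum_arr T = (\<lambda>((u, f, \<phi>, u'), (v, g, \<psi>, v')).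
     (sum_arr T u v, sum_arr T f g,
      (THE \<chi>. \<chi> \<in> hom2 T (sum_arr T u v) (sum_arr T u' v' \<circ>\<^sub>1\<^bsub>T\<^esub> sum_arr T f g) \<and>
         (\<forall>l<2. \<chi> \<circ>\<^sub>h\<^bsub>T\<^esub> id2 T (csum_inc T (src T u) (src T v) l) =
            (id2 T (sum_arr T u' v') \<circ>\<^sub>h\<^bsub>T\<^esub> inv2 T (sum_tri T f g l))
            \<circ>\<^sub>v\<^bsub>T\<^esub> (inv2 T (sum_tri T u' v' l) \<circ>\<^sub>h\<^bsub>T\<^esub> id2 T (pair2 f g l))
            \<circ>\<^sub>v\<^bsub>T\<^esub> (id2 T (csum_inc T (trg T u) (trg T v) l) \<circ>\<^sub>h\<^bsub>T\<^esub> pair2 \<phi> \<psi> l)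
            \<circ>\<^sub>v\<^bsub>T\<^esub> sum_tri T u v l)),
      sum_arr T u' v'))"

definition slice_sum_cell ::
  "('o, 'a, 'c) two_cat \<Rightarrow> ('a, 'c) slice_cell \<times> ('a, 'c) slice_cell \<Rightarrow> ('a, 'c) slice_cell" where
  "slice_sum_cell T = (\<lambda>(((u, f, \<phi>, u'), \<alpha>, (u1, f', \<phi>', u1')), ((v, g, \<psi>, v'), \<beta>, (v1, g', \<psi>', v1'))).
     (slice_sum_arr T ((u, f, \<phi>, u'), (v, g, \<psi>, v')),
      (THE \<chi>. \<chi> \<in> hom2 T (sum_arr T f g) (sum_arr T f' g') \<and>
         (\<forall>l<2. \<chi> \<circ>\<^sub>h\<^bsub>T\<^esub> id2 T (csum_inc T (src T f) (src T g) l) =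
            inv2 T (sum_tri T f' g' l)
            \<circ>\<^sub>v\<^bsub>T\<^esub> (id2 T (csum_inc T (trg T f) (trg T g) l) \<circ>\<^sub>h\<^bsub>T\<^esub> pair2 \<alpha> \<beta> l)
            \<circ>\<^sub>v\<^bsub>T\<^esub> sum_tri T f g l)),
      slice_sum_arr T ((u1, f', \<phi>', u1'), (v1, g', \<psi>', v1'))))"

definition extensive :: "('o, 'a, 'c) two_cat \<Rightarrow> bool" where
  "extensive T \<longleftrightarrow>
     has_finite_coproducts T \<and>
     (\<forall>G\<in>Obj T. \<forall>H\<in>Obj T.
        biequivalence (prod_two_cat (slice T G) (slice T H)) (slice T (csum_ob T G H))
          (\<lambda>(u, v). sum_arr T u v) (slice_sum_arr T) (slice_sum_cell T))"

text \<open>Pseudopullback squares with \<open>\<gamma> : i p \<Rightarrow> u q\<close>: for every \<open>Z\<close>, the functor from the Hom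
  category at \<open>P = src p = src q\<close> to the category of triples \<open>(a, b, \<theta> : i a \<cong> u b)\<close> is an equivalence.\<close>

definition mackey_square :: "('o, 'a, 'c) two_cat \<Rightarrow> 'a \<Rightarrow> 'a \<Rightarrow> 'a \<Rightarrow> 'a \<Rightarrow> 'c \<Rightarrow> bool" where
  "mackey_square T i u p q \<gamma> \<longleftrightarrow>
     i \<in> Arr T \<and> u \<in> Arr T \<and> trg T i = trg T u \<and>
     p \<in> hom1 T (src T p) (src T i) \<and> q \<in> hom1 T (src T p) (src T u) \<and>
     \<gamma> \<in> iso2 T (i \<circ>\<^sub>1\<^bsub>T\<^esub> p) (u \<circ>\<^sub>1\<^bsub>T\<^esub> q) \<and>
     (\<forall>Z\<in>Obj T.
        (\<forall>a\<in>hom1 T Z (src T i). \<forall>b\<in>hom1 T Z (src T u). \<forall>\<theta>\<in>iso2 T (i \<circ>\<^sub>1\<^bsub>T\<^esub> a) (u \<circ>\<^sub>1\<^bsub>T\<^esub> b).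
           \<exists>h\<in>hom1 T Z (src T p). \<exists>\<phi>\<in>iso2 T (p \<circ>\<^sub>1\<^bsub>T\<^esub> h) a. \<exists>\<psi>\<in>iso2 T (q \<circ>\<^sub>1\<^bsub>T\<^esub> h) b.
             \<theta> \<circ>\<^sub>v\<^bsub>T\<^esub> (id2 T i \<circ>\<^sub>h\<^bsub>T\<^esub> \<phi>) = (id2 T u \<circ>\<^sub>h\<^bsub>T\<^esub> \<psi>) \<circ>\<^sub>v\<^bsub>T\<^esub> (\<gamma> \<circ>\<^sub>h\<^bsub>T\<^esub> id2 T h)) \<and>
        (\<forall>h\<in>hom1 T Z (src T p). \<forall>k\<in>hom1 T Z (src T p).
           \<forall>\<phi>\<in>hom2 T (p \<circ>\<^sub>1\<^bsub>T\<^esub> h) (p \<circ>\<^sub>1\<^bsub>T\<^esub> k). \<forall>\<psi>\<in>hom2 T (q \<circ>\<^sub>1\<^bsub>T\<^esub> h) (q \<circ>\<^sub>1\<^bsub>T\<^esub> k).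
             (\<gamma> \<circ>\<^sub>h\<^bsub>T\<^esub> id2 T k) \<circ>\<^sub>v\<^bsub>T\<^esub> (id2 T i \<circ>\<^sub>h\<^bsub>T\<^esub> \<phi>) = (id2 T u \<circ>\<^sub>h\<^bsub>T\<^esub> \<psi>) \<circ>\<^sub>v\<^bsub>T\<^esub> (\<gamma> \<circ>\<^sub>h\<^bsub>T\<^esub> id2 T h) \<longrightarrow>
             (\<exists>!\<chi>. \<chi> \<in> hom2 T h k \<and> id2 T p \<circ>\<^sub>h\<^bsub>T\<^esub> \<chi> = \<phi> \<and> id2 T q \<circ>\<^sub>h\<^bsub>T\<^esub> \<chi> = \<psi>)))"

text \<open>A 2-full 2-subcategory containing all equivalences contains all objects, so it is
  given by its set \<open>J\<close> of 1-cells. Smallness conditions hold automatically,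
  since objects, 1-cells and 2-cells form sets.\<close>

definition spannable_pair :: "('o, 'a, 'c) two_cat \<Rightarrow> 'a set \<Rightarrow> bool" where
  "spannable_pair T J \<longleftrightarrow>
     two_one_category T \<and> extensive T \<and>
     J \<subseteq> Arr T \<and>
     (\<forall>f. equivalence1 T f \<longrightarrow> f \<in> J) \<and>
     (\<forall>f\<in>J. \<forall>g\<in>J. src T g = trg T f \<longrightarrow> g \<circ>\<^sub>1\<^bsub>T\<^esub> f \<in> J) \<and>
     (\<forall>f\<in>J. \<forall>g\<in>Arr T. iso2 T f g \<noteq> {} \<longrightarrow> g \<in> J) \<and>
     (\<forall>i\<in>J. \<forall>u\<in>Arr T. trg T u = trg T i \<longrightarrow> (\<exists>p q \<gamma>. mackey_square T i u p q \<gamma> \<and> q \<in> J)) \<and>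
     (\<forall>n Z us C inc w.
        (\<forall>l<n. us l \<in> Arr T \<and> trg T (us l) = Z) \<longrightarrow>
        is_coproduct T n (\<lambda>l. src T (us l)) C inc \<longrightarrow>
        w \<in> hom1 T C Z \<longrightarrow> (\<forall>l<n. iso2 T (w \<circ>\<^sub>1\<^bsub>T\<^esub> inc l) (us l) \<noteq> {}) \<longrightarrow>
        (w \<in> J \<longleftrightarrow> (\<forall>l<n. us l \<in> J)))"


section \<open>Mackey 2-functors\<close>

text \<open>\<open>pull M u\<close> is \<open>u\<^sup>*\<close>, \<open>mcell M \<alpha> X\<close> is the component at \<open>X\<close> of
  \<open>\<alpha>\<^sup>*\<close>, and \<open>push M i\<close> is the common functor \<open>i\<^sub>! = i\<^sub>*\<close> of a rectified Mackey
  2-functor, which is both left adjoint (\<open>leta\<close>, \<open>leps\<close>) and right adjoint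
  (\<open>reta\<close>, \<open>reps\<close>) to \<open>pull M i\<close>. For Mackey 2-functors lifted to monoidal categories
  the record schemes carry the monoidal structures.\<close>

record ('o, 'a, 'c, 'k, 'x, 'm, 'z, 'y) mackey =
  mcat :: "'o \<Rightarrow> ('x, 'm, 'z) cat_scheme"
  mlin :: "'o \<Rightarrow> ('k, 'x, 'm) lin"
  pull :: "'a \<Rightarrow> ('x, 'm, 'x, 'm, 'y) funct_scheme"
  mcell :: "'c \<Rightarrow> 'x \<Rightarrow> 'm"
  push :: "'a \<Rightarrow> ('x, 'm, 'x, 'm) funct"
  leta :: "'a \<Rightarrow> 'x \<Rightarrow> 'm"
  leps :: "'a \<Rightarrow> 'x \<Rightarrow> 'm"
  reta :: "'a \<Rightarrow> 'x \<Rightarrow> 'm"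
  reps :: "'a \<Rightarrow> 'x \<Rightarrow> 'm"

definition linear_two_functor ::
  "bool \<Rightarrow> ('k, 'r) ring_scheme \<Rightarrow> ('o, 'a, 'c) two_cat \<Rightarrow>
   ('o, 'a, 'c, 'k, 'x, 'm, 'z, 'y) mackey \<Rightarrow> bool" where
  "linear_two_functor ic K T M \<longleftrightarrow>
     (\<forall>G\<in>Obj T. in_target ic K (mlin M G) (mcat M G)) \<and>
     (\<forall>H G u. u \<in> hom1 T H G \<longrightarrow>
        linear_functor K (mlin M G) (mcat M G) (mlin M H) (mcat M H) (pull M u)) \<and>
     (\<forall>u v \<alpha>. \<alpha> \<in> hom2 T u v \<longrightarrow>
        nat_transf (mcat M (trg T u)) (mcat M (src T u)) (pull M u) (pull M v) (mcell M \<alpha>)) \<and>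
     (\<forall>G\<in>Obj T. eq_funct (mcat M G) (pull M (id1 T G)) id_funct) \<and>
     (\<forall>u\<in>Arr T. \<forall>v\<in>Arr T. src T v = trg T u \<longrightarrow>
        eq_funct (mcat M (trg T v)) (pull M (v \<circ>\<^sub>1\<^bsub>T\<^esub> u)) (comp_funct (pull M u) (pull M v))) \<and>
     (\<forall>u\<in>Arr T. \<forall>X\<in>Ob (mcat M (trg T u)).
        mcell M (id2 T u) X = Idn (mcat M (src T u)) (fo (pull M u) X)) \<and>
     (\<forall>u v w \<alpha> \<beta>. \<alpha> \<in> hom2 T u v \<longrightarrow> \<beta> \<in> hom2 T v w \<longrightarrow>
        (\<forall>X\<in>Ob (mcat M (trg T u)).
           mcell M (\<beta> \<circ>\<^sub>v\<^bsub>T\<^esub> \<alpha>) X = mcell M \<beta> X \<cdot>\<^bsub>mcat M (src T u)\<^esub> mcell M \<alpha> X)) \<and>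
     (\<forall>u u' v v' \<alpha> \<beta>. \<alpha> \<in> hom2 T u u' \<longrightarrow> \<beta> \<in> hom2 T v v' \<longrightarrow> src T v = trg T u \<longrightarrow>
        (\<forall>X\<in>Ob (mcat M (trg T v)).
           mcell M (\<beta> \<circ>\<^sub>h\<^bsub>T\<^esub> \<alpha>) X =
             mcell M \<alpha> (fo (pull M v') X) \<cdot>\<^bsub>mcat M (src T u)\<^esub> fm (pull M u) (mcell M \<beta> X)))"

text \<open>Additivity: for a finite coproduct with inclusions \<open>inc l : D l \<rightarrow> C\<close>, the functor
  \<open>((inc l)\<^sup>*)\<^sub>l\<close> from \<open>M C\<close> to the product of the \<open>M (D l)\<close> is an equivalence of categories.\<close>

definition additive_two_functor ::
  "('o, 'a, 'c) two_cat \<Rightarrow> ('o, 'a, 'c, 'k, 'x, 'm, 'z, 'y) mackey \<Rightarrow> bool" where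
  "additive_two_functor T M \<longleftrightarrow>
     (\<forall>n D C inc. is_coproduct T n D C inc \<longrightarrow>
        (\<forall>Y. (\<forall>l<n. Y l \<in> Ob (mcat M (D l))) \<longrightarrow>
           (\<exists>X\<in>Ob (mcat M C). \<forall>l<n. isomorphic_obs (mcat M (D l)) (fo (pull M (inc l)) X) (Y l))) \<and>
        (\<forall>X\<in>Ob (mcat M C). \<forall>X'\<in>Ob (mcat M C). \<forall>f.
           (\<forall>l<n. f l \<in> Hom (mcat M (D l)) (fo (pull M (inc l)) X) (fo (pull M (inc l)) X')) \<longrightarrow>
           (\<exists>!g. g \<in> Hom (mcat M C) X X' \<and> (\<forall>l<n. fm (pull M (inc l)) g = f l))))"

text \<open>Mates. For a square \<open>\<gamma> : i p \<Rightarrow> u q\<close>: \<open>mate_l M i u p q \<gamma>\<close> is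
  \<open>q\<^sub>! p\<^sup>* \<Rightarrow> q\<^sub>! p\<^sup>* i\<^sup>* i\<^sub>! \<Rightarrow> q\<^sub>! q\<^sup>* u\<^sup>* i\<^sub>! \<Rightarrow> u\<^sup>* i\<^sub>!\<close>, and for \<open>\<gamma>' : u q \<Rightarrow> i p\<close>,
  \<open>mate_r M i u p q \<gamma>'\<close> is
  \<open>u\<^sup>* i\<^sub>* \<Rightarrow> q\<^sub>* q\<^sup>* u\<^sup>* i\<^sub>* \<Rightarrow> q\<^sub>* p\<^sup>* i\<^sup>* i\<^sub>* \<Rightarrow> q\<^sub>* p\<^sup>*\<close>.\<close>

definition mate_l ::
  "('o, 'a, 'c) two_cat \<Rightarrow> ('o, 'a, 'c, 'k, 'x, 'm, 'z, 'y) mackey \<Rightarrow>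
   'a \<Rightarrow> 'a \<Rightarrow> 'a \<Rightarrow> 'a \<Rightarrow> 'c \<Rightarrow> 'x \<Rightarrow> 'm" where
  "mate_l T M i u p q \<gamma> Y =
     leps M q (fo (pull M u) (fo (push M i) Y))
     \<cdot>\<^bsub>mcat M (trg T q)\<^esub> fm (push M q) (mcell M \<gamma> (fo (push M i) Y))
     \<cdot>\<^bsub>mcat M (trg T q)\<^esub> fm (push M q) (fm (pull M p) (leta M i Y))"

definition mate_r ::
  "('o, 'a, 'c) two_cat \<Rightarrow> ('o, 'a, 'c, 'k, 'x, 'm, 'z, 'y) mackey \<Rightarrow>
   'a \<Rightarrow> 'a \<Rightarrow> 'a \<Rightarrow> 'a \<Rightarrow> 'c \<Rightarrow> 'x \<Rightarrow> 'm" where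
  "mate_r T M i u p q \<gamma>' Y =
     fm (push M q) (fm (pull M p) (reps M i Y))
     \<cdot>\<^bsub>mcat M (trg T q)\<^esub> fm (push M q) (mcell M \<gamma>' (fo (push M i) Y))
     \<cdot>\<^bsub>mcat M (trg T q)\<^esub> reta M q (fo (pull M u) (fo (push M i) Y))"

text \<open>Equality of the pseudofunctors \<open>i \<mapsto> i\<^sub>!\<close> and \<open>i \<mapsto> i\<^sub>*\<close> on \<open>J\<close>, whose structure is
  obtained from that of \<open>i \<mapsto> i\<^sup>*\<close> by taking mates: on a 2-cell \<open>\<alpha> : i \<Rightarrow> j\<close> both give a
  transformation from the functor of \<open>j\<close> to that of \<open>i\<close>, the compositors are compared as maps
  \<open>i\<^sub>! j\<^sub>! \<Rightarrow> (i j)\<^sub>!\<close> and \<open>i\<^sub>* j\<^sub>* \<Rightarrow> (i j)\<^sub>*\<close>, the unitors as maps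
  \<open>Id \<Rightarrow> id\<^sub>!\<close> and \<open>Id \<Rightarrow> id\<^sub>*\<close>.\<close>

definition equal_push_pseudofunctors ::
  "('o, 'a, 'c) two_cat \<Rightarrow> 'a set \<Rightarrow> ('o, 'a, 'c, 'k, 'x, 'm, 'z, 'y) mackey \<Rightarrow> bool" where
  "equal_push_pseudofunctors T J M \<longleftrightarrow>
     (\<forall>i\<in>J. \<forall>j\<in>J. \<forall>\<alpha>\<in>hom2 T i j. \<forall>X\<in>Ob (mcat M (src T i)).
        leps M j (fo (push M i) X)
          \<cdot>\<^bsub>mcat M (trg T i)\<^esub> fm (push M j) (mcell M \<alpha> (fo (push M i) X))
          \<cdot>\<^bsub>mcat M (trg T i)\<^esub> fm (push M j) (leta M i X) =
        fm (push M i) (reps M j X)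
          \<cdot>\<^bsub>mcat M (trg T i)\<^esub> fm (push M i) (mcell M \<alpha> (fo (push M j) X))
          \<cdot>\<^bsub>mcat M (trg T i)\<^esub> reta M i (fo (push M j) X)) \<and>
     (\<forall>i\<in>J. \<forall>j\<in>J. src T i = trg T j \<longrightarrow> (\<forall>X\<in>Ob (mcat M (src T j)).
        leps M i (fo (push M (i \<circ>\<^sub>1\<^bsub>T\<^esub> j)) X)
          \<cdot>\<^bsub>mcat M (trg T i)\<^esub> fm (push M i) (leps M j (fo (pull M i) (fo (push M (i \<circ>\<^sub>1\<^bsub>T\<^esub> j)) X)))
          \<cdot>\<^bsub>mcat M (trg T i)\<^esub> fm (push M i) (fm (push M j) (leta M (i \<circ>\<^sub>1\<^bsub>T\<^esub> j) X)) =
        fm (push M (i \<circ>\<^sub>1\<^bsub>T\<^esub> j)) (reps M j X)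
          \<cdot>\<^bsub>mcat M (trg T i)\<^esub> fm (push M (i \<circ>\<^sub>1\<^bsub>T\<^esub> j)) (fm (pull M j) (reps M i (fo (push M j) X)))
          \<cdot>\<^bsub>mcat M (trg T i)\<^esub> reta M (i \<circ>\<^sub>1\<^bsub>T\<^esub> j) (fo (push M i) (fo (push M j) X)))) \<and>
     (\<forall>G\<in>Obj T. \<forall>X\<in>Ob (mcat M G). leta M (id1 T G) X = reta M (id1 T G) X)"

text \<open>Rectified Mackey 2-functors: the adjunctions are part of the data, and the last clause says
  that the mates \<open>\<gamma>\<^sub>!\<close> and \<open>(\<gamma>\<^sup>-\<^sup>1)\<^sub>*\<close> of every Mackey square along \<open>J\<close> are mutually
  inverse, so that in particular both are invertible.\<close>

definition mackey_2_functor ::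
  "bool \<Rightarrow> ('k, 'r) ring_scheme \<Rightarrow> ('o, 'a, 'c) two_cat \<Rightarrow> 'a set \<Rightarrow>
   ('o, 'a, 'c, 'k, 'x, 'm, 'z, 'y) mackey \<Rightarrow> bool" where
  "mackey_2_functor ic K T J M \<longleftrightarrow>
     linear_two_functor ic K T M \<and>
     additive_two_functor T M \<and>
     (\<forall>H G i. i \<in> J \<longrightarrow> i \<in> hom1 T H G \<longrightarrow>
        linear_functor K (mlin M H) (mcat M H) (mlin M G) (mcat M G) (push M i) \<and>
        adjunction (mcat M H) (mcat M G) (push M i) (pull M i) (leta M i) (leps M i) \<and>
        adjunction (mcat M G) (mcat M H) (pull M i) (push M i) (reta M i) (reps M i) \<and>
        (\<forall>Y\<in>Ob (mcat M H). reps M i Y \<cdot>\<^bsub>mcat M H\<^esub> leta M i Y = Idn (mcat M H) Y)) \<and>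
     equal_push_pseudofunctors T J M \<and>
     (\<forall>i\<in>J. \<forall>q\<in>J. \<forall>u p \<gamma>. mackey_square T i u p q \<gamma> \<longrightarrow>
        (\<forall>Y\<in>Ob (mcat M (src T i)).
           inverse_mors (mcat M (src T u)) (mate_l T M i u p q \<gamma> Y) (mate_r T M i u p q (inv2 T \<gamma>) Y)))"


section \<open>Green 2-functors\<close>

type_synonym ('o, 'a, 'c, 'k, 'x, 'm) green =
  "('o, 'a, 'c, 'k, 'x, 'm, ('x, 'm, unit) moncat_ext, ('x, 'm, unit) mfunct_ext) mackey"

abbreviation mC :: "('o, 'a, 'c) two_cat \<Rightarrow> ('o, 'a, 'c, 'k, 'x, 'm) green \<Rightarrow> 'a \<Rightarrow> ('x, 'm) moncat" where
  "mC T M i \<equiv> mcat M (trg T i)"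

abbreviation mD :: "('o, 'a, 'c) two_cat \<Rightarrow> ('o, 'a, 'c, 'k, 'x, 'm) green \<Rightarrow> 'a \<Rightarrow> ('x, 'm) moncat" where
  "mD T M i \<equiv> mcat M (src T i)"

text \<open>The projection maps for \<open>i : H \<rightarrow> G\<close>, with \<open>mC T M i = M(G)\<close> and \<open>mD T M i = M(H)\<close>.\<close>

definition rp1 :: "('o, 'a, 'c) two_cat \<Rightarrow> ('o, 'a, 'c, 'k, 'x, 'm) green \<Rightarrow> 'a \<Rightarrow> 'x \<Rightarrow> 'x \<Rightarrow> 'm" where
  "rp1 T M i X Y =
     fm (push M i) (Idn (mD T M i) (fo (pull M i) X) \<otimes>\<^sub>m\<^bsub>mD T M i\<^esub> reps M i Y)
     \<cdot>\<^bsub>mC T M i\<^esub> fm (push M i) (fmul (pull M i) X (fo (push M i) Y))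
     \<cdot>\<^bsub>mC T M i\<^esub> reta M i (X \<otimes>\<^sub>o\<^bsub>mC T M i\<^esub> fo (push M i) Y)"

definition rp2 :: "('o, 'a, 'c) two_cat \<Rightarrow> ('o, 'a, 'c, 'k, 'x, 'm) green \<Rightarrow> 'a \<Rightarrow> 'x \<Rightarrow> 'x \<Rightarrow> 'm" where
  "rp2 T M i Y X =
     fm (push M i) (reps M i Y \<otimes>\<^sub>m\<^bsub>mD T M i\<^esub> Idn (mD T M i) (fo (pull M i) X))
     \<cdot>\<^bsub>mC T M i\<^esub> fm (push M i) (fmul (pull M i) (fo (push M i) Y) X)
     \<cdot>\<^bsub>mC T M i\<^esub> reta M i (fo (push M i) Y \<otimes>\<^sub>o\<^bsub>mC T M i\<^esub> X)"

definition lp1 :: "('o, 'a, 'c) two_cat \<Rightarrow> ('o, 'a, 'c, 'k, 'x, 'm) green \<Rightarrow> 'a \<Rightarrow> 'x \<Rightarrow> 'x \<Rightarrow> 'm" where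
  "lp1 T M i X Y =
     leps M i (X \<otimes>\<^sub>o\<^bsub>mC T M i\<^esub> fo (push M i) Y)
     \<cdot>\<^bsub>mC T M i\<^esub> fm (push M i) (inv_mor (mD T M i) (fmul (pull M i) X (fo (push M i) Y)))
     \<cdot>\<^bsub>mC T M i\<^esub> fm (push M i) (Idn (mD T M i) (fo (pull M i) X) \<otimes>\<^sub>m\<^bsub>mD T M i\<^esub> leta M i Y)"

definition lp2 :: "('o, 'a, 'c) two_cat \<Rightarrow> ('o, 'a, 'c, 'k, 'x, 'm) green \<Rightarrow> 'a \<Rightarrow> 'x \<Rightarrow> 'x \<Rightarrow> 'm" where
  "lp2 T M i Y X =
     leps M i (fo (push M i) Y \<otimes>\<^sub>o\<^bsub>mC T M i\<^esub> X)
     \<cdot>\<^bsub>mC T M i\<^esub> fm (push M i) (inv_mor (mD T M i) (fmul (pull M i) (fo (push M i) Y) X))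
     \<cdot>\<^bsub>mC T M i\<^esub> fm (push M i) (leta M i Y \<otimes>\<^sub>m\<^bsub>mD T M i\<^esub> Idn (mD T M i) (fo (pull M i) X))"

text \<open>The lift to monoidal categories is strict, like the underlying 2-functor: identities and
  composites of 1-cells are preserved on the nose, including the monoidal structure maps.\<close>

definition green_2_functor ::
  "bool \<Rightarrow> ('k, 'r) ring_scheme \<Rightarrow> ('o, 'a, 'c) two_cat \<Rightarrow> 'a set \<Rightarrow>
   ('o, 'a, 'c, 'k, 'x, 'm) green \<Rightarrow> bool" where
  "green_2_functor ic K T J M \<longleftrightarrow>
     mackey_2_functor ic K T J M \<and>
     (\<forall>G\<in>Obj T. monoidal_category (mcat M G) \<and> bilinear_tensor K (mlin M G) (mcat M G)) \<and>
     (\<forall>H G u. u \<in> hom1 T H G \<longrightarrow> strong_monoidal (mcat M G) (mcat M H) (pull M u)) \<and>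
     (\<forall>u v \<alpha>. \<alpha> \<in> hom2 T u v \<longrightarrow>
        colax_transf (mcat M (trg T u)) (mcat M (src T u)) (pull M u) (pull M v) (mcell M \<alpha>)) \<and>
     (\<forall>G\<in>Obj T. eq_mfunct (mcat M G) (pull M (id1 T G)) (id_mfunct (mcat M G))) \<and>
     (\<forall>u\<in>Arr T. \<forall>v\<in>Arr T. src T v = trg T u \<longrightarrow>
        eq_mfunct (mcat M (trg T v)) (pull M (v \<circ>\<^sub>1\<^bsub>T\<^esub> u))
          (comp_colax (mcat M (src T u)) (pull M u) (pull M v))) \<and>
     (\<forall>i\<in>J. \<forall>X\<in>Ob (mcat M (trg T i)). \<forall>Y\<in>Ob (mcat M (src T i)).
        inverse_mors (mcat M (trg T i)) (rp1 T M i X Y) (lp1 T M i X Y) \<and>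
        inverse_mors (mcat M (trg T i)) (rp2 T M i Y X) (lp2 T M i Y X))"

definition braided_green ::
  "('o, 'a, 'c) two_cat \<Rightarrow> ('o, 'a, 'c, 'k, 'x, 'm) green \<Rightarrow> ('o \<Rightarrow> 'x \<Rightarrow> 'x \<Rightarrow> 'm) \<Rightarrow> bool" where
  "braided_green T M \<beta> \<longleftrightarrow>
     (\<forall>G\<in>Obj T. braiding (mcat M G) (\<beta> G)) \<and>
     (\<forall>H G u. u \<in> hom1 T H G \<longrightarrow> braided_functor (mcat M G) (\<beta> G) (mcat M H) (\<beta> H) (pull M u))"


section \<open>The canonical Frobenius object\<close>

definition frob_ob :: "('o, 'a, 'c) two_cat \<Rightarrow> ('o, 'a, 'c, 'k, 'x, 'm) green \<Rightarrow> 'a \<Rightarrow> 'x" where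
  "frob_ob T M i = fo (push M i) (unit (mD T M i))"

definition push_lax ::
  "('o, 'a, 'c) two_cat \<Rightarrow> ('o, 'a, 'c, 'k, 'x, 'm) green \<Rightarrow> 'a \<Rightarrow> ('x, 'm, 'x, 'm) mfunct" where
  "push_lax T M i = right_adjoint_lax (mC T M i) (mD T M i) (pull M i) (push M i) (reta M i) (reps M i)"

definition push_colax ::
  "('o, 'a, 'c) two_cat \<Rightarrow> ('o, 'a, 'c, 'k, 'x, 'm) green \<Rightarrow> 'a \<Rightarrow> ('x, 'm, 'x, 'm) mfunct" where
  "push_colax T M i = left_adjoint_colax (mC T M i) (mD T M i) (pull M i) (push M i) (leta M i) (leps M i)"

text \<open>The identification \<open>1 \<otimes> 1 \<cong> 1\<close> in \<open>M(H)\<close> is \<open>lun\<close>, which agrees with \<open>run\<close> at the unit.\<close>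

definition frob_mult :: "('o, 'a, 'c) two_cat \<Rightarrow> ('o, 'a, 'c, 'k, 'x, 'm) green \<Rightarrow> 'a \<Rightarrow> 'm" where
  "frob_mult T M i =
     fm (push M i) (lun (mD T M i) (unit (mD T M i)))
     \<cdot>\<^bsub>mC T M i\<^esub> fmul (push_lax T M i) (unit (mD T M i)) (unit (mD T M i))"

definition frob_unit :: "('o, 'a, 'c) two_cat \<Rightarrow> ('o, 'a, 'c, 'k, 'x, 'm) green \<Rightarrow> 'a \<Rightarrow> 'm" where
  "frob_unit T M i = fun0 (push_lax T M i)"

definition frob_comult :: "('o, 'a, 'c) two_cat \<Rightarrow> ('o, 'a, 'c, 'k, 'x, 'm) green \<Rightarrow> 'a \<Rightarrow> 'm" where
  "frob_comult T M i =
     fmul (push_colax T M i) (unit (mD T M i)) (unit (mD T M i))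
     \<cdot>\<^bsub>mC T M i\<^esub> fm (push M i) (inv_mor (mD T M i) (lun (mD T M i) (unit (mD T M i))))"

definition frob_counit :: "('o, 'a, 'c) two_cat \<Rightarrow> ('o, 'a, 'c, 'k, 'x, 'm) green \<Rightarrow> 'a \<Rightarrow> 'm" where
  "frob_counit T M i = fun0 (push_colax T M i)"

definition frob_sigma :: "('o, 'a, 'c) two_cat \<Rightarrow> ('o, 'a, 'c, 'k, 'x, 'm) green \<Rightarrow> 'a \<Rightarrow> 'x \<Rightarrow> 'm" where
  "frob_sigma T M i = (\<lambda>X\<in>Ob (mC T M i).
     lp1 T M i X (unit (mD T M i))
     \<cdot>\<^bsub>mC T M i\<^esub> fm (push M i) (inv_mor (mD T M i) (run (mD T M i) (fo (pull M i) X))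
                         \<cdot>\<^bsub>mD T M i\<^esub> lun (mD T M i) (fo (pull M i) X))
     \<cdot>\<^bsub>mC T M i\<^esub> rp2 T M i (unit (mD T M i)) X)"

text \<open>The composites \<open>A \<otimes> X \<rightarrow> i\<^sub>* (1 \<otimes> i\<^sup>* X) \<cong> i\<^sub>* i\<^sup>* X\<close> and
  \<open>X \<otimes> A \<rightarrow> i\<^sub>* (i\<^sup>* X \<otimes> 1) \<cong> i\<^sub>* i\<^sup>* X\<close>.\<close>

definition rp2_unit :: "('o, 'a, 'c) two_cat \<Rightarrow> ('o, 'a, 'c, 'k, 'x, 'm) green \<Rightarrow> 'a \<Rightarrow> 'x \<Rightarrow> 'm" where
  "rp2_unit T M i X =
     fm (push M i) (lun (mD T M i) (fo (pull M i) X)) \<cdot>\<^bsub>mC T M i\<^esub> rp2 T M i (unit (mD T M i)) X"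

definition rp1_unit :: "('o, 'a, 'c) two_cat \<Rightarrow> ('o, 'a, 'c, 'k, 'x, 'm) green \<Rightarrow> 'a \<Rightarrow> 'x \<Rightarrow> 'm" where
  "rp1_unit T M i X =
     fm (push M i) (run (mD T M i) (fo (pull M i) X)) \<cdot>\<^bsub>mC T M i\<^esub> rp1 T M i X (unit (mD T M i))"

definition push_pull_lax ::
  "('o, 'a, 'c) two_cat \<Rightarrow> ('o, 'a, 'c, 'k, 'x, 'm) green \<Rightarrow> 'a \<Rightarrow> ('x, 'm, 'x, 'm) mfunct" where
  "push_pull_lax T M i = comp_lax (mC T M i) (push_lax T M i) (strong_as_lax (mD T M i) (pull M i))"

definition push_pull_colax ::
  "('o, 'a, 'c) two_cat \<Rightarrow> ('o, 'a, 'c, 'k, 'x, 'm) green \<Rightarrow> 'a \<Rightarrow> ('x, 'm, 'x, 'm) mfunct" where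
  "push_pull_colax T M i = comp_colax (mC T M i) (push_colax T M i) (pull M i)"

text \<open>The lax and colax structures on \<open>A \<otimes> (-)\<close> and \<open>(-) \<otimes> A\<close> induced by a half-braiding
  \<open>\<sigma>\<close> and a monoid, respectively comonoid, structure on \<open>A\<close>.\<close>

definition ltensor_lax ::
  "('x, 'm, 'z) moncat_scheme \<Rightarrow> 'x \<Rightarrow> ('x \<Rightarrow> 'm) \<Rightarrow> 'm \<Rightarrow> 'm \<Rightarrow> ('x, 'm, 'x, 'm) mfunct" where
  "ltensor_lax C A \<sigma> \<mu> \<iota> =
     \<lparr>fo = (\<lambda>X. A \<otimes>\<^sub>o\<^bsub>C\<^esub> X), fm = (\<lambda>f. Idn C A \<otimes>\<^sub>m\<^bsub>C\<^esub> f),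
      fmul = (\<lambda>X Y.
        (\<mu> \<otimes>\<^sub>m\<^bsub>C\<^esub> Idn C (X \<otimes>\<^sub>o\<^bsub>C\<^esub> Y))
        \<cdot>\<^bsub>C\<^esub> iassc C A A (X \<otimes>\<^sub>o\<^bsub>C\<^esub> Y)
        \<cdot>\<^bsub>C\<^esub> (Idn C A \<otimes>\<^sub>m\<^bsub>C\<^esub> (assc C A X Y \<cdot>\<^bsub>C\<^esub> (inv_mor C (\<sigma> X) \<otimes>\<^sub>m\<^bsub>C\<^esub> Idn C Y) \<cdot>\<^bsub>C\<^esub> iassc C X A Y))
        \<cdot>\<^bsub>C\<^esub> assc C A X (A \<otimes>\<^sub>o\<^bsub>C\<^esub> Y)),
      fun0 = (\<iota> \<otimes>\<^sub>m\<^bsub>C\<^esub> Idn C (unit C)) \<cdot>\<^bsub>C\<^esub> inv_mor C (lun C (unit C))\<rparr>"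

definition ltensor_colax ::
  "('x, 'm, 'z) moncat_scheme \<Rightarrow> 'x \<Rightarrow> ('x \<Rightarrow> 'm) \<Rightarrow> 'm \<Rightarrow> 'm \<Rightarrow> ('x, 'm, 'x, 'm) mfunct" where
  "ltensor_colax C A \<sigma> \<delta> \<epsilon> =
     \<lparr>fo = (\<lambda>X. A \<otimes>\<^sub>o\<^bsub>C\<^esub> X), fm = (\<lambda>f. Idn C A \<otimes>\<^sub>m\<^bsub>C\<^esub> f),
      fmul = (\<lambda>X Y.
        iassc C A X (A \<otimes>\<^sub>o\<^bsub>C\<^esub> Y)
        \<cdot>\<^bsub>C\<^esub> (Idn C A \<otimes>\<^sub>m\<^bsub>C\<^esub> (assc C X A Y \<cdot>\<^bsub>C\<^esub> (\<sigma> X \<otimes>\<^sub>m\<^bsub>C\<^esub> Idn C Y) \<cdot>\<^bsub>C\<^esub> iassc C A X Y))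
        \<cdot>\<^bsub>C\<^esub> assc C A A (X \<otimes>\<^sub>o\<^bsub>C\<^esub> Y)
        \<cdot>\<^bsub>C\<^esub> (\<delta> \<otimes>\<^sub>m\<^bsub>C\<^esub> Idn C (X \<otimes>\<^sub>o\<^bsub>C\<^esub> Y))),
      fun0 = lun C (unit C) \<cdot>\<^bsub>C\<^esub> (\<epsilon> \<otimes>\<^sub>m\<^bsub>C\<^esub> Idn C (unit C))\<rparr>"

definition rtensor_lax ::
  "('x, 'm, 'z) moncat_scheme \<Rightarrow> 'x \<Rightarrow> ('x \<Rightarrow> 'm) \<Rightarrow> 'm \<Rightarrow> 'm \<Rightarrow> ('x, 'm, 'x, 'm) mfunct" where
  "rtensor_lax C A \<sigma> \<mu> \<iota> =
     \<lparr>fo = (\<lambda>X. X \<otimes>\<^sub>o\<^bsub>C\<^esub> A), fm = (\<lambda>f. f \<otimes>\<^sub>m\<^bsub>C\<^esub> Idn C A),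
      fmul = (\<lambda>X Y.
        (Idn C (X \<otimes>\<^sub>o\<^bsub>C\<^esub> Y) \<otimes>\<^sub>m\<^bsub>C\<^esub> \<mu>)
        \<cdot>\<^bsub>C\<^esub> assc C (X \<otimes>\<^sub>o\<^bsub>C\<^esub> Y) A A
        \<cdot>\<^bsub>C\<^esub> ((iassc C X Y A \<cdot>\<^bsub>C\<^esub> (Idn C X \<otimes>\<^sub>m\<^bsub>C\<^esub> \<sigma> Y) \<cdot>\<^bsub>C\<^esub> assc C X A Y) \<otimes>\<^sub>m\<^bsub>C\<^esub> Idn C A)
        \<cdot>\<^bsub>C\<^esub> iassc C (X \<otimes>\<^sub>o\<^bsub>C\<^esub> A) Y A),
      fun0 = (Idn C (unit C) \<otimes>\<^sub>m\<^bsub>C\<^esub> \<iota>) \<cdot>\<^bsub>C\<^esub> inv_mor C (run C (unit C))\<rparr>"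

definition rtensor_colax ::
  "('x, 'm, 'z) moncat_scheme \<Rightarrow> 'x \<Rightarrow> ('x \<Rightarrow> 'm) \<Rightarrow> 'm \<Rightarrow> 'm \<Rightarrow> ('x, 'm, 'x, 'm) mfunct" where
  "rtensor_colax C A \<sigma> \<delta> \<epsilon> =
     \<lparr>fo = (\<lambda>X. X \<otimes>\<^sub>o\<^bsub>C\<^esub> A), fm = (\<lambda>f. f \<otimes>\<^sub>m\<^bsub>C\<^esub> Idn C A),
      fmul = (\<lambda>X Y.
        assc C (X \<otimes>\<^sub>o\<^bsub>C\<^esub> A) Y A
        \<cdot>\<^bsub>C\<^esub> ((iassc C X A Y \<cdot>\<^bsub>C\<^esub> (Idn C X \<otimes>\<^sub>m\<^bsub>C\<^esub> inv_mor C (\<sigma> Y)) \<cdot>\<^bsub>C\<^esub> assc C X Y A) \<otimes>\<^sub>m\<^bsub>C\<^esub> Idn C A)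
        \<cdot>\<^bsub>C\<^esub> iassc C (X \<otimes>\<^sub>o\<^bsub>C\<^esub> Y) A A
        \<cdot>\<^bsub>C\<^esub> (Idn C (X \<otimes>\<^sub>o\<^bsub>C\<^esub> Y) \<otimes>\<^sub>m\<^bsub>C\<^esub> \<delta>)),
      fun0 = run C (unit C) \<cdot>\<^bsub>C\<^esub> (Idn C (unit C) \<otimes>\<^sub>m\<^bsub>C\<^esub> \<epsilon>)\<rparr>"

end

theory Submission
  imports Defs
begin

text \<open>
  Write \<open>I = i\<^sup>*\<close> for the strong monoidal functor from \<open>C = M(G)\<close> to \<open>D = M(H)\<close> and \<open>P\<close> for its common left and
  right adjoint \<open>i\<^sub>! = i\<^sub>*\<close>, so that \<open>A = P 1\<close>. The argument takes place in \<open>C\<close> and \<open>D\<close>; it uses \<open>I\<close>, \<open>P\<close>, the two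
  adjunctions and the projection formulas at the unit object.

  The first idea is to get rid of \<open>D\<close> and of the structure isomorphisms of \<open>I\<close>. Let \<open>E\<close> be the full
  image of \<open>I\<close>: its objects are those of \<open>C\<close>, and a morphism \<open>X \<rightarrow> Y\<close> of \<open>E\<close> is a morphism \<open>I X \<rightarrow> I Y\<close> of \<open>D\<close>.
  It is a monoidal category, and \<open>C \<rightarrow> E\<close> is strictly monoidal and the identity on objects. The counit
  of \<open>I \<stileturn> P\<close> at \<open>1\<close> becomes a morphism \<open>e : A \<rightarrow> 1\<close> of \<open>E\<close>, and absorbing \<open>A\<close> along \<open>e\<close> gives maps
  \<open>A \<otimes> X \<rightarrow> X\<close> and \<open>X \<otimes> A \<rightarrow> X\<close> in \<open>E\<close>. These are the transposes of the right projection maps.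
  As the projection maps are invertible, \<open>A \<otimes> X\<close>, \<open>X \<otimes> A\<close> and \<open>P (I X)\<close> are all cofree on \<open>X\<close> with respect
  to \<open>C \<rightarrow> E\<close>: two morphisms of \<open>C\<close> into one of them are equal once they agree in \<open>E\<close> after
  composition with its counit.

  Everything about the right adjoint follows by this test. The half-braiding \<open>\<sigma>\<close> is the map
  \<open>A \<otimes> X \<rightarrow> X \<otimes> A\<close> compatible with the counits, and \<open>\<mu>\<close> is determined by \<open>e \<mu> = e (e \<otimes> A)\<close>. After composition
  with a counit both sides of the hexagon, of the monoid axioms, of commutativity, and of the statement
  that \<open>\<mu>\<close> and \<open>\<iota>\<close> are morphisms of the center become the same composite of absorptions
  (\<open>\<sigma>_half_braiding\<close>, \<open>monoid\<close>, \<open>commutative\<close>, \<open>hb_mor_\<mu>\<close>, \<open>hb_mor_\<iota>\<close>). Lax structures on cofree objects are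
  lax monoidal as soon as the counits are monoidal, and comparisons between them are automatically
  monoidal (\<open>cofree_lax_monoidal\<close>, \<open>cofree_lax_monoidal_iso\<close>); this gives the lax half of the third part.

  The hypotheses are symmetric: passing to \<open>C\<^sup>o\<^sup>p\<close> and \<open>D\<^sup>o\<^sup>p\<close> exchanges the two adjunctions, \<open>Rp\<close> with \<open>Lp\<close>,
  \<open>\<sigma>\<close> with its inverse, and \<open>(\<mu>, \<iota>)\<close> with \<open>(\<delta>, \<epsilon>)\<close> (\<open>ambidextrous_opp\<close>). So the comonoid and the
  colax half come for free. What links the two halves are the formulas \<open>\<mu> = P(e) r\<close> and
  \<open>\<delta> = r\<^sup>-\<^sup>1 P(n)\<close>, where \<open>r : A \<otimes> A \<rightarrow> P (I A)\<close> is the projection isomorphism and \<open>n : 1 \<rightarrow> A\<close> is the unit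
  of \<open>P \<stileturn> I\<close>. They give \<open>\<mu> \<delta> = P(e n) = 1\<close>, because \<open>e n = 1\<close>, and the Frobenius relation, because
  both of its sides become \<open>n e \<mu>\<close> in \<open>E\<close>.
\<close>

section \<open>Calculus in monoidal categories\<close>

locale cat_calculus =
  fixes C :: "('x, 'm, 'z) cat_scheme" (structure)
  assumes cat: "category C"
begin

lemma in_HomD: "f \<in> Hom C X Y \<Longrightarrow> f \<in> Mor C \<and> Dom C f = X \<and> Cod C f = Y"
  by (simp add: Hom_def)

lemma Dom_in_Ob [simp]: "f \<in> Mor C \<Longrightarrow> Dom C f \<in> Ob C"
  and Cod_in_Ob [simp]: "f \<in> Mor C \<Longrightarrow> Cod C f \<in> Ob C"
  using cat by (auto simp: category_def)

text \<open>The typing and cancellation rules are conditional simplification rules whose premises are solved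
  by computing domains and codomains, so that equations between long composites can be checked
  by simplification alone.\<close>

lemma Idn_typing [simp]:
  assumes "X \<in> Ob C"
  shows "Idn C X \<in> Mor C" "Dom C (Idn C X) = X" "Cod C (Idn C X) = X"
  using cat assms by (auto simp: category_def Hom_def)

lemma Cmp_typing [simp]:
  assumes "f \<in> Mor C" "g \<in> Mor C" "Dom C g = Cod C f"
  shows "g \<cdot> f \<in> Mor C" "Dom C (g \<cdot> f) = Dom C f" "Cod C (g \<cdot> f) = Cod C g"
proof -
  have "\<forall>X Y Z f g. f \<in> Hom C X Y \<longrightarrow> g \<in> Hom C Y Z \<longrightarrow> g \<cdot> f \<in> Hom C X Z"
    using cat by (simp add: category_def)
  then have "g \<cdot> f \<in> Hom C (Dom C f) (Cod C g)"
    using assms by (auto simp: Hom_def)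
  then show "g \<cdot> f \<in> Mor C" "Dom C (g \<cdot> f) = Dom C f" "Cod C (g \<cdot> f) = Cod C g"
    by (auto simp: Hom_def)
qed

lemma Idn_right [simp]: "f \<in> Mor C \<Longrightarrow> Dom C f = X \<Longrightarrow> f \<cdot> Idn C X = f"
  and Idn_left [simp]: "f \<in> Mor C \<Longrightarrow> Cod C f = X \<Longrightarrow> Idn C X \<cdot> f = f"
  using cat by (auto simp: category_def Hom_def)

lemma Cmp_assoc [simp]:
  assumes "f \<in> Mor C" "g \<in> Mor C" "h \<in> Mor C" "Dom C g = Cod C f" "Dom C h = Cod C g"
  shows "(h \<cdot> g) \<cdot> f = h \<cdot> (g \<cdot> f)"
proof -
  have "\<forall>W X Y Z f g h. f \<in> Hom C W X \<longrightarrow> g \<in> Hom C X Y \<longrightarrow> h \<in> Hom C Y Z \<longrightarrow>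
        (h \<cdot> g) \<cdot> f = h \<cdot> (g \<cdot> f)"
    using cat by (simp add: category_def)
  then show ?thesis
    using assms by (auto simp: Hom_def)
qed

text \<open>Composites are kept bracketed to the right, so an equation \<open>g \<cdot> f = k\<close> has to be
  applicable in the middle of such a composite as well.\<close>

lemma reassoc:
  assumes "g \<cdot> f = k" "f \<in> Mor C" "g \<in> Mor C" "Dom C g = Cod C f" "h \<in> Mor C" "Cod C h = Dom C f"
  shows "g \<cdot> (f \<cdot> h) = k \<cdot> h"
  using assms by (metis Cmp_assoc)

lemma inverse_mors_unique:
  assumes "inverse_mors C f g" "inverse_mors C f h"
  shows "g = h"
proof -
  have "h = h \<cdot> (f \<cdot> g)" "g = (h \<cdot> f) \<cdot> g"
    using assms by (auto simp: inverse_mors_def Hom_def)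
  moreover have "(h \<cdot> f) \<cdot> g = h \<cdot> (f \<cdot> g)"
    using assms by (intro Cmp_assoc) (auto simp: inverse_mors_def Hom_def)
  ultimately show ?thesis by simp
qed

lemma inv_mor_eqI: "inverse_mors C f g \<Longrightarrow> inv_mor C f = g"
  unfolding inv_mor_def by (blast intro: the_equality inverse_mors_unique)

lemma inverse_mors_inv_mor: "is_iso C f \<Longrightarrow> inverse_mors C f (inv_mor C f)"
  unfolding is_iso_def using inv_mor_eqI by auto

lemma is_isoI: "inverse_mors C f g \<Longrightarrow> is_iso C f"
  by (auto simp: is_iso_def)

lemma is_iso_in_Mor: "is_iso C f \<Longrightarrow> f \<in> Mor C"
  by (auto simp: is_iso_def inverse_mors_def)

lemma inverse_mors_sym: "inverse_mors C f g \<Longrightarrow> inverse_mors C g f"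
  by (auto simp: inverse_mors_def Hom_def)

lemma inv_mor_typing [simp]:
  assumes "is_iso C f"
  shows "inv_mor C f \<in> Mor C" "Dom C (inv_mor C f) = Cod C f" "Cod C (inv_mor C f) = Dom C f"
  using inverse_mors_inv_mor [OF assms] by (auto simp: inverse_mors_def Hom_def)

lemma inv_mor_cancel [simp]:
  assumes "is_iso C f"
  shows "inv_mor C f \<cdot> f = Idn C (Dom C f)" "f \<cdot> inv_mor C f = Idn C (Cod C f)"
  using inverse_mors_inv_mor [OF assms] by (auto simp: inverse_mors_def)

lemma inv_mor_cancel_left [simp]:
  assumes "is_iso C f" "h \<in> Mor C"
  shows "Cod C h = Dom C f \<Longrightarrow> inv_mor C f \<cdot> (f \<cdot> h) = h"
    and "Cod C h = Cod C f \<Longrightarrow> f \<cdot> (inv_mor C f \<cdot> h) = h"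
  using assms is_iso_in_Mor [OF assms(1)]
  by (simp_all add: Cmp_assoc [symmetric] del: Cmp_assoc)

lemma is_iso_inv_mor [simp]: "is_iso C f \<Longrightarrow> is_iso C (inv_mor C f)"
  using inverse_mors_inv_mor inverse_mors_sym is_isoI by blast

lemma inv_mor_inv_mor [simp]: "is_iso C f \<Longrightarrow> inv_mor C (inv_mor C f) = f"
  by (simp add: inv_mor_eqI inverse_mors_inv_mor inverse_mors_sym)

lemma inverse_mors_Idn: "X \<in> Ob C \<Longrightarrow> inverse_mors C (Idn C X) (Idn C X)"
  by (simp add: inverse_mors_def Hom_def)

lemma is_iso_Idn [simp]: "X \<in> Ob C \<Longrightarrow> is_iso C (Idn C X)"
  using inverse_mors_Idn is_isoI by blast

lemma inv_mor_Idn [simp]: "X \<in> Ob C \<Longrightarrow> inv_mor C (Idn C X) = Idn C X"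
  using inverse_mors_Idn inv_mor_eqI by blast

lemma inverse_mors_Cmp:
  assumes "inverse_mors C f f'" "inverse_mors C g g'" "Dom C g = Cod C f"
  shows "inverse_mors C (g \<cdot> f) (f' \<cdot> g')"
proof -
  have t: "f \<in> Mor C" "f' \<in> Mor C" "Dom C f' = Cod C f" "Cod C f' = Dom C f"
     "g \<in> Mor C" "g' \<in> Mor C" "Dom C g' = Cod C g" "Cod C g' = Dom C g"
    and e: "f' \<cdot> f = Idn C (Dom C f)" "f \<cdot> f' = Idn C (Cod C f)"
      "g' \<cdot> g = Idn C (Dom C g)" "g \<cdot> g' = Idn C (Cod C g)"
    using assms by (auto simp: inverse_mors_def Hom_def)
  have "g' \<cdot> (g \<cdot> f) = f" "f \<cdot> (f' \<cdot> g') = g'"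
    using t e assms(3) by (simp_all add: Cmp_assoc [symmetric] del: Cmp_assoc)
  with t e assms(3) show ?thesis by (simp add: inverse_mors_def Hom_def)
qed

lemma is_iso_Cmp [simp]: "is_iso C f \<Longrightarrow> is_iso C g \<Longrightarrow> Dom C g = Cod C f \<Longrightarrow> is_iso C (g \<cdot> f)"
  and inv_mor_Cmp: "is_iso C f \<Longrightarrow> is_iso C g \<Longrightarrow> Dom C g = Cod C f \<Longrightarrow>
     inv_mor C (g \<cdot> f) = inv_mor C f \<cdot> inv_mor C g"
  by (meson inverse_mors_inv_mor inverse_mors_Cmp is_isoI,
      meson inverse_mors_inv_mor inverse_mors_Cmp inv_mor_eqI)

lemma iso_cancel_left:
  assumes "is_iso C f" "g \<in> Mor C" "h \<in> Mor C" "Cod C g = Dom C f" "Cod C h = Dom C f"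
    "f \<cdot> g = f \<cdot> h"
  shows "g = h"
  using assms by (metis inv_mor_cancel_left(1))

lemma iso_cancel_right:
  assumes "is_iso C f" "g \<in> Mor C" "h \<in> Mor C" "Dom C g = Cod C f" "Dom C h = Cod C f"
    "g \<cdot> f = h \<cdot> f"
  shows "g = h"
proof -
  have "(g \<cdot> f) \<cdot> inv_mor C f = g" "(h \<cdot> f) \<cdot> inv_mor C f = h"
    using assms(1-5) is_iso_in_Mor [OF assms(1)] by simp_all
  with assms(6) show ?thesis by metis
qed

end

locale moncat_calculus =
  fixes C :: "('x, 'm, 'z) moncat_scheme" (structure)
  assumes moncat: "monoidal_category C"
begin

sublocale cat_calculus C
  using moncat by unfold_locales (simp add: monoidal_category_def)

lemma unit_in_Ob [simp]: "unit C \<in> Ob C"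
  and tob_in_Ob [simp]: "X \<in> Ob C \<Longrightarrow> Y \<in> Ob C \<Longrightarrow> X \<otimes>\<^sub>o Y \<in> Ob C"
  and tmor_Idn [simp]: "X \<in> Ob C \<Longrightarrow> Y \<in> Ob C \<Longrightarrow> Idn C X \<otimes>\<^sub>m Idn C Y = Idn C (X \<otimes>\<^sub>o Y)"
  using moncat by (auto simp: monoidal_category_def)

lemma tmor_typing [simp]:
  assumes "f \<in> Mor C" "g \<in> Mor C"
  shows "f \<otimes>\<^sub>m g \<in> Mor C" "Dom C (f \<otimes>\<^sub>m g) = Dom C f \<otimes>\<^sub>o Dom C g"
    "Cod C (f \<otimes>\<^sub>m g) = Cod C f \<otimes>\<^sub>o Cod C g"
proof -
  have "\<forall>X X' Y Y' f g. f \<in> Hom C X X' \<longrightarrow> g \<in> Hom C Y Y' \<longrightarrow>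
        f \<otimes>\<^sub>m g \<in> Hom C (X \<otimes>\<^sub>o Y) (X' \<otimes>\<^sub>o Y')"
    using moncat by (simp add: monoidal_category_def)
  with assms show "f \<otimes>\<^sub>m g \<in> Mor C" "Dom C (f \<otimes>\<^sub>m g) = Dom C f \<otimes>\<^sub>o Dom C g"
    "Cod C (f \<otimes>\<^sub>m g) = Cod C f \<otimes>\<^sub>o Cod C g"
    by (auto simp: Hom_def)
qed

text \<open>Merging tensor products is used as a simplification rule: it exposes equations between the
  tensor factors.\<close>

lemma interchange [simp]:
  assumes "f \<in> Mor C" "f' \<in> Mor C" "g \<in> Mor C" "g' \<in> Mor C" "Dom C f' = Cod C f" "Dom C g' = Cod C g"
  shows "(f' \<otimes>\<^sub>m g') \<cdot> (f \<otimes>\<^sub>m g) = (f' \<cdot> f) \<otimes>\<^sub>m (g' \<cdot> g)"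
proof -
  have "\<forall>X X' X'' Y Y' Y'' f f' g g'.
        f \<in> Hom C X X' \<longrightarrow> f' \<in> Hom C X' X'' \<longrightarrow> g \<in> Hom C Y Y' \<longrightarrow> g' \<in> Hom C Y' Y'' \<longrightarrow>
        (f' \<cdot> f) \<otimes>\<^sub>m (g' \<cdot> g) = (f' \<otimes>\<^sub>m g') \<cdot> (f \<otimes>\<^sub>m g)"
    using moncat by (simp add: monoidal_category_def)
  with assms show ?thesis by (simp add: Hom_def)
qed

lemma interchange_left [simp]:
  assumes "f \<in> Mor C" "f' \<in> Mor C" "g \<in> Mor C" "g' \<in> Mor C" "Dom C f' = Cod C f" "Dom C g' = Cod C g"
    "h \<in> Mor C" "Cod C h = Dom C f \<otimes>\<^sub>o Dom C g"
  shows "(f' \<otimes>\<^sub>m g') \<cdot> ((f \<otimes>\<^sub>m g) \<cdot> h) = ((f' \<cdot> f) \<otimes>\<^sub>m (g' \<cdot> g)) \<cdot> h"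
  by (rule reassoc [OF interchange]) (use assms in simp_all)

lemma assc_typing [simp]:
  assumes "X \<in> Ob C" "Y \<in> Ob C" "Z \<in> Ob C"
  shows "is_iso C (assc C X Y Z)" "assc C X Y Z \<in> Mor C"
    "Dom C (assc C X Y Z) = (X \<otimes>\<^sub>o Y) \<otimes>\<^sub>o Z" "Cod C (assc C X Y Z) = X \<otimes>\<^sub>o (Y \<otimes>\<^sub>o Z)"
  using moncat assms by (auto simp: monoidal_category_def Hom_def)

lemma lun_typing [simp]:
  assumes "X \<in> Ob C"
  shows "is_iso C (lun C X)" "lun C X \<in> Mor C" "Dom C (lun C X) = unit C \<otimes>\<^sub>o X" "Cod C (lun C X) = X"
  using moncat assms by (auto simp: monoidal_category_def Hom_def)

lemma run_typing [simp]:
  assumes "X \<in> Ob C"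
  shows "is_iso C (run C X)" "run C X \<in> Mor C" "Dom C (run C X) = X \<otimes>\<^sub>o unit C" "Cod C (run C X) = X"
  using moncat assms by (auto simp: monoidal_category_def Hom_def)

lemma assc_natural:
  assumes "f \<in> Mor C" "g \<in> Mor C" "h \<in> Mor C"
  shows "assc C (Cod C f) (Cod C g) (Cod C h) \<cdot> ((f \<otimes>\<^sub>m g) \<otimes>\<^sub>m h) =
     (f \<otimes>\<^sub>m (g \<otimes>\<^sub>m h)) \<cdot> assc C (Dom C f) (Dom C g) (Dom C h)"
proof -
  have "\<forall>X X' Y Y' Z Z' f g h. f \<in> Hom C X X' \<longrightarrow> g \<in> Hom C Y Y' \<longrightarrow> h \<in> Hom C Z Z' \<longrightarrow>
        assc C X' Y' Z' \<cdot> ((f \<otimes>\<^sub>m g) \<otimes>\<^sub>m h) = (f \<otimes>\<^sub>m (g \<otimes>\<^sub>m h)) \<cdot> assc C X Y Z"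
    using moncat by (simp add: monoidal_category_def)
  with assms show ?thesis by (simp add: Hom_def)
qed

lemma iassc_natural:
  assumes "f \<in> Mor C" "g \<in> Mor C" "h \<in> Mor C"
  shows "iassc C (Cod C f) (Cod C g) (Cod C h) \<cdot> (f \<otimes>\<^sub>m (g \<otimes>\<^sub>m h)) =
     ((f \<otimes>\<^sub>m g) \<otimes>\<^sub>m h) \<cdot> iassc C (Dom C f) (Dom C g) (Dom C h)"
proof (rule iso_cancel_right [of "assc C (Dom C f) (Dom C g) (Dom C h)"])
  have "(f \<otimes>\<^sub>m (g \<otimes>\<^sub>m h)) \<cdot> assc C (Dom C f) (Dom C g) (Dom C h) =
      assc C (Cod C f) (Cod C g) (Cod C h) \<cdot> ((f \<otimes>\<^sub>m g) \<otimes>\<^sub>m h)"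
    using assc_natural [OF assms] by simp
  with assms show "(iassc C (Cod C f) (Cod C g) (Cod C h) \<cdot> (f \<otimes>\<^sub>m (g \<otimes>\<^sub>m h))) \<cdot>
        assc C (Dom C f) (Dom C g) (Dom C h) =
      (((f \<otimes>\<^sub>m g) \<otimes>\<^sub>m h) \<cdot> iassc C (Dom C f) (Dom C g) (Dom C h)) \<cdot>
        assc C (Dom C f) (Dom C g) (Dom C h)"
    by simp
qed (use assms in simp_all)

lemma lun_natural: "f \<in> Mor C \<Longrightarrow> lun C (Cod C f) \<cdot> (Idn C (unit C) \<otimes>\<^sub>m f) = f \<cdot> lun C (Dom C f)"
  and run_natural: "f \<in> Mor C \<Longrightarrow> run C (Cod C f) \<cdot> (f \<otimes>\<^sub>m Idn C (unit C)) = f \<cdot> run C (Dom C f)"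
  using moncat by (simp_all add: monoidal_category_def Hom_def)

lemma pentagon:
  assumes "W \<in> Ob C" "X \<in> Ob C" "Y \<in> Ob C" "Z \<in> Ob C"
  shows "(Idn C W \<otimes>\<^sub>m assc C X Y Z) \<cdot> assc C W (X \<otimes>\<^sub>o Y) Z \<cdot> (assc C W X Y \<otimes>\<^sub>m Idn C Z) =
        assc C W X (Y \<otimes>\<^sub>o Z) \<cdot> assc C (W \<otimes>\<^sub>o X) Y Z"
  using moncat assms by (simp add: monoidal_category_def)

lemma triangle:
  assumes "X \<in> Ob C" "Y \<in> Ob C"
  shows "(Idn C X \<otimes>\<^sub>m lun C Y) \<cdot> assc C X (unit C) Y = run C X \<otimes>\<^sub>m Idn C Y"
  using moncat assms by (simp add: monoidal_category_def)

lemma inverse_mors_tmor: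
  assumes "inverse_mors C f f'" "inverse_mors C g g'"
  shows "inverse_mors C (f \<otimes>\<^sub>m g) (f' \<otimes>\<^sub>m g')"
  using assms by (auto simp: inverse_mors_def Hom_def)

lemma is_iso_tmor [simp]: "is_iso C f \<Longrightarrow> is_iso C g \<Longrightarrow> is_iso C (f \<otimes>\<^sub>m g)"
  and inv_mor_tmor: "is_iso C f \<Longrightarrow> is_iso C g \<Longrightarrow> inv_mor C (f \<otimes>\<^sub>m g) = inv_mor C f \<otimes>\<^sub>m inv_mor C g"
  by (meson inverse_mors_inv_mor inverse_mors_tmor is_isoI,
      meson inverse_mors_inv_mor inverse_mors_tmor inv_mor_eqI)

lemma unit_tensor_faithful:
  assumes "f \<in> Mor C" "g \<in> Mor C" "Dom C f = Dom C g" "Cod C f = Cod C g"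
  shows "Idn C (unit C) \<otimes>\<^sub>m f = Idn C (unit C) \<otimes>\<^sub>m g \<Longrightarrow> f = g"
    and "f \<otimes>\<^sub>m Idn C (unit C) = g \<otimes>\<^sub>m Idn C (unit C) \<Longrightarrow> f = g"
proof -
  assume "Idn C (unit C) \<otimes>\<^sub>m f = Idn C (unit C) \<otimes>\<^sub>m g"
  then have "f \<cdot> lun C (Dom C f) = g \<cdot> lun C (Dom C f)"
    using lun_natural [of f] lun_natural [of g] assms by simp
  then show "f = g"
    by (rule iso_cancel_right [rotated -1]) (use assms in simp_all)
next
  assume "f \<otimes>\<^sub>m Idn C (unit C) = g \<otimes>\<^sub>m Idn C (unit C)"
  then have "f \<cdot> run C (Dom C f) = g \<cdot> run C (Dom C f)"
    using run_natural [of f] run_natural [of g] assms by simp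
  then show "f = g"
    by (rule iso_cancel_right [rotated -1]) (use assms in simp_all)
qed

text \<open>Kelly's redundant unit axioms. In both cases the pentagon and the triangle show that the two sides
  agree after tensoring with the unit object, up to an isomorphism, and tensoring with the unit
  object is faithful.\<close>

lemma lun_tob:
  assumes X: "X \<in> Ob C" and Y: "Y \<in> Ob C"
  shows "lun C (X \<otimes>\<^sub>o Y) \<cdot> assc C (unit C) X Y = lun C X \<otimes>\<^sub>m Idn C Y"
proof -
  let ?I = "unit C"
  let ?a = "assc C ?I (?I \<otimes>\<^sub>o X) Y \<cdot> (assc C ?I ?I X \<otimes>\<^sub>m Idn C Y)"
  have "(Idn C ?I \<otimes>\<^sub>m (lun C (X \<otimes>\<^sub>o Y) \<cdot> assc C ?I X Y)) \<cdot> ?a =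
      (Idn C ?I \<otimes>\<^sub>m lun C (X \<otimes>\<^sub>o Y)) \<cdot> (Idn C ?I \<otimes>\<^sub>m assc C ?I X Y) \<cdot> ?a"
    using X Y by simp
  also have "\<dots> = (Idn C ?I \<otimes>\<^sub>m lun C (X \<otimes>\<^sub>o Y)) \<cdot> assc C ?I ?I (X \<otimes>\<^sub>o Y) \<cdot> assc C (?I \<otimes>\<^sub>o ?I) X Y"
    using pentagon [of ?I ?I X Y] X Y by simp
  also have "\<dots> = (run C ?I \<otimes>\<^sub>m Idn C (X \<otimes>\<^sub>o Y)) \<cdot> assc C (?I \<otimes>\<^sub>o ?I) X Y"
    by (rule reassoc [OF triangle]) (use X Y in simp_all)
  also have "\<dots> = assc C ?I X Y \<cdot> ((run C ?I \<otimes>\<^sub>m Idn C X) \<otimes>\<^sub>m Idn C Y)"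
    using assc_natural [of "run C ?I" "Idn C X" "Idn C Y"] X Y by simp
  also have "\<dots> = assc C ?I X Y \<cdot> ((Idn C ?I \<otimes>\<^sub>m lun C X) \<otimes>\<^sub>m Idn C Y) \<cdot> (assc C ?I ?I X \<otimes>\<^sub>m Idn C Y)"
    using X Y by (simp add: triangle)
  also have "\<dots> = (Idn C ?I \<otimes>\<^sub>m (lun C X \<otimes>\<^sub>m Idn C Y)) \<cdot> ?a"
    using reassoc [OF assc_natural [of "Idn C ?I" "lun C X" "Idn C Y"],
        of "assc C ?I ?I X \<otimes>\<^sub>m Idn C Y"] X Y by simp
  finally have "Idn C ?I \<otimes>\<^sub>m (lun C (X \<otimes>\<^sub>o Y) \<cdot> assc C ?I X Y) = Idn C ?I \<otimes>\<^sub>m (lun C X \<otimes>\<^sub>m Idn C Y)"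
    by (rule iso_cancel_right [rotated -1]) (use X Y in simp_all)
  then show ?thesis
    by (rule unit_tensor_faithful(1) [rotated -1]) (use X Y in simp_all)
qed

lemma run_tob:
  assumes X: "X \<in> Ob C" and Y: "Y \<in> Ob C"
  shows "(Idn C X \<otimes>\<^sub>m run C Y) \<cdot> assc C X Y (unit C) = run C (X \<otimes>\<^sub>o Y)"
proof -
  let ?I = "unit C"
  have "assc C X Y ?I \<cdot> (((Idn C X \<otimes>\<^sub>m run C Y) \<cdot> assc C X Y ?I) \<otimes>\<^sub>m Idn C ?I) =
      assc C X Y ?I \<cdot> ((Idn C X \<otimes>\<^sub>m run C Y) \<otimes>\<^sub>m Idn C ?I) \<cdot> (assc C X Y ?I \<otimes>\<^sub>m Idn C ?I)"
    using X Y by simp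
  also have "\<dots> = (Idn C X \<otimes>\<^sub>m (run C Y \<otimes>\<^sub>m Idn C ?I)) \<cdot> assc C X (Y \<otimes>\<^sub>o ?I) ?I \<cdot> (assc C X Y ?I \<otimes>\<^sub>m Idn C ?I)"
    using reassoc [OF assc_natural [of "Idn C X" "run C Y" "Idn C ?I"],
        of "assc C X Y ?I \<otimes>\<^sub>m Idn C ?I"] X Y by simp
  also have "\<dots> = (Idn C X \<otimes>\<^sub>m (Idn C Y \<otimes>\<^sub>m lun C ?I)) \<cdot> (Idn C X \<otimes>\<^sub>m assc C Y ?I ?I) \<cdot>
      assc C X (Y \<otimes>\<^sub>o ?I) ?I \<cdot> (assc C X Y ?I \<otimes>\<^sub>m Idn C ?I)"
    using triangle [of Y ?I] X Y by simp
  also have "\<dots> = (Idn C X \<otimes>\<^sub>m (Idn C Y \<otimes>\<^sub>m lun C ?I)) \<cdot> assc C X Y (?I \<otimes>\<^sub>o ?I) \<cdot> assc C (X \<otimes>\<^sub>o Y) ?I ?I"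
    using pentagon [of X Y ?I ?I] X Y by simp
  also have "\<dots> = assc C X Y ?I \<cdot> (Idn C (X \<otimes>\<^sub>o Y) \<otimes>\<^sub>m lun C ?I) \<cdot> assc C (X \<otimes>\<^sub>o Y) ?I ?I"
    using reassoc [OF assc_natural [of "Idn C X" "Idn C Y" "lun C ?I"],
        of "assc C (X \<otimes>\<^sub>o Y) ?I ?I"] X Y by simp
  also have "\<dots> = assc C X Y ?I \<cdot> (run C (X \<otimes>\<^sub>o Y) \<otimes>\<^sub>m Idn C ?I)"
    using X Y by (simp add: triangle)
  finally have "((Idn C X \<otimes>\<^sub>m run C Y) \<cdot> assc C X Y ?I) \<otimes>\<^sub>m Idn C ?I = run C (X \<otimes>\<^sub>o Y) \<otimes>\<^sub>m Idn C ?I"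
    by (rule iso_cancel_left [rotated -1]) (use X Y in simp_all)
  then show ?thesis
    by (rule unit_tensor_faithful(2) [rotated -1]) (use X Y in simp_all)
qed

text \<open>Naturality of \<open>lun\<close> at \<open>lun\<close> identifies \<open>lun (1 \<otimes> 1)\<close> with \<open>1 \<otimes> lun 1\<close>; Kelly's axiom and
  the triangle then compare \<open>lun 1 \<otimes> 1\<close> with \<open>run 1 \<otimes> 1\<close>.\<close>

lemma lun_unit_eq_run_unit: "lun C (unit C) = run C (unit C)"
proof -
  let ?I = "unit C"
  have "lun C (?I \<otimes>\<^sub>o ?I) = Idn C ?I \<otimes>\<^sub>m lun C ?I"
    by (rule iso_cancel_left [of "lun C ?I"]) (use lun_natural [of "lun C ?I"] in simp_all)
  then have "lun C ?I \<otimes>\<^sub>m Idn C ?I = run C ?I \<otimes>\<^sub>m Idn C ?I"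
    using lun_tob [of ?I ?I] triangle [of ?I ?I] by simp
  then show ?thesis
    by (rule unit_tensor_faithful(2) [rotated -1]) simp_all
qed

end

section \<open>Opposite monoidal categories\<close>

definition opp :: "('x, 'm) moncat \<Rightarrow> ('x, 'm) moncat" where
  "opp C = \<lparr>Ob = Ob C, Mor = Mor C, Dom = Cod C, Cod = Dom C, Idn = Idn C,
     Cmp = (\<lambda>g f. f \<cdot>\<^bsub>C\<^esub> g), tob = tob C, tmor = tmor C, unit = unit C,
     assc = (\<lambda>X Y Z. iassc C X Y Z), lun = (\<lambda>X. inv_mor C (lun C X)), run = (\<lambda>X. inv_mor C (run C X))\<rparr>"

lemma opp_sel [simp]:
  "Ob (opp C) = Ob C" "Mor (opp C) = Mor C" "Dom (opp C) = Cod C" "Cod (opp C) = Dom C"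
  "Idn (opp C) = Idn C" "Cmp (opp C) g f = f \<cdot>\<^bsub>C\<^esub> g" "tob (opp C) = tob C" "tmor (opp C) = tmor C"
  "unit (opp C) = unit C" "assc (opp C) X Y Z = iassc C X Y Z"
  "lun (opp C) X = inv_mor C (lun C X)" "run (opp C) X = inv_mor C (run C X)"
  by (simp_all add: opp_def)

lemma Hom_opp [simp]: "Hom (opp C) X Y = Hom C Y X"
  by (auto simp: Hom_def)

lemma inverse_mors_opp [simp]: "inverse_mors (opp C) = inverse_mors C"
  by (auto simp: inverse_mors_def fun_eq_iff)

lemma is_iso_opp [simp]: "is_iso (opp C) = is_iso C"
  and inv_mor_opp [simp]: "inv_mor (opp C) = inv_mor C"
  by (simp_all add: is_iso_def inv_mor_def fun_eq_iff)

lemma category_opp: "category C \<Longrightarrow> category (opp C)"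
  unfolding category_def by simp

context moncat_calculus
begin

lemma inv_lun_natural:
  assumes "f \<in> Mor C"
  shows "inv_mor C (lun C (Cod C f)) \<cdot> f = (Idn C (unit C) \<otimes>\<^sub>m f) \<cdot> inv_mor C (lun C (Dom C f))"
  by (rule iso_cancel_left [of "lun C (Cod C f)"])
    (use assms reassoc [OF lun_natural [of f], of "inv_mor C (lun C (Dom C f))"] in simp_all)

lemma inv_run_natural:
  assumes "f \<in> Mor C"
  shows "inv_mor C (run C (Cod C f)) \<cdot> f = (f \<otimes>\<^sub>m Idn C (unit C)) \<cdot> inv_mor C (run C (Dom C f))"
  by (rule iso_cancel_left [of "run C (Cod C f)"])
    (use assms reassoc [OF run_natural [of f], of "inv_mor C (run C (Dom C f))"] in simp_all)

lemma pentagon_inv: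
  assumes "W \<in> Ob C" "X \<in> Ob C" "Y \<in> Ob C" "Z \<in> Ob C"
  shows "(iassc C W X Y \<otimes>\<^sub>m Idn C Z) \<cdot> iassc C W (X \<otimes>\<^sub>o Y) Z \<cdot> (Idn C W \<otimes>\<^sub>m iassc C X Y Z) =
     iassc C (W \<otimes>\<^sub>o X) Y Z \<cdot> iassc C W X (Y \<otimes>\<^sub>o Z)"
  using arg_cong [OF pentagon [OF assms], of "inv_mor C"] assms
  by (simp add: inv_mor_Cmp inv_mor_tmor)

lemma triangle_inv:
  assumes "X \<in> Ob C" "Y \<in> Ob C"
  shows "iassc C X (unit C) Y \<cdot> (Idn C X \<otimes>\<^sub>m inv_mor C (lun C Y)) = inv_mor C (run C X) \<otimes>\<^sub>m Idn C Y"
  using arg_cong [OF triangle [OF assms], of "inv_mor C"] assms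
  by (simp add: inv_mor_Cmp inv_mor_tmor)

end

lemma monoidal_category_opp:
  assumes "monoidal_category C"
  shows "monoidal_category (opp C)"
proof -
  interpret moncat_calculus C by unfold_locales (rule assms)
  show ?thesis
    unfolding monoidal_category_def opp_sel Hom_opp is_iso_opp
  proof (intro conjI ballI allI impI)
    fix X X' Y Y' Z Z' f g h
    assume "f \<in> Hom C X' X" "g \<in> Hom C Y' Y" "h \<in> Hom C Z' Z"
    then show "((f \<otimes>\<^sub>m\<^bsub>C\<^esub> g) \<otimes>\<^sub>m\<^bsub>C\<^esub> h) \<cdot>\<^bsub>C\<^esub> iassc C X' Y' Z' = iassc C X Y Z \<cdot>\<^bsub>C\<^esub> (f \<otimes>\<^sub>m\<^bsub>C\<^esub> (g \<otimes>\<^sub>m\<^bsub>C\<^esub> h))"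
      using iassc_natural [of f g h] by (simp add: Hom_def)
  next
    fix X Y f
    assume "f \<in> Hom C Y X"
    then show "inv_mor C (lun C X) \<cdot>\<^bsub>C\<^esub> f = (Idn C (unit C) \<otimes>\<^sub>m\<^bsub>C\<^esub> f) \<cdot>\<^bsub>C\<^esub> inv_mor C (lun C Y)"
      "inv_mor C (run C X) \<cdot>\<^bsub>C\<^esub> f = (f \<otimes>\<^sub>m\<^bsub>C\<^esub> Idn C (unit C)) \<cdot>\<^bsub>C\<^esub> inv_mor C (run C Y)"
      using inv_lun_natural [of f] inv_run_natural [of f] by (simp_all add: Hom_def)
  next
    fix W X Y Z
    assume "W \<in> Ob C" "X \<in> Ob C" "Y \<in> Ob C" "Z \<in> Ob C"
    then show "((iassc C W X Y \<otimes>\<^sub>m\<^bsub>C\<^esub> Idn C Z) \<cdot>\<^bsub>C\<^esub> iassc C W (X \<otimes>\<^sub>o\<^bsub>C\<^esub> Y) Z) \<cdot>\<^bsub>C\<^esub> (Idn C W \<otimes>\<^sub>m\<^bsub>C\<^esub> iassc C X Y Z) =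
       iassc C (W \<otimes>\<^sub>o\<^bsub>C\<^esub> X) Y Z \<cdot>\<^bsub>C\<^esub> iassc C W X (Y \<otimes>\<^sub>o\<^bsub>C\<^esub> Z)"
      using pentagon_inv [of W X Y Z] by simp
  next
    fix X Y
    assume "X \<in> Ob C" "Y \<in> Ob C"
    then show "iassc C X (unit C) Y \<cdot>\<^bsub>C\<^esub> (Idn C X \<otimes>\<^sub>m\<^bsub>C\<^esub> inv_mor C (lun C Y)) = inv_mor C (run C X) \<otimes>\<^sub>m\<^bsub>C\<^esub> Idn C Y"
      by (rule triangle_inv)
  qed (use category_opp [OF cat] in \<open>simp_all add: Hom_def\<close>)
qed

section \<open>Half-braidings\<close>

text \<open>The half-braidings of the center are restricted to the objects of \<open>C\<close>. Calculations are
  easier with the unrestricted formulas; the restrictions reappear only when the center itself does.\<close>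

definition hb_tensor :: "('x, 'm, 'z) moncat_scheme \<Rightarrow> 'x \<Rightarrow> ('x \<Rightarrow> 'm) \<Rightarrow> 'x \<Rightarrow> ('x \<Rightarrow> 'm) \<Rightarrow> 'x \<Rightarrow> 'm" where
  "hb_tensor C X \<sigma> Y \<tau> Z = assc C Z X Y \<cdot>\<^bsub>C\<^esub> (\<sigma> Z \<otimes>\<^sub>m\<^bsub>C\<^esub> Idn C Y) \<cdot>\<^bsub>C\<^esub> iassc C X Z Y
     \<cdot>\<^bsub>C\<^esub> (Idn C X \<otimes>\<^sub>m\<^bsub>C\<^esub> \<tau> Z) \<cdot>\<^bsub>C\<^esub> assc C X Y Z"

definition hb_unit :: "('x, 'm, 'z) moncat_scheme \<Rightarrow> 'x \<Rightarrow> 'm" where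
  "hb_unit C Z = inv_mor C (run C Z) \<cdot>\<^bsub>C\<^esub> lun C Z"

definition hb_mor :: "('x, 'm, 'z) moncat_scheme \<Rightarrow> 'x \<Rightarrow> ('x \<Rightarrow> 'm) \<Rightarrow> 'm \<Rightarrow> 'x \<Rightarrow> ('x \<Rightarrow> 'm) \<Rightarrow> bool" where
  "hb_mor C X \<sigma> f Y \<tau> \<longleftrightarrow> f \<in> Hom C X Y \<and>
     (\<forall>Z\<in>Ob C. \<tau> Z \<cdot>\<^bsub>C\<^esub> (f \<otimes>\<^sub>m\<^bsub>C\<^esub> Idn C Z) = (Idn C Z \<otimes>\<^sub>m\<^bsub>C\<^esub> f) \<cdot>\<^bsub>C\<^esub> \<sigma> Z)"

context moncat_calculus
begin

lemma half_braiding_typing: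
  assumes "half_braiding C A \<sigma>"
  shows "A \<in> Ob C" "Z \<in> Ob C \<Longrightarrow> is_iso C (\<sigma> Z)" "Z \<in> Ob C \<Longrightarrow> \<sigma> Z \<in> Mor C"
    "Z \<in> Ob C \<Longrightarrow> Dom C (\<sigma> Z) = A \<otimes>\<^sub>o Z" "Z \<in> Ob C \<Longrightarrow> Cod C (\<sigma> Z) = Z \<otimes>\<^sub>o A"
  using assms by (auto simp: half_braiding_def Hom_def)

lemma half_braiding_natural:
  assumes "half_braiding C A \<sigma>" "f \<in> Mor C"
  shows "\<sigma> (Cod C f) \<cdot> (Idn C A \<otimes>\<^sub>m f) = (f \<otimes>\<^sub>m Idn C A) \<cdot> \<sigma> (Dom C f)"
  using assms by (simp add: half_braiding_def Hom_def)

lemma half_braiding_hexagon: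
  assumes "half_braiding C A \<sigma>" "X \<in> Ob C" "Y \<in> Ob C"
  shows "\<sigma> (X \<otimes>\<^sub>o Y) = iassc C X Y A \<cdot> (Idn C X \<otimes>\<^sub>m \<sigma> Y) \<cdot> assc C X A Y
            \<cdot> (\<sigma> X \<otimes>\<^sub>m Idn C Y) \<cdot> iassc C A X Y"
  using assms unfolding half_braiding_def by blast

text \<open>Composing the hexagon with \<open>run\<close> and applying Kelly's axioms and the triangle removes
  all associators.\<close>

lemma hb_unit_half_braiding: "half_braiding C (unit C) (hb_unit C)"
proof -
  have nat: "(f \<otimes>\<^sub>m Idn C (unit C)) \<cdot> hb_unit C X = hb_unit C Y \<cdot> (Idn C (unit C) \<otimes>\<^sub>m f)"
    if "f \<in> Hom C X Y" for X Y f
  proof -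
    have f: "f \<in> Mor C" "Dom C f = X" "Cod C f = Y"
      using in_HomD [OF that] by auto
    then have XY: "X \<in> Ob C" "Y \<in> Ob C" by auto
    have "hb_unit C Y \<cdot> (Idn C (unit C) \<otimes>\<^sub>m f) = inv_mor C (run C Y) \<cdot> (f \<cdot> lun C X)"
      using lun_natural [OF f(1)] f XY by (simp add: hb_unit_def)
    also have "\<dots> = ((f \<otimes>\<^sub>m Idn C (unit C)) \<cdot> inv_mor C (run C X)) \<cdot> lun C X"
      by (rule reassoc) (use inv_run_natural [OF f(1)] f XY in simp_all)
    finally show ?thesis
      using f XY by (simp add: hb_unit_def)
  qed
  have hex: "hb_unit C (X \<otimes>\<^sub>o Y) =
          iassc C X Y (unit C) \<cdot> (Idn C X \<otimes>\<^sub>m hb_unit C Y) \<cdot> assc C X (unit C) Y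
            \<cdot> (hb_unit C X \<otimes>\<^sub>m Idn C Y) \<cdot> iassc C (unit C) X Y"
    if X: "X \<in> Ob C" and Y: "Y \<in> Ob C" for X Y
  proof -
    have "run C (X \<otimes>\<^sub>o Y) \<cdot> iassc C X Y (unit C) \<cdot> (Idn C X \<otimes>\<^sub>m hb_unit C Y) \<cdot> assc C X (unit C) Y
            \<cdot> (hb_unit C X \<otimes>\<^sub>m Idn C Y) \<cdot> iassc C (unit C) X Y =
      (Idn C X \<otimes>\<^sub>m run C Y) \<cdot> (Idn C X \<otimes>\<^sub>m hb_unit C Y) \<cdot> assc C X (unit C) Y
            \<cdot> (hb_unit C X \<otimes>\<^sub>m Idn C Y) \<cdot> iassc C (unit C) X Y"
      using X Y by (simp add: run_tob [symmetric] hb_unit_def is_iso_in_Mor)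
    also have "\<dots> = (Idn C X \<otimes>\<^sub>m lun C Y) \<cdot> assc C X (unit C) Y
            \<cdot> (hb_unit C X \<otimes>\<^sub>m Idn C Y) \<cdot> iassc C (unit C) X Y"
      using X Y by (simp add: hb_unit_def)
    also have "\<dots> = (run C X \<otimes>\<^sub>m Idn C Y) \<cdot> (hb_unit C X \<otimes>\<^sub>m Idn C Y) \<cdot> iassc C (unit C) X Y"
      by (rule reassoc [OF triangle]) (use X Y in \<open>simp_all add: hb_unit_def\<close>)
    also have "\<dots> = (lun C X \<otimes>\<^sub>m Idn C Y) \<cdot> iassc C (unit C) X Y"
      using X Y by (simp add: hb_unit_def)
    also have "\<dots> = lun C (X \<otimes>\<^sub>o Y)"
      using X Y by (simp add: lun_tob [symmetric])
    also have "\<dots> = run C (X \<otimes>\<^sub>o Y) \<cdot> hb_unit C (X \<otimes>\<^sub>o Y)"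
      using X Y by (simp add: hb_unit_def)
    finally show ?thesis
      by (rule iso_cancel_left [rotated -1, symmetric]) (use X Y in \<open>simp_all add: hb_unit_def\<close>)
  qed
  show ?thesis
    unfolding half_braiding_def
  proof (intro conjI ballI allI impI)
    fix X Y assume "X \<in> Ob C" "Y \<in> Ob C"
    then show "hb_unit C (X \<otimes>\<^sub>o Y) =
          iassc C X Y (unit C) \<cdot> (Idn C X \<otimes>\<^sub>m hb_unit C Y) \<cdot> assc C X (unit C) Y
            \<cdot> (hb_unit C X \<otimes>\<^sub>m Idn C Y) \<cdot> iassc C (unit C) X Y"
      by (rule hex)
  qed (simp_all add: nat, simp_all add: hb_unit_def Hom_def)
qed

lemma half_braiding_restrict:
  assumes "half_braiding C A \<sigma>"
  shows "half_braiding C A (restrict \<sigma> (Ob C))"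
  unfolding half_braiding_def
proof (intro conjI ballI allI impI)
  fix X Y f assume "f \<in> Hom C X Y"
  then show "(f \<otimes>\<^sub>m Idn C A) \<cdot> restrict \<sigma> (Ob C) X = restrict \<sigma> (Ob C) Y \<cdot> (Idn C A \<otimes>\<^sub>m f)"
    using half_braiding_natural [OF assms, of f] in_HomD [of f X Y] by auto
next
  fix X Y assume "X \<in> Ob C" "Y \<in> Ob C"
  then show "restrict \<sigma> (Ob C) (X \<otimes>\<^sub>o Y) = iassc C X Y A \<cdot> (Idn C X \<otimes>\<^sub>m restrict \<sigma> (Ob C) Y)
       \<cdot> assc C X A Y \<cdot> (restrict \<sigma> (Ob C) X \<otimes>\<^sub>m Idn C Y) \<cdot> iassc C A X Y"
    using half_braiding_hexagon [OF assms, of X Y] by simp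
qed (use half_braiding_typing [OF assms] in \<open>simp_all add: Hom_def\<close>)

lemma hb_tensor_typing:
  assumes "half_braiding C X \<sigma>" "half_braiding C Y \<tau>" "Z \<in> Ob C"
  shows "is_iso C (hb_tensor C X \<sigma> Y \<tau> Z)" "hb_tensor C X \<sigma> Y \<tau> Z \<in> Mor C"
    "Dom C (hb_tensor C X \<sigma> Y \<tau> Z) = (X \<otimes>\<^sub>o Y) \<otimes>\<^sub>o Z"
    "Cod C (hb_tensor C X \<sigma> Y \<tau> Z) = Z \<otimes>\<^sub>o (X \<otimes>\<^sub>o Y)"
  unfolding hb_tensor_def
  using half_braiding_typing [OF assms(1)] half_braiding_typing [OF assms(2)] assms(3) by simp_all

lemma hb_tensor_natural:
  assumes \<sigma>: "half_braiding C X \<sigma>" and \<tau>: "half_braiding C Y \<tau>" and f: "f \<in> Mor C"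
  shows "(f \<otimes>\<^sub>m Idn C (X \<otimes>\<^sub>o Y)) \<cdot> hb_tensor C X \<sigma> Y \<tau> (Dom C f) =
     hb_tensor C X \<sigma> Y \<tau> (Cod C f) \<cdot> (Idn C (X \<otimes>\<^sub>o Y) \<otimes>\<^sub>m f)"
proof -
  note t [simp] = half_braiding_typing [OF \<sigma>] half_braiding_typing [OF \<tau>]
  let ?S = "Dom C f" and ?T = "Cod C f"
  have "hb_tensor C X \<sigma> Y \<tau> ?T \<cdot> (Idn C (X \<otimes>\<^sub>o Y) \<otimes>\<^sub>m f) =
    assc C ?T X Y \<cdot> (\<sigma> ?T \<otimes>\<^sub>m Idn C Y) \<cdot> iassc C X ?T Y
     \<cdot> (Idn C X \<otimes>\<^sub>m \<tau> ?T) \<cdot> assc C X Y ?T \<cdot> ((Idn C X \<otimes>\<^sub>m Idn C Y) \<otimes>\<^sub>m f)"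
    using f by (simp add: hb_tensor_def)
  also have "\<dots> = assc C ?T X Y \<cdot> (\<sigma> ?T \<otimes>\<^sub>m Idn C Y) \<cdot> iassc C X ?T Y
     \<cdot> (Idn C X \<otimes>\<^sub>m \<tau> ?T) \<cdot> (Idn C X \<otimes>\<^sub>m (Idn C Y \<otimes>\<^sub>m f)) \<cdot> assc C X Y ?S"
    using f assc_natural [of "Idn C X" "Idn C Y" f] by simp
  also have "\<dots> = assc C ?T X Y \<cdot> (\<sigma> ?T \<otimes>\<^sub>m Idn C Y) \<cdot> iassc C X ?T Y
     \<cdot> (Idn C X \<otimes>\<^sub>m (f \<otimes>\<^sub>m Idn C Y)) \<cdot> (Idn C X \<otimes>\<^sub>m \<tau> ?S) \<cdot> assc C X Y ?S"
    using f half_braiding_natural [OF \<tau> f] by simp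
  also have "\<dots> = assc C ?T X Y \<cdot> (\<sigma> ?T \<otimes>\<^sub>m Idn C Y) \<cdot> ((Idn C X \<otimes>\<^sub>m f) \<otimes>\<^sub>m Idn C Y) \<cdot> iassc C X ?S Y
     \<cdot> (Idn C X \<otimes>\<^sub>m \<tau> ?S) \<cdot> assc C X Y ?S"
    using f reassoc [OF iassc_natural [of "Idn C X" f "Idn C Y"],
        of "(Idn C X \<otimes>\<^sub>m \<tau> ?S) \<cdot> assc C X Y ?S"] by simp
  also have "\<dots> = assc C ?T X Y \<cdot> ((f \<otimes>\<^sub>m Idn C X) \<otimes>\<^sub>m Idn C Y) \<cdot> (\<sigma> ?S \<otimes>\<^sub>m Idn C Y) \<cdot> iassc C X ?S Y
     \<cdot> (Idn C X \<otimes>\<^sub>m \<tau> ?S) \<cdot> assc C X Y ?S"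
    using f half_braiding_natural [OF \<sigma> f] by simp
  also have "\<dots> = (f \<otimes>\<^sub>m (Idn C X \<otimes>\<^sub>m Idn C Y)) \<cdot> assc C ?S X Y \<cdot> (\<sigma> ?S \<otimes>\<^sub>m Idn C Y) \<cdot> iassc C X ?S Y
     \<cdot> (Idn C X \<otimes>\<^sub>m \<tau> ?S) \<cdot> assc C X Y ?S"
    using f reassoc [OF assc_natural [of f "Idn C X" "Idn C Y"], of "(\<sigma> ?S \<otimes>\<^sub>m Idn C Y) \<cdot> iassc C X ?S Y
     \<cdot> (Idn C X \<otimes>\<^sub>m \<tau> ?S) \<cdot> assc C X Y ?S"] by simp
  finally show ?thesis
    using f by (simp add: hb_tensor_def)
qed

end

section \<open>Strict extensions and cofree objects\<close>

text \<open>The relation between \<open>C\<close> and the full image of a strong monoidal functor on \<open>C\<close>: the objects and their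
  tensor products agree, the morphisms need not.\<close>

locale strict_extension =
  C: moncat_calculus C + E: moncat_calculus E
  for C :: "('x, 'm) moncat" (structure) and E :: "('x, 'n) moncat" +
  fixes F :: "'m \<Rightarrow> 'n"
  assumes Ob_E [simp]: "Ob E = Ob C"
    and tob_E [simp]: "tob E = tob C"
    and unit_E [simp]: "unit E = unit C"
    and F_typing [simp]: "f \<in> Mor C \<Longrightarrow> F f \<in> Mor E" "f \<in> Mor C \<Longrightarrow> Dom E (F f) = Dom C f"
      "f \<in> Mor C \<Longrightarrow> Cod E (F f) = Cod C f"
    and F_Idn [simp]: "X \<in> Ob C \<Longrightarrow> F (Idn C X) = Idn E X"
    and F_Cmp [simp]: "f \<in> Mor C \<Longrightarrow> g \<in> Mor C \<Longrightarrow> Dom C g = Cod C f \<Longrightarrow> F (g \<cdot> f) = F g \<cdot>\<^bsub>E\<^esub> F f"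
    and F_tmor [simp]: "f \<in> Mor C \<Longrightarrow> g \<in> Mor C \<Longrightarrow> F (f \<otimes>\<^sub>m g) = F f \<otimes>\<^sub>m\<^bsub>E\<^esub> F g"
    and F_assc [simp]: "X \<in> Ob C \<Longrightarrow> Y \<in> Ob C \<Longrightarrow> Z \<in> Ob C \<Longrightarrow> F (assc C X Y Z) = assc E X Y Z"
    and F_lun [simp]: "X \<in> Ob C \<Longrightarrow> F (lun C X) = lun E X"
    and F_run [simp]: "X \<in> Ob C \<Longrightarrow> F (run C X) = run E X"
begin

abbreviation E_Cmp (infixr \<open>\<bullet>\<close> 70) where "g \<bullet> f \<equiv> g \<cdot>\<^bsub>E\<^esub> f"
abbreviation E_tmor (infixr \<open>\<star>\<close> 75) where "f \<star> g \<equiv> f \<otimes>\<^sub>m\<^bsub>E\<^esub> g"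

lemma inverse_mors_F: "inverse_mors C f g \<Longrightarrow> inverse_mors E (F f) (F g)"
  unfolding inverse_mors_def by (auto simp: Hom_def simp flip: F_Cmp)

lemma is_iso_F [simp]: "is_iso C f \<Longrightarrow> is_iso E (F f)"
  and F_inv_mor [simp]: "is_iso C f \<Longrightarrow> F (inv_mor C f) = inv_mor E (F f)"
  by (meson C.inverse_mors_inv_mor inverse_mors_F E.is_isoI,
      metis C.inverse_mors_inv_mor inverse_mors_F E.inv_mor_eqI)

text \<open>\<open>G X\<close> is cofree on \<open>X\<close> with respect to \<open>F : C \<rightarrow> E\<close>, with counit \<open>\<kappa> X : G X \<rightarrow> X\<close>. The lifts through the
  counits are always constructed explicitly, so the predicate records only their uniqueness, which is
  what turns equations in \<open>E\<close> into equations in \<open>C\<close>.\<close>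

definition cofree :: "('x \<Rightarrow> 'x) \<Rightarrow> ('x \<Rightarrow> 'n) \<Rightarrow> bool" where
  "cofree G \<kappa> \<longleftrightarrow> (\<forall>X\<in>Ob C. G X \<in> Ob C \<and> \<kappa> X \<in> Hom E (G X) X \<and>
     (\<forall>f\<in>Mor C. \<forall>g\<in>Mor C. Dom C f = Dom C g \<longrightarrow> Cod C f = G X \<longrightarrow> Cod C g = G X \<longrightarrow>
        \<kappa> X \<bullet> F f = \<kappa> X \<bullet> F g \<longrightarrow> f = g))"

lemma cofree_typing:
  assumes "cofree G \<kappa>" "X \<in> Ob C"
  shows "G X \<in> Ob C" "\<kappa> X \<in> Mor E" "Dom E (\<kappa> X) = G X" "Cod E (\<kappa> X) = X"
  using assms by (auto simp: cofree_def Hom_def)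

lemma cofree_unique:
  assumes "cofree G \<kappa>" "X \<in> Ob C" "f \<in> Mor C" "g \<in> Mor C" "Dom C f = Dom C g"
    "Cod C f = G X" "Cod C g = G X" "\<kappa> X \<bullet> F f = \<kappa> X \<bullet> F g"
  shows "f = g"
  using assms unfolding cofree_def by blast

text \<open>The lax structure on \<open>G\<close> is the one for which the counit \<open>\<kappa>\<close> is monoidal.\<close>

definition cofree_lax :: "('x, 'm, 'x, 'm) mfunct \<Rightarrow> ('x \<Rightarrow> 'n) \<Rightarrow> bool" where
  "cofree_lax G \<kappa> \<longleftrightarrow> is_functor C C G \<and> cofree (fo G) \<kappa> \<and>
     (\<forall>f\<in>Mor C. \<kappa> (Cod C f) \<bullet> F (fm G f) = F f \<bullet> \<kappa> (Dom C f)) \<and>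
     (\<forall>X\<in>Ob C. \<forall>Y\<in>Ob C. fmul G X Y \<in> Hom C (fo G X \<otimes>\<^sub>o fo G Y) (fo G (X \<otimes>\<^sub>o Y)) \<and>
        \<kappa> (X \<otimes>\<^sub>o Y) \<bullet> F (fmul G X Y) = \<kappa> X \<star> \<kappa> Y) \<and>
     fun0 G \<in> Hom C (unit C) (fo G (unit C)) \<and> \<kappa> (unit C) \<bullet> F (fun0 G) = Idn E (unit C)"

lemma cofree_lax_cong:
  assumes "cofree_lax G \<kappa>" "fo G' = fo G" "fm G' = fm G"
    "\<And>X Y. X \<in> Ob C \<Longrightarrow> Y \<in> Ob C \<Longrightarrow> fmul G' X Y = fmul G X Y" "fun0 G' = fun0 G"
  shows "cofree_lax G' \<kappa>"
  using assms by (simp add: cofree_lax_def is_functor_def)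

lemma counit_inverse:
  assumes "is_iso C f" "k \<in> Mor E" "Dom E k = Cod C f" "k \<bullet> F f = k'"
  shows "k' \<bullet> F (inv_mor C f) = k"
  using assms C.is_iso_in_Mor [OF assms(1)] by (auto simp flip: assms(4))

lemma functor_typing:
  assumes "is_functor C C G"
  shows "X \<in> Ob C \<Longrightarrow> fo G X \<in> Ob C" "f \<in> Mor C \<Longrightarrow> fm G f \<in> Mor C"
    "f \<in> Mor C \<Longrightarrow> Dom C (fm G f) = fo G (Dom C f)" "f \<in> Mor C \<Longrightarrow> Cod C (fm G f) = fo G (Cod C f)"
  using assms unfolding is_functor_def by (auto simp: Hom_def)

text \<open>The axioms hold because both sides of each of them become equal after composition with the
  counit: there they reduce to naturality of the structure isomorphisms of \<open>E\<close>.\<close>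

theorem cofree_lax_monoidal:
  assumes "cofree_lax G \<kappa>"
  shows "lax_monoidal C C G"
proof -
  have fnc: "is_functor C C G" and co: "cofree (fo G) \<kappa>"
    and nat [simp]: "\<And>f. f \<in> Mor C \<Longrightarrow> \<kappa> (Cod C f) \<bullet> F (fm G f) = F f \<bullet> \<kappa> (Dom C f)"
    and m: "\<And>X Y. X \<in> Ob C \<Longrightarrow> Y \<in> Ob C \<Longrightarrow> \<kappa> (X \<otimes>\<^sub>o Y) \<bullet> F (fmul G X Y) = \<kappa> X \<star> \<kappa> Y"
    and u: "\<kappa> (unit C) \<bullet> F (fun0 G) = Idn E (unit C)"
    and m_typing [simp]: "\<And>X Y. X \<in> Ob C \<Longrightarrow> Y \<in> Ob C \<Longrightarrow> fmul G X Y \<in> Mor C"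
      "\<And>X Y. X \<in> Ob C \<Longrightarrow> Y \<in> Ob C \<Longrightarrow> Dom C (fmul G X Y) = fo G X \<otimes>\<^sub>o fo G Y"
      "\<And>X Y. X \<in> Ob C \<Longrightarrow> Y \<in> Ob C \<Longrightarrow> Cod C (fmul G X Y) = fo G (X \<otimes>\<^sub>o Y)"
    and u_typing [simp]: "fun0 G \<in> Mor C" "Dom C (fun0 G) = unit C" "Cod C (fun0 G) = fo G (unit C)"
    using assms by (auto simp: cofree_lax_def Hom_def)
  note t [simp] = functor_typing [OF fnc] cofree_typing [OF co]
  have m_left: "\<kappa> (X \<otimes>\<^sub>o Y) \<bullet> (F (fmul G X Y) \<bullet> h) = (\<kappa> X \<star> \<kappa> Y) \<bullet> h"
    if "X \<in> Ob C" "Y \<in> Ob C" "h \<in> Mor E" "Cod E h = fo G X \<otimes>\<^sub>o fo G Y" for X Y h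
    by (rule E.reassoc [OF m]) (use that in simp_all)
  have nat_left: "\<kappa> Y \<bullet> (F (fm G f) \<bullet> h) = (F f \<bullet> \<kappa> X) \<bullet> h"
    if "f \<in> Mor C" "Dom C f = X" "Cod C f = Y" "X \<in> Ob C" "Y \<in> Ob C" "h \<in> Mor E" "Cod E h = fo G X" for f h X Y
    by (rule E.reassoc) (use that nat [of f] in simp_all)
  note r = m m_left nat_left u
  show ?thesis
    unfolding lax_monoidal_def
  proof (intro conjI ballI allI impI fnc)
    fix X X' Y Y' f g assume "f \<in> Hom C X X'" "g \<in> Hom C Y Y'"
    then have fg [simp]: "f \<in> Mor C" "g \<in> Mor C"
      and eq: "X = Dom C f" "X' = Cod C f" "Y = Dom C g" "Y' = Cod C g"
      by (auto simp: Hom_def)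
    show "fm G (f \<otimes>\<^sub>m g) \<cdot> fmul G X Y = fmul G X' Y' \<cdot> (fm G f \<otimes>\<^sub>m fm G g)"
      unfolding eq
      by (rule cofree_unique [OF co, of "Cod C f \<otimes>\<^sub>o Cod C g"]) (simp_all add: r)
  next
    fix X Y Z assume X [simp]: "X \<in> Ob C" "Y \<in> Ob C" "Z \<in> Ob C"
    have [simp]: "\<kappa> X \<star> (\<kappa> Y \<star> \<kappa> Z) \<bullet> assc E (fo G X) (fo G Y) (fo G Z) =
        assc E X Y Z \<bullet> ((\<kappa> X \<star> \<kappa> Y) \<star> \<kappa> Z)"
      using E.assc_natural [of "\<kappa> X" "\<kappa> Y" "\<kappa> Z"] by simp
    show "fm G (assc C X Y Z) \<cdot> fmul G (X \<otimes>\<^sub>o Y) Z \<cdot> (fmul G X Y \<otimes>\<^sub>m Idn C (fo G Z)) =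
        fmul G X (Y \<otimes>\<^sub>o Z) \<cdot> (Idn C (fo G X) \<otimes>\<^sub>m fmul G Y Z) \<cdot> assc C (fo G X) (fo G Y) (fo G Z)"
      by (rule cofree_unique [OF co, of "X \<otimes>\<^sub>o (Y \<otimes>\<^sub>o Z)"])
        (simp_all add: r)
  next
    fix X assume X [simp]: "X \<in> Ob C"
    have "\<kappa> X \<bullet> lun E (fo G X) = lun E X \<bullet> (Idn E (unit C) \<star> \<kappa> X)"
      using E.lun_natural [of "\<kappa> X"] by simp
    then show "fm G (lun C X) \<cdot> fmul G (unit C) X \<cdot> (fun0 G \<otimes>\<^sub>m Idn C (fo G X)) = lun C (fo G X)"
      by (intro cofree_unique [OF co, of X]) (simp_all add: r)
    have "\<kappa> X \<bullet> run E (fo G X) = run E X \<bullet> (\<kappa> X \<star> Idn E (unit C))"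
      using E.run_natural [of "\<kappa> X"] by simp
    then show "fm G (run C X) \<cdot> fmul G X (unit C) \<cdot> (Idn C (fo G X) \<otimes>\<^sub>m fun0 G) = run C (fo G X)"
      by (intro cofree_unique [OF co, of X]) (simp_all add: r)
  qed (simp_all add: Hom_def)
qed

text \<open>Naturality of \<open>\<tau>\<close> and its compatibility with the tensor structures are equations between morphisms into
  cofree objects. They hold because both sides have the same composite with the counit \<open>\<kappa>'\<close>.\<close>

theorem cofree_lax_monoidal_iso:
  assumes G: "cofree_lax G \<kappa>" and G': "cofree_lax G' \<kappa>'"
    and \<tau>_Hom: "\<And>X. X \<in> Ob C \<Longrightarrow> \<tau> X \<in> Hom C (fo G X) (fo G' X)"
    and \<tau>_iso: "\<And>X. X \<in> Ob C \<Longrightarrow> is_iso C (\<tau> X)"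
    and \<tau>: "\<And>X. X \<in> Ob C \<Longrightarrow> \<kappa>' X \<bullet> F (\<tau> X) = \<kappa> X"
  shows "lax_monoidal_iso C C G G' \<tau>"
proof -
  have fnc: "is_functor C C G" "is_functor C C G'"
    and co: "cofree (fo G) \<kappa>" "cofree (fo G') \<kappa>'"
    and nat: "\<And>f. f \<in> Mor C \<Longrightarrow> \<kappa> (Cod C f) \<bullet> F (fm G f) = F f \<bullet> \<kappa> (Dom C f)"
      "\<And>f. f \<in> Mor C \<Longrightarrow> \<kappa>' (Cod C f) \<bullet> F (fm G' f) = F f \<bullet> \<kappa>' (Dom C f)"
    and m: "\<And>X Y. X \<in> Ob C \<Longrightarrow> Y \<in> Ob C \<Longrightarrow> \<kappa> (X \<otimes>\<^sub>o Y) \<bullet> F (fmul G X Y) = \<kappa> X \<star> \<kappa> Y"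
      "\<And>X Y. X \<in> Ob C \<Longrightarrow> Y \<in> Ob C \<Longrightarrow> \<kappa>' (X \<otimes>\<^sub>o Y) \<bullet> F (fmul G' X Y) = \<kappa>' X \<star> \<kappa>' Y"
    and u: "\<kappa> (unit C) \<bullet> F (fun0 G) = Idn E (unit C)" "\<kappa>' (unit C) \<bullet> F (fun0 G') = Idn E (unit C)"
    and m_typing [simp]: "\<And>X Y. X \<in> Ob C \<Longrightarrow> Y \<in> Ob C \<Longrightarrow> fmul G X Y \<in> Mor C"
      "\<And>X Y. X \<in> Ob C \<Longrightarrow> Y \<in> Ob C \<Longrightarrow> Dom C (fmul G X Y) = fo G X \<otimes>\<^sub>o fo G Y"
      "\<And>X Y. X \<in> Ob C \<Longrightarrow> Y \<in> Ob C \<Longrightarrow> Cod C (fmul G X Y) = fo G (X \<otimes>\<^sub>o Y)"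
      "\<And>X Y. X \<in> Ob C \<Longrightarrow> Y \<in> Ob C \<Longrightarrow> fmul G' X Y \<in> Mor C"
      "\<And>X Y. X \<in> Ob C \<Longrightarrow> Y \<in> Ob C \<Longrightarrow> Dom C (fmul G' X Y) = fo G' X \<otimes>\<^sub>o fo G' Y"
      "\<And>X Y. X \<in> Ob C \<Longrightarrow> Y \<in> Ob C \<Longrightarrow> Cod C (fmul G' X Y) = fo G' (X \<otimes>\<^sub>o Y)"
    and u_typing [simp]: "fun0 G \<in> Mor C" "Dom C (fun0 G) = unit C" "Cod C (fun0 G) = fo G (unit C)"
      "fun0 G' \<in> Mor C" "Dom C (fun0 G') = unit C" "Cod C (fun0 G') = fo G' (unit C)"
    using G G' by (auto simp: cofree_lax_def Hom_def)
  have \<tau>_typing [simp]: "X \<in> Ob C \<Longrightarrow> \<tau> X \<in> Mor C" "X \<in> Ob C \<Longrightarrow> Dom C (\<tau> X) = fo G X"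
    "X \<in> Ob C \<Longrightarrow> Cod C (\<tau> X) = fo G' X" for X
    using \<tau>_Hom [of X] by (auto simp: Hom_def)
  note t [simp] = functor_typing [OF fnc(1)] cofree_typing [OF co(1)]
    functor_typing [OF fnc(2)] cofree_typing [OF co(2)]
  have \<tau>_left: "\<kappa>' X \<bullet> (F (\<tau> X) \<bullet> h) = \<kappa> X \<bullet> h"
    if "X \<in> Ob C" "h \<in> Mor E" "Cod E h = fo G X" for X h
    by (rule E.reassoc [OF \<tau>]) (use that in simp_all)
  have m_left: "\<kappa>' (X \<otimes>\<^sub>o Y) \<bullet> (F (fmul G' X Y) \<bullet> h) = (\<kappa>' X \<star> \<kappa>' Y) \<bullet> h"
    if "X \<in> Ob C" "Y \<in> Ob C" "h \<in> Mor E" "Cod E h = fo G' X \<otimes>\<^sub>o fo G' Y" for X Y h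
    by (rule E.reassoc [OF m(2)]) (use that in simp_all)
  have nat_left: "\<kappa>' (Cod C f) \<bullet> (F (fm G' f) \<bullet> h) = (F f \<bullet> \<kappa>' (Dom C f)) \<bullet> h"
    if "f \<in> Mor C" "h \<in> Mor E" "Cod E h = fo G' (Dom C f)" for f h
    by (rule E.reassoc) (use that nat(2) [of f] in simp_all)
  note r = \<tau> \<tau>_left m m_left nat nat_left u
  have nat_transf: "nat_transf C C G G' \<tau>"
    unfolding nat_transf_def
  proof (intro conjI ballI allI impI)
    fix X Y f assume "f \<in> Hom C X Y"
    then have fg [simp]: "f \<in> Mor C" and eq: "X = Dom C f" "Y = Cod C f"
      by (auto simp: Hom_def)
    show "fm G' f \<cdot> \<tau> X = \<tau> Y \<cdot> fm G f"
      unfolding eq by (rule cofree_unique [OF co(2), of "Cod C f"]) (simp_all add: r)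
  qed (rule \<tau>_Hom)
  have "lax_transf C C G G' \<tau>"
    unfolding lax_transf_def
  proof (intro conjI ballI nat_transf)
    fix X Y assume [simp]: "X \<in> Ob C" "Y \<in> Ob C"
    show "\<tau> (X \<otimes>\<^sub>o Y) \<cdot> fmul G X Y = fmul G' X Y \<cdot> (\<tau> X \<otimes>\<^sub>m \<tau> Y)"
      by (rule cofree_unique [OF co(2), of "X \<otimes>\<^sub>o Y"]) (simp_all add: r)
  next
    show "\<tau> (unit C) \<cdot> fun0 G = fun0 G'"
      by (rule cofree_unique [OF co(2), of "unit C"]) (simp_all add: r)
  qed
  with nat_transf \<tau>_iso show ?thesis
    by (simp add: lax_monoidal_iso_def nat_iso_def cofree_lax_monoidal [OF G] cofree_lax_monoidal [OF G'])
qed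

end

section \<open>Absorbing an object over the unit\<close>

text \<open>For \<open>e : A \<rightarrow> 1\<close> these are the maps \<open>A \<otimes> X \<rightarrow> X\<close> and \<open>X \<otimes> A \<rightarrow> X\<close> that apply \<open>e\<close> to the factor \<open>A\<close>.\<close>

definition absorb_l :: "('x, 'n) moncat \<Rightarrow> 'n \<Rightarrow> 'x \<Rightarrow> 'n" where
  "absorb_l E e X = lun E X \<cdot>\<^bsub>E\<^esub> (e \<otimes>\<^sub>m\<^bsub>E\<^esub> Idn E X)"

definition absorb_r :: "('x, 'n) moncat \<Rightarrow> 'n \<Rightarrow> 'x \<Rightarrow> 'n" where
  "absorb_r E e X = run E X \<cdot>\<^bsub>E\<^esub> (Idn E X \<otimes>\<^sub>m\<^bsub>E\<^esub> e)"

text \<open>When \<open>A \<otimes> X\<close> is cofree on \<open>X\<close> by absorption, an isomorphism \<open>\<sigma>\<close> compatible with both absorptions makes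
  \<open>X \<otimes> A\<close> cofree as well, and \<open>\<sigma>\<close> is the only such map.\<close>

locale cofree_tensor = strict_extension +
  fixes A :: 'a and e :: 'c and \<sigma> :: "'a \<Rightarrow> 'b"
  assumes A_Ob [simp]: "A \<in> Ob C"
    and e_Hom: "e \<in> Hom E A (unit C)"
    and \<sigma>_Hom: "X \<in> Ob C \<Longrightarrow> \<sigma> X \<in> Hom C (A \<otimes>\<^sub>o X) (X \<otimes>\<^sub>o A)"
    and \<sigma>_iso [simp]: "X \<in> Ob C \<Longrightarrow> is_iso C (\<sigma> X)"
    and absorb_\<sigma> [simp]: "X \<in> Ob C \<Longrightarrow> absorb_r E e X \<bullet> F (\<sigma> X) = absorb_l E e X"
    and cofree_l: "cofree (\<lambda>X. A \<otimes>\<^sub>o X) (absorb_l E e)"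
begin

abbreviation "cl \<equiv> absorb_l E e"
abbreviation "cr \<equiv> absorb_r E e"

lemma e_typing [simp]: "e \<in> Mor E" "Dom E e = A" "Cod E e = unit C"
  using e_Hom by (auto simp: Hom_def)

lemma \<sigma>_typing [simp]:
  assumes "X \<in> Ob C"
  shows "\<sigma> X \<in> Mor C" "Dom C (\<sigma> X) = A \<otimes>\<^sub>o X" "Cod C (\<sigma> X) = X \<otimes>\<^sub>o A"
  using \<sigma>_Hom [OF assms] by (auto simp: Hom_def)

lemma absorb_typing [simp]:
  assumes "X \<in> Ob C"
  shows "cl X \<in> Mor E" "Dom E (cl X) = A \<otimes>\<^sub>o X" "Cod E (cl X) = X"
    "cr X \<in> Mor E" "Dom E (cr X) = X \<otimes>\<^sub>o A" "Cod E (cr X) = X"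
  using assms by (simp_all add: absorb_l_def absorb_r_def)

lemma cl_natural:
  assumes f: "f \<in> Mor E" and "X = Dom E f" "Y = Cod E f"
  shows "cl Y \<bullet> (Idn E A \<star> f) = f \<bullet> cl X"
proof -
  have XY: "Dom E f \<in> Ob C" "Cod E f \<in> Ob C"
    using f E.Dom_in_Ob E.Cod_in_Ob by auto
  have "cl (Cod E f) \<bullet> (Idn E A \<star> f) = lun E (Cod E f) \<bullet> (Idn E (unit C) \<star> f) \<bullet> (e \<star> Idn E (Dom E f))"
    using f XY by (simp add: absorb_l_def)
  also have "\<dots> = (f \<bullet> lun E (Dom E f)) \<bullet> (e \<star> Idn E (Dom E f))"
    by (rule E.reassoc) (use f XY E.lun_natural [of f] in simp_all)
  finally show ?thesis
    using f XY by (simp add: absorb_l_def assms)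
qed

lemma cr_natural:
  assumes f: "f \<in> Mor E" and "X = Dom E f" "Y = Cod E f"
  shows "cr Y \<bullet> (f \<star> Idn E A) = f \<bullet> cr X"
proof -
  have XY: "Dom E f \<in> Ob C" "Cod E f \<in> Ob C"
    using f E.Dom_in_Ob E.Cod_in_Ob by auto
  have "cr (Cod E f) \<bullet> (f \<star> Idn E A) = run E (Cod E f) \<bullet> (f \<star> Idn E (unit C)) \<bullet> (Idn E (Dom E f) \<star> e)"
    using f XY by (simp add: absorb_r_def)
  also have "\<dots> = (f \<bullet> run E (Dom E f)) \<bullet> (Idn E (Dom E f) \<star> e)"
    by (rule E.reassoc) (use f XY E.run_natural [of f] in simp_all)
  finally show ?thesis
    using f XY by (simp add: absorb_r_def assms)
qed

text \<open>Absorbing \<open>A\<close> at the left end, at the right end, or in the middle of \<open>X \<otimes> Y\<close>, which amounts to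
  Kelly's two unit axioms and the triangle. With these equations the associators disappear as soon as
  a counit is applied.\<close>

lemma cl_tob:
  assumes "X \<in> Ob C" "Y \<in> Ob C"
  shows "cl (X \<otimes>\<^sub>o Y) \<bullet> assc E A X Y = cl X \<star> Idn E Y"
proof -
  have "cl (X \<otimes>\<^sub>o Y) \<bullet> assc E A X Y =
      lun E (X \<otimes>\<^sub>o Y) \<bullet> assc E (unit C) X Y \<bullet> ((e \<star> Idn E X) \<star> Idn E Y)"
    using assms E.assc_natural [of e "Idn E X" "Idn E Y"] by (simp add: absorb_l_def)
  also have "\<dots> = (lun E X \<star> Idn E Y) \<bullet> ((e \<star> Idn E X) \<star> Idn E Y)"
    by (rule E.reassoc) (use assms E.lun_tob [of X Y] in simp_all)
  finally show ?thesis
    using assms by (simp add: absorb_l_def)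
qed

lemma cr_tob:
  assumes "X \<in> Ob C" "Y \<in> Ob C"
  shows "(Idn E X \<star> cr Y) \<bullet> assc E X Y A = cr (X \<otimes>\<^sub>o Y)"
proof -
  have "(Idn E X \<star> cr Y) \<bullet> assc E X Y A =
      (Idn E X \<star> run E Y) \<bullet> (Idn E X \<star> (Idn E Y \<star> e)) \<bullet> assc E X Y A"
    using assms by (simp add: absorb_r_def)
  also have "\<dots> = (Idn E X \<star> run E Y) \<bullet> assc E X Y (unit C) \<bullet> (Idn E (X \<otimes>\<^sub>o Y) \<star> e)"
    using assms E.assc_natural [of "Idn E X" "Idn E Y" e] by simp
  also have "\<dots> = run E (X \<otimes>\<^sub>o Y) \<bullet> (Idn E (X \<otimes>\<^sub>o Y) \<star> e)"
    by (rule E.reassoc) (use assms E.run_tob [of X Y] in simp_all)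
  finally show ?thesis
    by (simp add: absorb_r_def)
qed

lemma cl_middle:
  assumes "X \<in> Ob C" "Y \<in> Ob C"
  shows "(Idn E X \<star> cl Y) \<bullet> assc E X A Y = cr X \<star> Idn E Y"
proof -
  have "(Idn E X \<star> cl Y) \<bullet> assc E X A Y =
      (Idn E X \<star> lun E Y) \<bullet> (Idn E X \<star> (e \<star> Idn E Y)) \<bullet> assc E X A Y"
    using assms by (simp add: absorb_l_def)
  also have "\<dots> = (Idn E X \<star> lun E Y) \<bullet> assc E X (unit C) Y \<bullet> ((Idn E X \<star> e) \<star> Idn E Y)"
    using assms E.assc_natural [of "Idn E X" e "Idn E Y"] by simp
  also have "\<dots> = (run E X \<star> Idn E Y) \<bullet> ((Idn E X \<star> e) \<star> Idn E Y)"
    by (rule E.reassoc) (use assms E.triangle [of X Y] in simp_all)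
  finally show ?thesis
    using assms by (simp add: absorb_r_def)
qed

text \<open>The inverse associator occurs as often as the associator itself, so both orientations are provided;
  the variants with a further factor \<open>h\<close> apply inside composites, which are bracketed to the right.\<close>

lemma absorb_iassc:
  assumes "X \<in> Ob C" "Y \<in> Ob C"
  shows "(cl X \<star> Idn E Y) \<bullet> iassc E A X Y = cl (X \<otimes>\<^sub>o Y)"
    and "cr (X \<otimes>\<^sub>o Y) \<bullet> iassc E X Y A = Idn E X \<star> cr Y"
    and "(cr X \<star> Idn E Y) \<bullet> iassc E X A Y = Idn E X \<star> cl Y"
  using assms by (simp_all flip: cl_tob cr_tob cl_middle)

lemma absorb_left:
  assumes "X \<in> Ob C" "Y \<in> Ob C" "h \<in> Mor E"
  shows "Cod E h = A \<otimes>\<^sub>o (X \<otimes>\<^sub>o Y) \<Longrightarrow>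
      (cl X \<star> Idn E Y) \<bullet> (iassc E A X Y \<bullet> h) = cl (X \<otimes>\<^sub>o Y) \<bullet> h"
    and "Cod E h = X \<otimes>\<^sub>o (Y \<otimes>\<^sub>o A) \<Longrightarrow>
      cr (X \<otimes>\<^sub>o Y) \<bullet> (iassc E X Y A \<bullet> h) = (Idn E X \<star> cr Y) \<bullet> h"
    and "Cod E h = (X \<otimes>\<^sub>o A) \<otimes>\<^sub>o Y \<Longrightarrow>
      (Idn E X \<star> cl Y) \<bullet> (assc E X A Y \<bullet> h) = (cr X \<star> Idn E Y) \<bullet> h"
    and "Cod E h = X \<otimes>\<^sub>o (A \<otimes>\<^sub>o Y) \<Longrightarrow>
      (cr X \<star> Idn E Y) \<bullet> (iassc E X A Y \<bullet> h) = (Idn E X \<star> cl Y) \<bullet> h"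
    and "Cod E h = (A \<otimes>\<^sub>o X) \<otimes>\<^sub>o Y \<Longrightarrow>
      cl (X \<otimes>\<^sub>o Y) \<bullet> (assc E A X Y \<bullet> h) = (cl X \<star> Idn E Y) \<bullet> h"
    and "Cod E h = (X \<otimes>\<^sub>o Y) \<otimes>\<^sub>o A \<Longrightarrow>
      (Idn E X \<star> cr Y) \<bullet> (assc E X Y A \<bullet> h) = cr (X \<otimes>\<^sub>o Y) \<bullet> h"
  using E.reassoc [OF absorb_iassc(1) [OF assms(1,2)], of h]
    E.reassoc [OF absorb_iassc(2) [OF assms(1,2)], of h]
    E.reassoc [OF absorb_iassc(3) [OF assms(1,2)], of h]
    E.reassoc [OF cl_tob [OF assms(1,2)], of h]
    E.reassoc [OF cr_tob [OF assms(1,2)], of h]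
    E.reassoc [OF cl_middle [OF assms(1,2)], of h] assms
  by simp_all

lemma absorb_\<sigma>_left:
  "X \<in> Ob C \<Longrightarrow> h \<in> Mor E \<Longrightarrow> Cod E h = A \<otimes>\<^sub>o X \<Longrightarrow> cr X \<bullet> (F (\<sigma> X) \<bullet> h) = cl X \<bullet> h"
  by (rule E.reassoc [OF absorb_\<sigma>]) simp_all

lemmas absorb = cl_tob cr_tob cl_middle absorb_iassc absorb_left absorb_\<sigma>_left

lemma cl_unique:
  assumes "f \<in> Mor C" "g \<in> Mor C" "Dom C f = Dom C g" "X \<in> Ob C"
    "Cod C f = A \<otimes>\<^sub>o X" "Cod C g = A \<otimes>\<^sub>o X" "cl X \<bullet> F f = cl X \<bullet> F g"
  shows "f = g"
  using cofree_unique [OF cofree_l, of X f g] assms by simp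

lemma cr_inv_\<sigma> [simp]: "X \<in> Ob C \<Longrightarrow> cl X \<bullet> inv_mor E (F (\<sigma> X)) = cr X"
  by (simp flip: absorb_\<sigma>)

lemma cr_inv_\<sigma>_left:
  "X \<in> Ob C \<Longrightarrow> h \<in> Mor E \<Longrightarrow> Cod E h = X \<otimes>\<^sub>o A \<Longrightarrow> cl X \<bullet> (inv_mor E (F (\<sigma> X)) \<bullet> h) = cr X \<bullet> h"
  by (rule E.reassoc [OF cr_inv_\<sigma>]) simp_all

lemma cr_unique:
  assumes "f \<in> Mor C" "g \<in> Mor C" "Dom C f = Dom C g" "X \<in> Ob C"
    "Cod C f = X \<otimes>\<^sub>o A" "Cod C g = X \<otimes>\<^sub>o A" "cr X \<bullet> F f = cr X \<bullet> F g"
  shows "f = g"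
proof -
  have "inv_mor C (\<sigma> X) \<cdot> f = inv_mor C (\<sigma> X) \<cdot> g"
    by (rule cl_unique [of _ _ X]) (use assms in \<open>simp_all add: cr_inv_\<sigma>_left\<close>)
  then show ?thesis
    by (rule C.iso_cancel_left [rotated -1]) (use assms in simp_all)
qed

lemma cofree_r: "cofree (\<lambda>X. X \<otimes>\<^sub>o A) cr"
  unfolding cofree_def using cr_unique by (auto simp: Hom_def)

text \<open>After composition with the counit \<open>X \<otimes> Y \<otimes> A \<rightarrow> X \<otimes> Y\<close>, the right-hand side of the hexagon absorbs \<open>A\<close>
  first behind \<open>Y\<close>, hence between \<open>X\<close> and \<open>Y\<close> by compatibility of \<open>\<sigma> Y\<close> with the counits, and hence in front
  of \<open>X\<close> by that of \<open>\<sigma> X\<close>. So does the left-hand side.\<close>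

theorem \<sigma>_half_braiding: "half_braiding C A \<sigma>"
  unfolding half_braiding_def
proof (intro conjI ballI allI impI)
  fix X Y f assume "f \<in> Hom C X Y"
  then have f [simp]: "f \<in> Mor C" and eq: "X = Dom C f" "Y = Cod C f"
    by (auto simp: Hom_def)
  have [simp]: "cl (Cod C f) \<bullet> (Idn E A \<star> F f) = F f \<bullet> cl (Dom C f)"
    by (rule cl_natural) simp_all
  have [simp]: "cr (Cod C f) \<bullet> ((F f \<star> Idn E A) \<bullet> h) = (F f \<bullet> cr (Dom C f)) \<bullet> h"
    if "h \<in> Mor E" "Cod E h = Dom C f \<otimes>\<^sub>o A" for h
    by (rule E.reassoc [OF cr_natural]) (use that in simp_all)
  show "(f \<otimes>\<^sub>m Idn C A) \<cdot> \<sigma> X = \<sigma> Y \<cdot> (Idn C A \<otimes>\<^sub>m f)"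
    unfolding eq by (rule cr_unique [of _ _ "Cod C f"]) (simp_all add: absorb)
next
  fix X Y assume [simp]: "X \<in> Ob C" "Y \<in> Ob C"
  show "\<sigma> (X \<otimes>\<^sub>o Y) = iassc C X Y A \<cdot> (Idn C X \<otimes>\<^sub>m \<sigma> Y) \<cdot> assc C X A Y
       \<cdot> (\<sigma> X \<otimes>\<^sub>m Idn C Y) \<cdot> iassc C A X Y"
    by (rule cr_unique [of _ _ "X \<otimes>\<^sub>o Y"]) (simp_all add: absorb)
qed (simp_all add: \<sigma>_Hom)

end

section \<open>Half-braidings on tensor products with \<open>A\<close>\<close>

context cofree_tensor
begin

text \<open>If \<open>p : B \<rightarrow> X\<close> is a morphism of \<open>E\<close> that commutes with \<open>\<theta>\<close> and the half-braiding \<open>\<tau>\<close> of \<open>X\<close>, and if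
  \<open>Z \<otimes> p\<close> always detects equality of morphisms of \<open>C\<close> into \<open>Z \<otimes> B\<close>, then the hexagon for \<open>\<theta>\<close> follows from the one
  for \<open>\<tau>\<close>. For tensor products such as \<open>A \<otimes> A\<close> this replaces a lengthy associator calculation.\<close>

lemma half_braiding_lift:
  assumes \<tau>: "half_braiding C X \<tau>" and B [simp]: "B \<in> Ob C" and p: "p \<in> Hom E B X"
    and \<theta>_Hom: "\<And>Z. Z \<in> Ob C \<Longrightarrow> \<theta> Z \<in> Hom C (B \<otimes>\<^sub>o Z) (Z \<otimes>\<^sub>o B)"
    and \<theta>_iso: "\<And>Z. Z \<in> Ob C \<Longrightarrow> is_iso C (\<theta> Z)"
    and \<theta>_natural: "\<And>f. f \<in> Mor C \<Longrightarrow> (f \<otimes>\<^sub>m Idn C B) \<cdot> \<theta> (Dom C f) = \<theta> (Cod C f) \<cdot> (Idn C B \<otimes>\<^sub>m f)"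
    and p_\<theta>: "\<And>Z. Z \<in> Ob C \<Longrightarrow> (Idn E Z \<star> p) \<bullet> F (\<theta> Z) = F (\<tau> Z) \<bullet> (p \<star> Idn E Z)"
    and unique: "\<And>Z f g. \<lbrakk>Z \<in> Ob C; f \<in> Mor C; g \<in> Mor C; Dom C f = Dom C g; Cod C f = Z \<otimes>\<^sub>o B;
        Cod C g = Z \<otimes>\<^sub>o B; (Idn E Z \<star> p) \<bullet> F f = (Idn E Z \<star> p) \<bullet> F g\<rbrakk> \<Longrightarrow> f = g"
  shows "half_braiding C B \<theta>"
proof -
  note [simp] = C.half_braiding_typing [OF \<tau>]
  have p_typing [simp]: "p \<in> Mor E" "Dom E p = B" "Cod E p = X"
    using p by (auto simp: Hom_def)
  have \<theta>_typing [simp]: "\<theta> Z \<in> Mor C" "Dom C (\<theta> Z) = B \<otimes>\<^sub>o Z" "Cod C (\<theta> Z) = Z \<otimes>\<^sub>o B" if "Z \<in> Ob C" for Z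
    using \<theta>_Hom [OF that] by (auto simp: Hom_def)
  have hex: "\<theta> (Z \<otimes>\<^sub>o W) = iassc C Z W B \<cdot> (Idn C Z \<otimes>\<^sub>m \<theta> W) \<cdot> assc C Z B W
       \<cdot> (\<theta> Z \<otimes>\<^sub>m Idn C W) \<cdot> iassc C B Z W"
    if [simp]: "Z \<in> Ob C" "W \<in> Ob C" for Z W
  proof (rule unique [of "Z \<otimes>\<^sub>o W"])
    \<comment> \<open>The morphism \<open>p\<close> is moved past the factors of the hexagon one by one.\<close>
    have "(Idn E (Z \<otimes>\<^sub>o W) \<star> p) \<bullet> F (iassc C Z W B \<cdot> (Idn C Z \<otimes>\<^sub>m \<theta> W) \<cdot> assc C Z B W
       \<cdot> (\<theta> Z \<otimes>\<^sub>m Idn C W) \<cdot> iassc C B Z W) =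
      (Idn E (Z \<otimes>\<^sub>o W) \<star> p) \<bullet> iassc E Z W B \<bullet> (Idn E Z \<star> F (\<theta> W)) \<bullet> assc E Z B W
       \<bullet> (F (\<theta> Z) \<star> Idn E W) \<bullet> iassc E B Z W"
      by simp
    also have "\<dots> = iassc E Z W X \<bullet> (Idn E Z \<star> (Idn E W \<star> p)) \<bullet> (Idn E Z \<star> F (\<theta> W)) \<bullet> assc E Z B W
       \<bullet> (F (\<theta> Z) \<star> Idn E W) \<bullet> iassc E B Z W"
      using E.reassoc [OF E.iassc_natural [of "Idn E Z" "Idn E W" p, symmetric],
        of "(Idn E Z \<star> F (\<theta> W)) \<bullet> assc E Z B W \<bullet> (F (\<theta> Z) \<star> Idn E W) \<bullet> iassc E B Z W"] by simp
    also have "\<dots> = iassc E Z W X \<bullet> (Idn E Z \<star> F (\<tau> W)) \<bullet> (Idn E Z \<star> (p \<star> Idn E W)) \<bullet> assc E Z B W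
       \<bullet> (F (\<theta> Z) \<star> Idn E W) \<bullet> iassc E B Z W"
      by (simp add: p_\<theta>)
    also have "\<dots> = iassc E Z W X \<bullet> (Idn E Z \<star> F (\<tau> W)) \<bullet> assc E Z X W \<bullet> ((Idn E Z \<star> p) \<star> Idn E W)
       \<bullet> (F (\<theta> Z) \<star> Idn E W) \<bullet> iassc E B Z W"
      using E.reassoc [OF E.assc_natural [of "Idn E Z" p "Idn E W", symmetric],
        of "(F (\<theta> Z) \<star> Idn E W) \<bullet> iassc E B Z W"] by simp
    also have "\<dots> = iassc E Z W X \<bullet> (Idn E Z \<star> F (\<tau> W)) \<bullet> assc E Z X W \<bullet> (F (\<tau> Z) \<star> Idn E W)
       \<bullet> ((p \<star> Idn E Z) \<star> Idn E W) \<bullet> iassc E B Z W"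
      by (simp add: p_\<theta>)
    also have "\<dots> = iassc E Z W X \<bullet> (Idn E Z \<star> F (\<tau> W)) \<bullet> assc E Z X W \<bullet> (F (\<tau> Z) \<star> Idn E W)
       \<bullet> iassc E X Z W \<bullet> (p \<star> Idn E (Z \<otimes>\<^sub>o W))"
      using E.iassc_natural [of p "Idn E Z" "Idn E W"] by simp
    also have "\<dots> = F (\<tau> (Z \<otimes>\<^sub>o W)) \<bullet> (p \<star> Idn E (Z \<otimes>\<^sub>o W))"
      by (simp add: C.half_braiding_hexagon [OF \<tau>])
    finally show "(Idn E (Z \<otimes>\<^sub>o W) \<star> p) \<bullet> F (\<theta> (Z \<otimes>\<^sub>o W)) =
      (Idn E (Z \<otimes>\<^sub>o W) \<star> p) \<bullet> F (iassc C Z W B \<cdot> (Idn C Z \<otimes>\<^sub>m \<theta> W) \<cdot> assc C Z B W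
         \<cdot> (\<theta> Z \<otimes>\<^sub>m Idn C W) \<cdot> iassc C B Z W)"
      by (simp add: p_\<theta>)
  qed simp_all
  show ?thesis
    unfolding half_braiding_def
  proof (intro conjI ballI allI impI)
    fix Y Z f assume "f \<in> Hom C Y Z"
    with \<theta>_natural [of f] show "(f \<otimes>\<^sub>m Idn C B) \<cdot> \<theta> Y = \<theta> Z \<cdot> (Idn C B \<otimes>\<^sub>m f)"
      by (simp add: Hom_def)
  qed (rule B | (rule \<theta>_Hom \<theta>_iso hex; assumption))+
qed

text \<open>The counits are the morphisms \<open>p\<close> to which the previous lemma is applied.\<close>

lemma cr_hb_tensor:
  assumes \<tau>: "half_braiding C X \<tau>" and Z: "Z \<in> Ob C"
  shows "(Idn E Z \<star> cr X) \<bullet> F (hb_tensor C X \<tau> A \<sigma> Z) = F (\<tau> Z) \<bullet> (cr X \<star> Idn E Z)"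
proof -
  note [simp] = C.half_braiding_typing [OF \<tau>] Z
  have [simp]: "cr (Z \<otimes>\<^sub>o X) \<bullet> ((F (\<tau> Z) \<star> Idn E A) \<bullet> h) = (F (\<tau> Z) \<bullet> cr (X \<otimes>\<^sub>o Z)) \<bullet> h"
    if "h \<in> Mor E" "Cod E h = (X \<otimes>\<^sub>o Z) \<otimes>\<^sub>o A" for h
    by (rule E.reassoc [OF cr_natural]) (use that in simp_all)
  show ?thesis
    by (simp add: hb_tensor_def absorb)
qed

lemma cl_hb_tensor:
  assumes \<tau>: "half_braiding C X \<tau>" and Z: "Z \<in> Ob C"
  shows "(Idn E Z \<star> cl X) \<bullet> F (hb_tensor C A \<sigma> X \<tau> Z) = F (\<tau> Z) \<bullet> (cl X \<star> Idn E Z)"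
proof -
  note [simp] = C.half_braiding_typing [OF \<tau>] Z
  have [simp]: "cl (Z \<otimes>\<^sub>o X) \<bullet> ((Idn E A \<star> F (\<tau> Z)) \<bullet> h) = (F (\<tau> Z) \<bullet> cl (X \<otimes>\<^sub>o Z)) \<bullet> h"
    if "h \<in> Mor E" "Cod E h = A \<otimes>\<^sub>o (X \<otimes>\<^sub>o Z)" for h
    by (rule E.reassoc [OF cl_natural]) (use that in simp_all)
  show ?thesis
    by (simp add: hb_tensor_def absorb)
qed

lemma cr_whisker_unique:
  assumes "f \<in> Mor C" "g \<in> Mor C" "Dom C f = Dom C g" "X \<in> Ob C" "Z \<in> Ob C"
    "Cod C f = Z \<otimes>\<^sub>o (X \<otimes>\<^sub>o A)" "Cod C g = Z \<otimes>\<^sub>o (X \<otimes>\<^sub>o A)"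
    "(Idn E Z \<star> cr X) \<bullet> F f = (Idn E Z \<star> cr X) \<bullet> F g"
  shows "f = g"
proof -
  have "iassc C Z X A \<cdot> f = iassc C Z X A \<cdot> g"
    by (rule cr_unique [of _ _ "Z \<otimes>\<^sub>o X"]) (use assms in \<open>simp_all add: absorb\<close>)
  then show ?thesis
    by (rule C.iso_cancel_left [rotated -1]) (use assms in simp_all)
qed

lemma cl_whisker_unique:
  assumes "f \<in> Mor C" "g \<in> Mor C" "Dom C f = Dom C g" "X \<in> Ob C" "Z \<in> Ob C"
    "Cod C f = Z \<otimes>\<^sub>o (A \<otimes>\<^sub>o X)" "Cod C g = Z \<otimes>\<^sub>o (A \<otimes>\<^sub>o X)"
    "(Idn E Z \<star> cl X) \<bullet> F f = (Idn E Z \<star> cl X) \<bullet> F g"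
  shows "f = g"
proof -
  have cl_inv: "(cl Z \<star> Idn E X) \<bullet> ((inv_mor E (F (\<sigma> Z)) \<star> Idn E X) \<bullet> h) = (cr Z \<star> Idn E X) \<bullet> h"
    if "h \<in> Mor E" "Cod E h = (Z \<otimes>\<^sub>o A) \<otimes>\<^sub>o X" for h
    using that assms by simp
  let ?s = "assc C A Z X \<cdot> (inv_mor C (\<sigma> Z) \<otimes>\<^sub>m Idn C X) \<cdot> iassc C Z A X"
  have "?s \<cdot> f = ?s \<cdot> g"
    by (rule cl_unique [of _ _ "Z \<otimes>\<^sub>o X"]) (use assms in \<open>simp_all add: absorb cl_inv\<close>)
  then show ?thesis
    by (rule C.iso_cancel_left [rotated -1]) (use assms in simp_all)
qed

lemma hb_tensor_r:
  assumes \<tau>: "half_braiding C X \<tau>"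
  shows "half_braiding C (X \<otimes>\<^sub>o A) (hb_tensor C X \<tau> A \<sigma>)"
proof (rule half_braiding_lift [OF \<tau>, of _ "cr X"])
  have X: "X \<in> Ob C" using C.half_braiding_typing [OF \<tau>] by simp
  show "X \<otimes>\<^sub>o A \<in> Ob C" "cr X \<in> Hom E (X \<otimes>\<^sub>o A) X"
    using X by (simp_all add: Hom_def)
  show "f = g" if "Z \<in> Ob C" "f \<in> Mor C" "g \<in> Mor C" "Dom C f = Dom C g" "Cod C f = Z \<otimes>\<^sub>o (X \<otimes>\<^sub>o A)"
      "Cod C g = Z \<otimes>\<^sub>o (X \<otimes>\<^sub>o A)" "(Idn E Z \<star> cr X) \<bullet> F f = (Idn E Z \<star> cr X) \<bullet> F g" for Z f g
    using cr_whisker_unique [of f g X Z] that X by simp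
qed (simp_all add: C.hb_tensor_typing [OF \<tau> \<sigma>_half_braiding] Hom_def cr_hb_tensor [OF \<tau>]
    C.hb_tensor_natural [OF \<tau> \<sigma>_half_braiding])

lemma hb_tensor_l:
  assumes \<tau>: "half_braiding C X \<tau>"
  shows "half_braiding C (A \<otimes>\<^sub>o X) (hb_tensor C A \<sigma> X \<tau>)"
proof (rule half_braiding_lift [OF \<tau>, of _ "cl X"])
  have X: "X \<in> Ob C" using C.half_braiding_typing [OF \<tau>] by simp
  show "A \<otimes>\<^sub>o X \<in> Ob C" "cl X \<in> Hom E (A \<otimes>\<^sub>o X) X"
    using X by (simp_all add: Hom_def)
  show "f = g" if "Z \<in> Ob C" "f \<in> Mor C" "g \<in> Mor C" "Dom C f = Dom C g" "Cod C f = Z \<otimes>\<^sub>o (A \<otimes>\<^sub>o X)"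
      "Cod C g = Z \<otimes>\<^sub>o (A \<otimes>\<^sub>o X)" "(Idn E Z \<star> cl X) \<bullet> F f = (Idn E Z \<star> cl X) \<bullet> F g" for Z f g
    using cl_whisker_unique [of f g X Z] that X by simp
qed (simp_all add: C.hb_tensor_typing [OF \<sigma>_half_braiding \<tau>] Hom_def cl_hb_tensor [OF \<tau>]
    C.hb_tensor_natural [OF \<sigma>_half_braiding \<tau>])

lemma hb_tensor_whisker:
  assumes \<tau>: "half_braiding C X \<tau>" and \<upsilon>: "half_braiding C Y \<upsilon>" and f: "f \<in> Hom E X Y"
    and Z: "Z \<in> Ob C"
    and f_\<tau>: "(Idn E Z \<star> f) \<bullet> F (\<tau> Z) = F (\<upsilon> Z) \<bullet> (f \<star> Idn E Z)"
  shows "(Idn E Z \<star> (f \<star> Idn E A)) \<bullet> F (hb_tensor C X \<tau> A \<sigma> Z) =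
     F (hb_tensor C Y \<upsilon> A \<sigma> Z) \<bullet> ((f \<star> Idn E A) \<star> Idn E Z)"
proof -
  note [simp] = C.half_braiding_typing [OF \<tau>] C.half_braiding_typing [OF \<upsilon>] Z
  have [simp]: "f \<in> Mor E" "Dom E f = X" "Cod E f = Y"
    using f by (auto simp: Hom_def)
  let ?k = "iassc E X Z A \<bullet> (Idn E X \<star> F (\<sigma> Z)) \<bullet> assc E X A Z"
  have "(Idn E Z \<star> (f \<star> Idn E A)) \<bullet> F (hb_tensor C X \<tau> A \<sigma> Z) =
      (Idn E Z \<star> (f \<star> Idn E A)) \<bullet> assc E Z X A \<bullet> (F (\<tau> Z) \<star> Idn E A) \<bullet> ?k"
    by (simp add: hb_tensor_def)
  also have "\<dots> = assc E Z Y A \<bullet> ((Idn E Z \<star> f) \<star> Idn E A) \<bullet> (F (\<tau> Z) \<star> Idn E A) \<bullet> ?k"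
    using E.reassoc [OF E.assc_natural [of "Idn E Z" f "Idn E A", symmetric],
      of "(F (\<tau> Z) \<star> Idn E A) \<bullet> ?k"] by simp
  also have "\<dots> = assc E Z Y A \<bullet> (F (\<upsilon> Z) \<star> Idn E A) \<bullet> ((f \<star> Idn E Z) \<star> Idn E A) \<bullet> ?k"
    by (simp add: f_\<tau>)
  also have "\<dots> = assc E Z Y A \<bullet> (F (\<upsilon> Z) \<star> Idn E A) \<bullet> iassc E Y Z A \<bullet> (f \<star> Idn E (Z \<otimes>\<^sub>o A))
      \<bullet> (Idn E X \<star> F (\<sigma> Z)) \<bullet> assc E X A Z"
    using E.reassoc [OF E.iassc_natural [of f "Idn E Z" "Idn E A", symmetric],
      of "(Idn E X \<star> F (\<sigma> Z)) \<bullet> assc E X A Z"] by simp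
  also have "\<dots> = assc E Z Y A \<bullet> (F (\<upsilon> Z) \<star> Idn E A) \<bullet> iassc E Y Z A \<bullet> (Idn E Y \<star> F (\<sigma> Z))
      \<bullet> (f \<star> Idn E (A \<otimes>\<^sub>o Z)) \<bullet> assc E X A Z"
    by simp
  also have "\<dots> = assc E Z Y A \<bullet> (F (\<upsilon> Z) \<star> Idn E A) \<bullet> iassc E Y Z A \<bullet> (Idn E Y \<star> F (\<sigma> Z))
      \<bullet> assc E Y A Z \<bullet> ((f \<star> Idn E A) \<star> Idn E Z)"
    using E.assc_natural [of f "Idn E A" "Idn E Z"] by simp
  finally show ?thesis
    by (simp add: hb_tensor_def)
qed

text \<open>The counit \<open>A \<otimes> (A \<otimes> A) \<rightarrow> A \<otimes> A\<close> reduces the claim to the fact that \<open>A \<otimes> A \<rightarrow> A\<close>, tensored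
  with \<open>A\<close>, commutes with the half-braidings.\<close>

lemma hb_mor_assc:
  "hb_mor C ((A \<otimes>\<^sub>o A) \<otimes>\<^sub>o A) (hb_tensor C (A \<otimes>\<^sub>o A) (hb_tensor C A \<sigma> A \<sigma>) A \<sigma>) (assc C A A A)
     (A \<otimes>\<^sub>o (A \<otimes>\<^sub>o A)) (hb_tensor C A \<sigma> (A \<otimes>\<^sub>o A) (hb_tensor C A \<sigma> A \<sigma>))"
  unfolding hb_mor_def
proof (intro conjI ballI)
  fix Z assume Z [simp]: "Z \<in> Ob C"
  note hA = \<sigma>_half_braiding
  note hAA = hb_tensor_r [OF hA]
  note [simp] = C.hb_tensor_typing [OF hA hA] C.hb_tensor_typing [OF hAA hA]
    C.hb_tensor_typing [OF hA hAA]
  let ?t = "hb_tensor C A \<sigma> A \<sigma>"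
  have "(Idn E Z \<star> cl (A \<otimes>\<^sub>o A)) \<bullet> F (hb_tensor C A \<sigma> (A \<otimes>\<^sub>o A) ?t Z) \<bullet> (assc E A A A \<star> Idn E Z) =
      (F (?t Z) \<bullet> (cl (A \<otimes>\<^sub>o A) \<star> Idn E Z)) \<bullet> (assc E A A A \<star> Idn E Z)"
    by (rule E.reassoc [OF cl_hb_tensor [OF hAA Z]]) simp_all
  also have "\<dots> = F (?t Z) \<bullet> ((cl A \<star> Idn E A) \<star> Idn E Z)"
    by (simp add: absorb)
  also have "\<dots> = (Idn E Z \<star> (cl A \<star> Idn E A)) \<bullet> F (hb_tensor C (A \<otimes>\<^sub>o A) ?t A \<sigma> Z)"
    by (rule hb_tensor_whisker [OF hAA hA, symmetric]) (simp_all add: Hom_def cl_hb_tensor [OF hA])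
  also have "\<dots> = (Idn E Z \<star> cl (A \<otimes>\<^sub>o A)) \<bullet> (Idn E Z \<star> assc E A A A) \<bullet> F (hb_tensor C (A \<otimes>\<^sub>o A) ?t A \<sigma> Z)"
    by (simp add: absorb)
  finally show "hb_tensor C A \<sigma> (A \<otimes>\<^sub>o A) ?t Z \<cdot> (assc C A A A \<otimes>\<^sub>m Idn C Z) =
      (Idn C Z \<otimes>\<^sub>m assc C A A A) \<cdot> hb_tensor C (A \<otimes>\<^sub>o A) ?t A \<sigma> Z"
    by (intro cl_whisker_unique [of _ _ "A \<otimes>\<^sub>o A" Z]) simp_all
qed (simp add: Hom_def)

end

section \<open>The commutative monoid on \<open>A\<close>\<close>

locale cofree_monoid = cofree_tensor +
  fixes \<mu> \<iota> :: 'b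
  assumes \<mu>_Hom: "\<mu> \<in> Hom C (A \<otimes>\<^sub>o A) A" and \<iota>_Hom: "\<iota> \<in> Hom C (unit C) A"
    and e_\<mu> [simp]: "e \<bullet> F \<mu> = e \<bullet> absorb_l E e A"
    and e_\<iota> [simp]: "e \<bullet> F \<iota> = Idn E (unit C)"
begin

lemma \<mu>\<iota>_typing [simp]:
  "\<mu> \<in> Mor C" "Dom C \<mu> = A \<otimes>\<^sub>o A" "Cod C \<mu> = A" "\<iota> \<in> Mor C" "Dom C \<iota> = unit C" "Cod C \<iota> = A"
  using \<mu>_Hom \<iota>_Hom by (auto simp: Hom_def)

text \<open>The absorptions at \<open>X = 1\<close> are essentially \<open>e\<close>, so \<open>e\<close> itself detects equality of morphisms
  into \<open>A\<close>.\<close>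

lemma cl_unit: "cl (unit C) = e \<bullet> run E A" and cr_unit: "cr (unit C) = e \<bullet> lun E A"
  using E.run_natural [of e] E.lun_natural [of e] E.lun_unit_eq_run_unit
  by (simp_all add: absorb_l_def absorb_r_def)

lemma e_unique:
  assumes "f \<in> Mor C" "g \<in> Mor C" "Dom C f = Dom C g" "Cod C f = A" "Cod C g = A" "e \<bullet> F f = e \<bullet> F g"
  shows "f = g"
proof -
  have "inv_mor C (run C A) \<cdot> f = inv_mor C (run C A) \<cdot> g"
    by (rule cl_unique [of _ _ "unit C"]) (use assms in \<open>simp_all add: cl_unit\<close>)
  then show ?thesis
    by (rule C.iso_cancel_left [rotated -1]) (use assms in simp_all)
qed

lemma e_cr: "e \<bullet> cr A = e \<bullet> cl A"
proof -
  have "e \<bullet> cl A = cl (unit C) \<bullet> (Idn E A \<star> e)"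
    using cl_natural [of e] by simp
  then show ?thesis
    by (simp add: cl_unit absorb_r_def)
qed

text \<open>Since \<open>e \<mu> = e (e \<otimes> A) = e (A \<otimes> e)\<close>, absorbing a product means absorbing its two factors in either order.\<close>

lemma cl_\<mu>: "X \<in> Ob C \<Longrightarrow> cl X \<bullet> (F \<mu> \<star> Idn E X) = cl X \<bullet> cl (A \<otimes>\<^sub>o X) \<bullet> assc E A A X"
  by (simp add: absorb) (simp add: absorb_l_def)

lemma cr_\<mu>: "X \<in> Ob C \<Longrightarrow> cr X \<bullet> (Idn E X \<star> F \<mu>) = cr X \<bullet> cr (X \<otimes>\<^sub>o A) \<bullet> iassc E X A A"
  by (simp add: absorb) (simp add: absorb_r_def e_cr [unfolded absorb_r_def])

lemma cl_\<iota>: "X \<in> Ob C \<Longrightarrow> cl X \<bullet> (F \<iota> \<star> Idn E X) = lun E X"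
  and cr_\<iota>: "X \<in> Ob C \<Longrightarrow> cr X \<bullet> (Idn E X \<star> F \<iota>) = run E X"
  by (simp_all add: absorb_l_def absorb_r_def)

lemma cl_\<mu>_left:
  "X \<in> Ob C \<Longrightarrow> h \<in> Mor E \<Longrightarrow> Cod E h = (A \<otimes>\<^sub>o A) \<otimes>\<^sub>o X \<Longrightarrow>
     cl X \<bullet> ((F \<mu> \<star> Idn E X) \<bullet> h) = cl X \<bullet> cl (A \<otimes>\<^sub>o X) \<bullet> assc E A A X \<bullet> h"
  using E.reassoc [OF cl_\<mu>, of X h] by simp

lemma cr_\<mu>_left:
  "X \<in> Ob C \<Longrightarrow> h \<in> Mor E \<Longrightarrow> Cod E h = X \<otimes>\<^sub>o (A \<otimes>\<^sub>o A) \<Longrightarrow>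
     cr X \<bullet> ((Idn E X \<star> F \<mu>) \<bullet> h) = cr X \<bullet> cr (X \<otimes>\<^sub>o A) \<bullet> iassc E X A A \<bullet> h"
  using E.reassoc [OF cr_\<mu>, of X h] by simp

lemma cl_\<iota>_left: "X \<in> Ob C \<Longrightarrow> h \<in> Mor E \<Longrightarrow> Cod E h = unit C \<otimes>\<^sub>o X \<Longrightarrow>
    cl X \<bullet> ((F \<iota> \<star> Idn E X) \<bullet> h) = lun E X \<bullet> h"
  and cr_\<iota>_left: "X \<in> Ob C \<Longrightarrow> h \<in> Mor E \<Longrightarrow> Cod E h = X \<otimes>\<^sub>o unit C \<Longrightarrow>
    cr X \<bullet> ((Idn E X \<star> F \<iota>) \<bullet> h) = run E X \<bullet> h"
  using E.reassoc [OF cl_\<iota>, of X h] E.reassoc [OF cr_\<iota>, of X h] by simp_all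

theorem monoid: "monoid_object C A \<mu> \<iota>"
  unfolding monoid_object_def
proof (intro conjI)
  have e_\<mu>_left: "e \<bullet> (F \<mu> \<bullet> h) = e \<bullet> cl A \<bullet> h" if "h \<in> Mor E" "Cod E h = A \<otimes>\<^sub>o A" for h
    using E.reassoc [OF e_\<mu>, of h] that by simp
  have [simp]: "cl A \<bullet> ((Idn E A \<star> F \<mu>) \<bullet> h) = (F \<mu> \<bullet> cl (A \<otimes>\<^sub>o A)) \<bullet> h"
    if "h \<in> Mor E" "Cod E h = A \<otimes>\<^sub>o (A \<otimes>\<^sub>o A)" for h
    by (rule E.reassoc [OF cl_natural]) (use that in simp_all)
  have [simp]: "cl A \<bullet> (Idn E A \<star> F \<iota>) = F \<iota> \<bullet> cl (unit C)"
    by (rule cl_natural) simp_all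
  have [simp]: "e \<bullet> (F \<iota> \<bullet> h) = h" if "h \<in> Mor E" "Cod E h = unit C" for h
    using E.reassoc [OF e_\<iota>, of h] that by simp
  show "\<mu> \<cdot> (\<mu> \<otimes>\<^sub>m Idn C A) = \<mu> \<cdot> (Idn C A \<otimes>\<^sub>m \<mu>) \<cdot> assc C A A A"
    by (rule e_unique) (simp_all add: e_\<mu>_left cl_\<mu>)
  show "\<mu> \<cdot> (\<iota> \<otimes>\<^sub>m Idn C A) = lun C A" "\<mu> \<cdot> (Idn C A \<otimes>\<^sub>m \<iota>) = run C A"
    by (rule e_unique; simp add: e_\<mu>_left cl_\<iota> cl_unit)+
qed (simp_all add: \<mu>_Hom \<iota>_Hom)

theorem commutative: "\<mu> \<cdot> \<sigma> A = \<mu>"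
proof (rule e_unique)
  have "e \<bullet> F (\<mu> \<cdot> \<sigma> A) = e \<bullet> (cl A \<bullet> F (\<sigma> A))"
    using E.reassoc [OF e_\<mu>, of "F (\<sigma> A)"] by simp
  also have "\<dots> = e \<bullet> (cr A \<bullet> F (\<sigma> A))"
    using E.reassoc [OF e_cr, of "F (\<sigma> A)"] by simp
  finally show "e \<bullet> F (\<mu> \<cdot> \<sigma> A) = e \<bullet> F \<mu>"
    by simp
qed simp_all

text \<open>After composition with the counit at \<open>Z\<close> both sides absorb the two copies of \<open>A\<close> in front of \<open>Z\<close>.\<close>

theorem hb_mor_\<mu>: "hb_mor C (A \<otimes>\<^sub>o A) (hb_tensor C A \<sigma> A \<sigma>) \<mu> A \<sigma>"
  unfolding hb_mor_def
proof (intro conjI ballI \<mu>_Hom)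
  fix Z assume [simp]: "Z \<in> Ob C"
  note [simp] = C.hb_tensor_typing [OF \<sigma>_half_braiding \<sigma>_half_braiding]
  have [simp]: "cr (Z \<otimes>\<^sub>o A) \<bullet> ((F (\<sigma> Z) \<star> Idn E A) \<bullet> h) = (F (\<sigma> Z) \<bullet> cr (A \<otimes>\<^sub>o Z)) \<bullet> h"
    if "h \<in> Mor E" "Cod E h = (A \<otimes>\<^sub>o Z) \<otimes>\<^sub>o A" for h
    by (rule E.reassoc [OF cr_natural]) (use that in simp_all)
  have "(cr Z \<bullet> cr (Z \<otimes>\<^sub>o A) \<bullet> iassc E Z A A) \<bullet> F (hb_tensor C A \<sigma> A \<sigma> Z) =
      cl Z \<bullet> (Idn E A \<star> cl Z) \<bullet> assc E A A Z"
    by (simp add: hb_tensor_def absorb)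
  also have "\<dots> = cl Z \<bullet> cl (A \<otimes>\<^sub>o Z) \<bullet> assc E A A Z"
    using E.reassoc [OF cl_natural [of "cl Z", OF _ refl refl], of "assc E A A Z"] by simp
  finally show "\<sigma> Z \<cdot> (\<mu> \<otimes>\<^sub>m Idn C Z) = (Idn C Z \<otimes>\<^sub>m \<mu>) \<cdot> hb_tensor C A \<sigma> A \<sigma> Z"
    by (intro cr_unique [of _ _ Z]) (simp_all add: absorb_\<sigma>_left cl_\<mu> cr_\<mu>_left)
qed

theorem hb_mor_\<iota>: "hb_mor C (unit C) (hb_unit C) \<iota> A \<sigma>"
  unfolding hb_mor_def
proof (intro conjI ballI \<iota>_Hom)
  fix Z assume [simp]: "Z \<in> Ob C"
  have "cr Z \<bullet> (Idn E Z \<star> F \<iota>) \<bullet> F (hb_unit C Z) = run E Z \<bullet> F (hb_unit C Z)"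
    by (rule E.reassoc [OF cr_\<iota>]) (simp_all add: hb_unit_def)
  then show "\<sigma> Z \<cdot> (\<iota> \<otimes>\<^sub>m Idn C Z) = (Idn C Z \<otimes>\<^sub>m \<iota>) \<cdot> hb_unit C Z"
    by (intro cr_unique [of _ _ Z]) (simp_all add: absorb_\<sigma>_left cl_\<iota> hb_unit_def)
qed

text \<open>The multiplication \<open>A \<otimes> X \<otimes> A \<otimes> Y \<rightarrow> A \<otimes> X \<otimes> Y\<close> moves the second \<open>A\<close> in front of \<open>X\<close> by \<open>\<sigma>\<^sup>-\<^sup>1\<close> and then applies
  \<open>\<mu>\<close>. Absorbing the result absorbs the second \<open>A\<close> where it stood, behind \<open>X\<close>, and the first in front.\<close>

theorem cofree_lax_ltensor: "cofree_lax (ltensor_lax C A \<sigma> \<mu> \<iota>) cl"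
proof -
  have nat: "cl (Cod C f) \<bullet> (Idn E A \<star> F f) = F f \<bullet> cl (Dom C f)" if "f \<in> Mor C" for f
    by (rule cl_natural) (use that in simp_all)
  have mult: "cl (X \<otimes>\<^sub>o Y) \<bullet> F (fmul (ltensor_lax C A \<sigma> \<mu> \<iota>) X Y) = cl X \<star> cl Y"
    if [simp]: "X \<in> Ob C" "Y \<in> Ob C" for X Y
  proof -
    let ?s = "assc E A X Y \<bullet> (inv_mor E (F (\<sigma> X)) \<star> Idn E Y) \<bullet> iassc E X A Y"
    have s: "cl (X \<otimes>\<^sub>o Y) \<bullet> ?s = Idn E X \<star> cl Y"
    proof -
      have "cl (X \<otimes>\<^sub>o Y) \<bullet> ?s = (cl X \<star> Idn E Y) \<bullet> (inv_mor E (F (\<sigma> X)) \<star> Idn E Y) \<bullet> iassc E X A Y"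
        by (rule E.reassoc [OF cl_tob]) simp_all
      then show ?thesis
        by (simp add: absorb)
    qed
    have "cl (X \<otimes>\<^sub>o Y) \<bullet> F (fmul (ltensor_lax C A \<sigma> \<mu> \<iota>) X Y) =
        cl (X \<otimes>\<^sub>o Y) \<bullet> (F \<mu> \<star> Idn E (X \<otimes>\<^sub>o Y)) \<bullet> iassc E A A (X \<otimes>\<^sub>o Y) \<bullet> (Idn E A \<star> ?s)
          \<bullet> assc E A X (A \<otimes>\<^sub>o Y)"
      by (simp add: ltensor_lax_def)
    also have "\<dots> = cl (X \<otimes>\<^sub>o Y) \<bullet> cl (A \<otimes>\<^sub>o (X \<otimes>\<^sub>o Y)) \<bullet> (Idn E A \<star> ?s) \<bullet> assc E A X (A \<otimes>\<^sub>o Y)"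
      by (simp add: cl_\<mu>_left)
    also have "\<dots> = cl (X \<otimes>\<^sub>o Y) \<bullet> (?s \<bullet> cl (X \<otimes>\<^sub>o (A \<otimes>\<^sub>o Y))) \<bullet> assc E A X (A \<otimes>\<^sub>o Y)"
      using E.reassoc [OF cl_natural [of ?s, OF _ refl refl], of "assc E A X (A \<otimes>\<^sub>o Y)"] by simp
    also have "\<dots> = (Idn E X \<star> cl Y) \<bullet> cl (X \<otimes>\<^sub>o (A \<otimes>\<^sub>o Y)) \<bullet> assc E A X (A \<otimes>\<^sub>o Y)"
      using E.reassoc [OF s, of "cl (X \<otimes>\<^sub>o (A \<otimes>\<^sub>o Y)) \<bullet> assc E A X (A \<otimes>\<^sub>o Y)"] by simp
    also have "\<dots> = cl X \<star> cl Y"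
      by (simp add: absorb)
    finally show ?thesis .
  qed
  have "is_functor C C (ltensor_lax C A \<sigma> \<mu> \<iota>)"
    unfolding is_functor_def using C.cat by (auto simp: ltensor_lax_def Hom_def)
  then show ?thesis
    unfolding cofree_lax_def
    using cofree_l nat mult
    by (simp add: ltensor_lax_def Hom_def cl_\<iota>_left)
qed

theorem cofree_lax_rtensor: "cofree_lax (rtensor_lax C A \<sigma> \<mu> \<iota>) cr"
proof -
  have nat: "cr (Cod C f) \<bullet> (F f \<star> Idn E A) = F f \<bullet> cr (Dom C f)" if "f \<in> Mor C" for f
    by (rule cr_natural) (use that in simp_all)
  have mult: "cr (X \<otimes>\<^sub>o Y) \<bullet> F (fmul (rtensor_lax C A \<sigma> \<mu> \<iota>) X Y) = cr X \<star> cr Y"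
    if [simp]: "X \<in> Ob C" "Y \<in> Ob C" for X Y
  proof -
    let ?s = "iassc E X Y A \<bullet> (Idn E X \<star> F (\<sigma> Y)) \<bullet> assc E X A Y"
    have s: "cr (X \<otimes>\<^sub>o Y) \<bullet> ?s = cr X \<star> Idn E Y"
      by (simp add: absorb)
    have "cr (X \<otimes>\<^sub>o Y) \<bullet> F (fmul (rtensor_lax C A \<sigma> \<mu> \<iota>) X Y) =
        cr (X \<otimes>\<^sub>o Y) \<bullet> (Idn E (X \<otimes>\<^sub>o Y) \<star> F \<mu>) \<bullet> assc E (X \<otimes>\<^sub>o Y) A A \<bullet> (?s \<star> Idn E A)
          \<bullet> iassc E (X \<otimes>\<^sub>o A) Y A"
      by (simp add: rtensor_lax_def)
    also have "\<dots> = cr (X \<otimes>\<^sub>o Y) \<bullet> cr ((X \<otimes>\<^sub>o Y) \<otimes>\<^sub>o A) \<bullet> (?s \<star> Idn E A) \<bullet> iassc E (X \<otimes>\<^sub>o A) Y A"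
      by (simp add: cr_\<mu>_left)
    also have "\<dots> = cr (X \<otimes>\<^sub>o Y) \<bullet> (?s \<bullet> cr ((X \<otimes>\<^sub>o A) \<otimes>\<^sub>o Y)) \<bullet> iassc E (X \<otimes>\<^sub>o A) Y A"
      using E.reassoc [OF cr_natural [of ?s, OF _ refl refl], of "iassc E (X \<otimes>\<^sub>o A) Y A"] by simp
    also have "\<dots> = (cr X \<star> Idn E Y) \<bullet> cr ((X \<otimes>\<^sub>o A) \<otimes>\<^sub>o Y) \<bullet> iassc E (X \<otimes>\<^sub>o A) Y A"
      using E.reassoc [OF s, of "cr ((X \<otimes>\<^sub>o A) \<otimes>\<^sub>o Y) \<bullet> iassc E (X \<otimes>\<^sub>o A) Y A"] by simp
    also have "\<dots> = cr X \<star> cr Y"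
      by (simp add: absorb)
    finally show ?thesis .
  qed
  have "is_functor C C (rtensor_lax C A \<sigma> \<mu> \<iota>)"
    unfolding is_functor_def using C.cat by (auto simp: rtensor_lax_def Hom_def)
  then show ?thesis
    unfolding cofree_lax_def
    using cofree_r nat mult
    by (simp add: rtensor_lax_def Hom_def cr_\<iota>_left)
qed

end

section \<open>The full image of a strong monoidal functor\<close>

locale strong_functor =
  C: moncat_calculus C + D: moncat_calculus D
  for C :: "('x, 'm) moncat" (structure) and D :: "('y, 'n) moncat" +
  fixes I :: "('x, 'm, 'y, 'n) mfunct"
  assumes strong: "strong_monoidal C D I"
begin

abbreviation D_Cmp (infixr \<open>\<ast>\<close> 70) where "g \<ast> f \<equiv> g \<cdot>\<^bsub>D\<^esub> f"
abbreviation D_tmor (infixr \<open>\<boxtimes>\<close> 75) where "f \<boxtimes> g \<equiv> f \<otimes>\<^sub>m\<^bsub>D\<^esub> g"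

lemma functor_I: "is_functor C D I"
  using strong by (simp add: strong_monoidal_def colax_monoidal_def)

lemma I_typing [simp]:
  "X \<in> Ob C \<Longrightarrow> fo I X \<in> Ob D" "f \<in> Mor C \<Longrightarrow> fm I f \<in> Mor D"
  "f \<in> Mor C \<Longrightarrow> Dom D (fm I f) = fo I (Dom C f)" "f \<in> Mor C \<Longrightarrow> Cod D (fm I f) = fo I (Cod C f)"
  using functor_I unfolding is_functor_def by (auto simp: Hom_def)

lemma I_Idn [simp]: "X \<in> Ob C \<Longrightarrow> fm I (Idn C X) = Idn D (fo I X)"
  using functor_I by (simp add: is_functor_def)

lemma I_Cmp [simp]:
  "f \<in> Mor C \<Longrightarrow> g \<in> Mor C \<Longrightarrow> Dom C g = Cod C f \<Longrightarrow> fm I (g \<cdot> f) = fm I g \<ast> fm I f"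
  using functor_I unfolding is_functor_def by (auto simp: Hom_def)

lemma fmul_typing [simp]:
  assumes "X \<in> Ob C" "Y \<in> Ob C"
  shows "fmul I X Y \<in> Mor D" "Dom D (fmul I X Y) = fo I (X \<otimes>\<^sub>o Y)"
    "Cod D (fmul I X Y) = fo I X \<otimes>\<^sub>o\<^bsub>D\<^esub> fo I Y" "is_iso D (fmul I X Y)"
  using strong assms by (auto simp: strong_monoidal_def colax_monoidal_def Hom_def)

lemma fun0_typing [simp]:
  "fun0 I \<in> Mor D" "Dom D (fun0 I) = fo I (unit C)" "Cod D (fun0 I) = unit D" "is_iso D (fun0 I)"
  using strong by (auto simp: strong_monoidal_def colax_monoidal_def Hom_def)

lemma fmul_natural:
  assumes "f \<in> Mor C" "g \<in> Mor C"
  shows "fmul I (Cod C f) (Cod C g) \<ast> fm I (f \<otimes>\<^sub>m g) =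
     (fm I f \<boxtimes> fm I g) \<ast> fmul I (Dom C f) (Dom C g)"
  using strong assms by (simp add: strong_monoidal_def colax_monoidal_def Hom_def)

lemma fmul_assc:
  assumes "X \<in> Ob C" "Y \<in> Ob C" "Z \<in> Ob C"
  shows "assc D (fo I X) (fo I Y) (fo I Z) \<ast> (fmul I X Y \<boxtimes> Idn D (fo I Z)) \<ast> fmul I (X \<otimes>\<^sub>o Y) Z =
      (Idn D (fo I X) \<boxtimes> fmul I Y Z) \<ast> fmul I X (Y \<otimes>\<^sub>o Z) \<ast> fm I (assc C X Y Z)"
  using strong assms by (simp add: strong_monoidal_def colax_monoidal_def)

lemma fmul_lun:
  assumes "X \<in> Ob C"
  shows "fm I (lun C X) = lun D (fo I X) \<ast> (fun0 I \<boxtimes> Idn D (fo I X)) \<ast> fmul I (unit C) X"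
    and "fm I (run C X) = run D (fo I X) \<ast> (Idn D (fo I X) \<boxtimes> fun0 I) \<ast> fmul I X (unit C)"
  using strong assms by (simp_all add: strong_monoidal_def colax_monoidal_def)

end

text \<open>Morphisms carry their source and target because the objects \<open>X\<close> and \<open>Y\<close> are not determined by a
  morphism \<open>I X \<rightarrow> I Y\<close> of \<open>D\<close>. Conjugating the tensor product of \<open>D\<close> by the structure isomorphisms of \<open>I\<close>
  makes the embedding of \<open>C\<close> strictly monoidal.\<close>

definition full_image ::
  "('x, 'm) moncat \<Rightarrow> ('y, 'n) moncat \<Rightarrow> ('x, 'm, 'y, 'n) mfunct \<Rightarrow> ('x, 'x \<times> 'n \<times> 'x) moncat" where
  "full_image C D I =
     \<lparr>Ob = Ob C,
      Mor = {(X, g, Y). X \<in> Ob C \<and> Y \<in> Ob C \<and> g \<in> Hom D (fo I X) (fo I Y)},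
      Dom = (\<lambda>(X, g, Y). X), Cod = (\<lambda>(X, g, Y). Y),
      Idn = (\<lambda>X. (X, Idn D (fo I X), X)),
      Cmp = (\<lambda>(Y', g, Z) (X, f, Y). (X, g \<cdot>\<^bsub>D\<^esub> f, Z)),
      tob = tob C,
      tmor = (\<lambda>(X, f, X') (Y, g, Y').
        (X \<otimes>\<^sub>o\<^bsub>C\<^esub> Y, inv_mor D (fmul I X' Y') \<cdot>\<^bsub>D\<^esub> (f \<otimes>\<^sub>m\<^bsub>D\<^esub> g) \<cdot>\<^bsub>D\<^esub> fmul I X Y, X' \<otimes>\<^sub>o\<^bsub>C\<^esub> Y')),
      unit = unit C,
      assc = (\<lambda>X Y Z. ((X \<otimes>\<^sub>o\<^bsub>C\<^esub> Y) \<otimes>\<^sub>o\<^bsub>C\<^esub> Z, fm I (assc C X Y Z), X \<otimes>\<^sub>o\<^bsub>C\<^esub> (Y \<otimes>\<^sub>o\<^bsub>C\<^esub> Z))),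
      lun = (\<lambda>X. (unit C \<otimes>\<^sub>o\<^bsub>C\<^esub> X, fm I (lun C X), X)),
      run = (\<lambda>X. (X \<otimes>\<^sub>o\<^bsub>C\<^esub> unit C, fm I (run C X), X))\<rparr>"

definition full_embed :: "('x, 'm) moncat \<Rightarrow> ('x, 'm, 'y, 'n) mfunct \<Rightarrow> 'm \<Rightarrow> 'x \<times> 'n \<times> 'x" where
  "full_embed C I f = (Dom C f, fm I f, Cod C f)"

lemma full_image_ob [simp]:
  "Ob (full_image C D I) = Ob C" "tob (full_image C D I) = tob C" "unit (full_image C D I) = unit C"
  by (simp_all add: full_image_def)

lemma full_image_mor [simp]:
  "Mor (full_image C D I) = {(X, g, Y). X \<in> Ob C \<and> Y \<in> Ob C \<and> g \<in> Hom D (fo I X) (fo I Y)}"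
  "Dom (full_image C D I) (X, g, Y) = X" "Cod (full_image C D I) (X, g, Y) = Y"
  "Idn (full_image C D I) X = (X, Idn D (fo I X), X)"
  "Cmp (full_image C D I) (Y', g', Z) (X, g, Y) = (X, g' \<cdot>\<^bsub>D\<^esub> g, Z)"
  "tmor (full_image C D I) (X, g, X') (Y, h, Y') =
     (X \<otimes>\<^sub>o\<^bsub>C\<^esub> Y, inv_mor D (fmul I X' Y') \<cdot>\<^bsub>D\<^esub> (g \<otimes>\<^sub>m\<^bsub>D\<^esub> h) \<cdot>\<^bsub>D\<^esub> fmul I X Y, X' \<otimes>\<^sub>o\<^bsub>C\<^esub> Y')"
  "assc (full_image C D I) X Y Z = ((X \<otimes>\<^sub>o\<^bsub>C\<^esub> Y) \<otimes>\<^sub>o\<^bsub>C\<^esub> Z, fm I (assc C X Y Z), X \<otimes>\<^sub>o\<^bsub>C\<^esub> (Y \<otimes>\<^sub>o\<^bsub>C\<^esub> Z))"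
  "lun (full_image C D I) X = (unit C \<otimes>\<^sub>o\<^bsub>C\<^esub> X, fm I (lun C X), X)"
  "run (full_image C D I) X = (X \<otimes>\<^sub>o\<^bsub>C\<^esub> unit C, fm I (run C X), X)"
  by (simp_all add: full_image_def)

context strong_functor
begin

abbreviation "E \<equiv> full_image C D I"
abbreviation "F \<equiv> full_embed C I"

lemma in_Hom_E: "f \<in> Hom E X Y \<longleftrightarrow> X \<in> Ob C \<and> Y \<in> Ob C \<and> (\<exists>g. f = (X, g, Y) \<and> g \<in> Mor D \<and>
    Dom D g = fo I X \<and> Cod D g = fo I Y)"
  by (auto simp: Hom_def)

lemma F_Mor: "f \<in> Mor C \<Longrightarrow> F f \<in> Mor E" "f \<in> Mor C \<Longrightarrow> Dom E (F f) = Dom C f"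
  "f \<in> Mor C \<Longrightarrow> Cod E (F f) = Cod C f"
  by (simp_all add: full_embed_def Hom_def)

lemma F_Cmp: "f \<in> Mor C \<Longrightarrow> g \<in> Mor C \<Longrightarrow> Dom C g = Cod C f \<Longrightarrow> F g \<cdot>\<^bsub>E\<^esub> F f = F (g \<cdot> f)"
  by (simp add: full_embed_def)

lemma F_tmor: "f \<in> Mor C \<Longrightarrow> g \<in> Mor C \<Longrightarrow> F f \<otimes>\<^sub>m\<^bsub>E\<^esub> F g = F (f \<otimes>\<^sub>m g)"
  by (simp add: full_embed_def flip: fmul_natural)

lemma F_Idn: "X \<in> Ob C \<Longrightarrow> Idn E X = F (Idn C X)"
  by (simp add: full_embed_def)

lemma F_structure:
  "X \<in> Ob C \<Longrightarrow> Y \<in> Ob C \<Longrightarrow> Z \<in> Ob C \<Longrightarrow> assc E X Y Z = F (assc C X Y Z)"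
  "X \<in> Ob C \<Longrightarrow> lun E X = F (lun C X)" "X \<in> Ob C \<Longrightarrow> run E X = F (run C X)"
  by (simp_all add: full_embed_def)

lemma is_iso_F: "is_iso C f \<Longrightarrow> is_iso E (F f)"
proof -
  assume f: "is_iso C f"
  have "inverse_mors E (F f) (F (inv_mor C f))"
    using f C.is_iso_in_Mor [OF f] unfolding inverse_mors_def
    by (simp add: F_Mor F_Cmp F_Idn Hom_def del: full_image_mor)
  then show ?thesis unfolding is_iso_def by blast
qed

text \<open>Composing with the isomorphism \<open>I (X' \<otimes> (Y' \<otimes> Z')) \<rightarrow> I X' \<otimes> (I Y' \<otimes> I Z')\<close> turns the claim into naturality
  of the associator of \<open>D\<close>, by the coherence axiom for \<open>I\<close>.\<close>

lemma assc_natural_E: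
  assumes X: "X \<in> Ob C" "Y \<in> Ob C" "Z \<in> Ob C" "X' \<in> Ob C" "Y' \<in> Ob C" "Z' \<in> Ob C"
    and f: "f \<in> Mor D" "Dom D f = fo I X" "Cod D f = fo I X'"
    and g: "g \<in> Mor D" "Dom D g = fo I Y" "Cod D g = fo I Y'"
    and h: "h \<in> Mor D" "Dom D h = fo I Z" "Cod D h = fo I Z'"
  shows "fm I (assc C X' Y' Z') \<ast> inv_mor D (fmul I (X' \<otimes>\<^sub>o Y') Z')
      \<ast> ((inv_mor D (fmul I X' Y') \<ast> (f \<boxtimes> g) \<ast> fmul I X Y) \<boxtimes> h) \<ast> fmul I (X \<otimes>\<^sub>o Y) Z =
    inv_mor D (fmul I X' (Y' \<otimes>\<^sub>o Z'))
      \<ast> (f \<boxtimes> (inv_mor D (fmul I Y' Z') \<ast> (g \<boxtimes> h) \<ast> fmul I Y Z)) \<ast> fmul I X (Y \<otimes>\<^sub>o Z)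
      \<ast> fm I (assc C X Y Z)" (is "?L = ?R")
proof -
  note [simp] = X f g h
  let ?k = "(fmul I X Y \<boxtimes> Idn D (fo I Z)) \<ast> fmul I (X \<otimes>\<^sub>o Y) Z"
  let ?m = "((inv_mor D (fmul I X' Y') \<ast> (f \<boxtimes> g) \<ast> fmul I X Y) \<boxtimes> h) \<ast> fmul I (X \<otimes>\<^sub>o Y) Z"
  have "(Idn D (fo I X') \<boxtimes> fmul I Y' Z') \<ast> fmul I X' (Y' \<otimes>\<^sub>o Z') \<ast> ?L =
      ((Idn D (fo I X') \<boxtimes> fmul I Y' Z') \<ast> fmul I X' (Y' \<otimes>\<^sub>o Z') \<ast> fm I (assc C X' Y' Z'))
        \<ast> inv_mor D (fmul I (X' \<otimes>\<^sub>o Y') Z') \<ast> ?m"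
    by simp
  also have "\<dots> = assc D (fo I X') (fo I Y') (fo I Z') \<ast> ((f \<boxtimes> g) \<boxtimes> h) \<ast> ?k"
    by (simp flip: fmul_assc)
  also have "\<dots> = ((f \<boxtimes> (g \<boxtimes> h)) \<ast> assc D (fo I X) (fo I Y) (fo I Z)) \<ast> ?k"
    by (rule D.reassoc) (use D.assc_natural [of f g h] in simp_all)
  also have "\<dots> = (f \<boxtimes> (g \<boxtimes> h)) \<ast> (Idn D (fo I X) \<boxtimes> fmul I Y Z) \<ast> fmul I X (Y \<otimes>\<^sub>o Z)
      \<ast> fm I (assc C X Y Z)"
    by (simp flip: fmul_assc)
  also have "\<dots> = (Idn D (fo I X') \<boxtimes> fmul I Y' Z') \<ast> fmul I X' (Y' \<otimes>\<^sub>o Z') \<ast> ?R"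
    by simp
  finally have "((Idn D (fo I X') \<boxtimes> fmul I Y' Z') \<ast> fmul I X' (Y' \<otimes>\<^sub>o Z')) \<ast> ?L =
      ((Idn D (fo I X') \<boxtimes> fmul I Y' Z') \<ast> fmul I X' (Y' \<otimes>\<^sub>o Z')) \<ast> ?R"
    by simp
  then show ?thesis
    by (rule D.iso_cancel_left [rotated -1]) simp_all
qed

text \<open>The axioms for the unit isomorphism of \<open>I\<close> reduce this to naturality of the unit isomorphisms of \<open>D\<close>.\<close>

lemma lun_natural_E:
  assumes X: "X \<in> Ob C" "X' \<in> Ob C" and f: "f \<in> Mor D" "Dom D f = fo I X" "Cod D f = fo I X'"
  shows "f \<ast> fm I (lun C X) = fm I (lun C X') \<ast> inv_mor D (fmul I (unit C) X')
      \<ast> (Idn D (fo I (unit C)) \<boxtimes> f) \<ast> fmul I (unit C) X"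
    and "f \<ast> fm I (run C X) = fm I (run C X') \<ast> inv_mor D (fmul I X' (unit C))
      \<ast> (f \<boxtimes> Idn D (fo I (unit C))) \<ast> fmul I X (unit C)"
proof -
  note [simp] = X f
  let ?k = "(fun0 I \<boxtimes> Idn D (fo I X)) \<ast> fmul I (unit C) X"
  have "f \<ast> fm I (lun C X) = (f \<ast> lun D (fo I X)) \<ast> ?k"
    by (simp add: fmul_lun)
  also have "\<dots> = lun D (fo I X') \<ast> (Idn D (unit D) \<boxtimes> f) \<ast> ?k"
    using D.lun_natural [of f] by (intro D.reassoc [symmetric]) simp_all
  finally show "f \<ast> fm I (lun C X) = fm I (lun C X') \<ast> inv_mor D (fmul I (unit C) X')
      \<ast> (Idn D (fo I (unit C)) \<boxtimes> f) \<ast> fmul I (unit C) X"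
    by (simp add: fmul_lun)
  let ?k = "(Idn D (fo I X) \<boxtimes> fun0 I) \<ast> fmul I X (unit C)"
  have "f \<ast> fm I (run C X) = (f \<ast> run D (fo I X)) \<ast> ?k"
    by (simp add: fmul_lun)
  also have "\<dots> = run D (fo I X') \<ast> (f \<boxtimes> Idn D (unit D)) \<ast> ?k"
    using D.run_natural [of f] by (intro D.reassoc [symmetric]) simp_all
  finally show "f \<ast> fm I (run C X) = fm I (run C X') \<ast> inv_mor D (fmul I X' (unit C))
      \<ast> (f \<boxtimes> Idn D (fo I (unit C))) \<ast> fmul I X (unit C)"
    by (simp add: fmul_lun)
qed

lemma category_full_image: "category E"
  unfolding category_def in_Hom_E by (auto simp: Hom_def)

text \<open>The pentagon and the triangle involve only morphisms from \<open>C\<close>, so they hold because the embedding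
  is strict; the naturality axioms concern all morphisms of \<open>E\<close>.\<close>

lemma monoidal_category_full_image: "monoidal_category E"
  unfolding monoidal_category_def
proof (intro conjI ballI allI impI)
  fix X X' Y Y' Z Z' f g h
  assume "f \<in> Hom E X X'" "g \<in> Hom E Y Y'" "h \<in> Hom E Z Z'"
  then show "assc E X' Y' Z' \<cdot>\<^bsub>E\<^esub> ((f \<otimes>\<^sub>m\<^bsub>E\<^esub> g) \<otimes>\<^sub>m\<^bsub>E\<^esub> h) = (f \<otimes>\<^sub>m\<^bsub>E\<^esub> (g \<otimes>\<^sub>m\<^bsub>E\<^esub> h)) \<cdot>\<^bsub>E\<^esub> assc E X Y Z"
    using assc_natural_E [of X Y Z X' Y' Z'] by (auto simp: in_Hom_E)
next
  fix X Y f assume "f \<in> Hom E X Y"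
  then show "f \<cdot>\<^bsub>E\<^esub> lun E X = lun E Y \<cdot>\<^bsub>E\<^esub> (Idn E (unit E) \<otimes>\<^sub>m\<^bsub>E\<^esub> f)"
    "f \<cdot>\<^bsub>E\<^esub> run E X = run E Y \<cdot>\<^bsub>E\<^esub> (f \<otimes>\<^sub>m\<^bsub>E\<^esub> Idn E (unit E))"
    using lun_natural_E [of X Y] by (auto simp: in_Hom_E)
next
  fix W X Y Z assume "W \<in> Ob E" "X \<in> Ob E" "Y \<in> Ob E" "Z \<in> Ob E"
  then have [simp]: "W \<in> Ob C" "X \<in> Ob C" "Y \<in> Ob C" "Z \<in> Ob C" by simp_all
  have "F ((Idn C W \<otimes>\<^sub>m assc C X Y Z) \<cdot> assc C W (X \<otimes>\<^sub>o Y) Z \<cdot> (assc C W X Y \<otimes>\<^sub>m Idn C Z)) =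
      F (assc C W X (Y \<otimes>\<^sub>o Z) \<cdot> assc C (W \<otimes>\<^sub>o X) Y Z)"
    by (simp only: C.pentagon \<open>W \<in> Ob C\<close> \<open>X \<in> Ob C\<close> \<open>Y \<in> Ob C\<close> \<open>Z \<in> Ob C\<close>)
  then show "(Idn E W \<otimes>\<^sub>m\<^bsub>E\<^esub> assc E X Y Z) \<cdot>\<^bsub>E\<^esub> assc E W (X \<otimes>\<^sub>o\<^bsub>E\<^esub> Y) Z \<cdot>\<^bsub>E\<^esub> (assc E W X Y \<otimes>\<^sub>m\<^bsub>E\<^esub> Idn E Z) =
      assc E W X (Y \<otimes>\<^sub>o\<^bsub>E\<^esub> Z) \<cdot>\<^bsub>E\<^esub> assc E (W \<otimes>\<^sub>o\<^bsub>E\<^esub> X) Y Z"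
    by (simp add: F_structure F_Idn F_tmor F_Cmp  del: full_image_mor)
next
  fix X Y assume "X \<in> Ob E" "Y \<in> Ob E"
  then have [simp]: "X \<in> Ob C" "Y \<in> Ob C" by simp_all
  have "F ((Idn C X \<otimes>\<^sub>m lun C Y) \<cdot> assc C X (unit C) Y) = F (run C X \<otimes>\<^sub>m Idn C Y)"
    by (simp only: C.triangle \<open>X \<in> Ob C\<close> \<open>Y \<in> Ob C\<close>)
  then show "(Idn E X \<otimes>\<^sub>m\<^bsub>E\<^esub> lun E Y) \<cdot>\<^bsub>E\<^esub> assc E X (unit E) Y = run E X \<otimes>\<^sub>m\<^bsub>E\<^esub> Idn E Y"
    by (simp add: F_structure F_Idn F_tmor F_Cmp  del: full_image_mor)
next
  fix X assume "X \<in> Ob E"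
  then have [simp]: "X \<in> Ob C" by simp
  show "is_iso E (lun E X)" "is_iso E (run E X)"
    using is_iso_F [of "lun C X"] is_iso_F [of "run C X"] by (simp_all flip: F_structure)
next
  fix X Y Z assume "X \<in> Ob E" "Y \<in> Ob E" "Z \<in> Ob E"
  then have [simp]: "X \<in> Ob C" "Y \<in> Ob C" "Z \<in> Ob C" by simp_all
  show "is_iso E (assc E X Y Z)"
    using is_iso_F [of "assc C X Y Z"] by (simp flip: F_structure)
next
  show "category E" by (rule category_full_image)
qed (auto simp: in_Hom_E Hom_def)

lemma strict_extension_full_image: "strict_extension C E F"
proof -
  interpret E: moncat_calculus E
    by unfold_locales (rule monoidal_category_full_image)
  show ?thesis
    by unfold_locales
      (simp_all add: F_Mor F_structure F_Idn F_tmor F_Cmp  del: full_image_mor)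
qed

end

section \<open>Projection maps of a right adjoint\<close>

text \<open>The projection maps \<open>X \<otimes> P Y \<rightarrow> P (I X \<otimes> Y)\<close> and \<open>P Y \<otimes> X \<rightarrow> P (Y \<otimes> I X)\<close> of a right adjoint
  \<open>P\<close> of a strong monoidal functor \<open>I\<close>, and their composites with the unit isomorphisms at \<open>Y = 1\<close>.\<close>

definition proj1 ::
  "('x, 'm) moncat \<Rightarrow> ('y, 'n) moncat \<Rightarrow> ('x, 'm, 'y, 'n) mfunct \<Rightarrow> ('y, 'n, 'x, 'm) funct \<Rightarrow>
   ('x \<Rightarrow> 'm) \<Rightarrow> ('y \<Rightarrow> 'n) \<Rightarrow> 'x \<Rightarrow> 'y \<Rightarrow> 'm" where
  "proj1 C D I P \<eta> \<epsilon> X Y =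
     fm P (Idn D (fo I X) \<otimes>\<^sub>m\<^bsub>D\<^esub> \<epsilon> Y) \<cdot>\<^bsub>C\<^esub> fm P (fmul I X (fo P Y)) \<cdot>\<^bsub>C\<^esub> \<eta> (X \<otimes>\<^sub>o\<^bsub>C\<^esub> fo P Y)"

definition proj2 ::
  "('x, 'm) moncat \<Rightarrow> ('y, 'n) moncat \<Rightarrow> ('x, 'm, 'y, 'n) mfunct \<Rightarrow> ('y, 'n, 'x, 'm) funct \<Rightarrow>
   ('x \<Rightarrow> 'm) \<Rightarrow> ('y \<Rightarrow> 'n) \<Rightarrow> 'y \<Rightarrow> 'x \<Rightarrow> 'm" where
  "proj2 C D I P \<eta> \<epsilon> Y X =
     fm P (\<epsilon> Y \<otimes>\<^sub>m\<^bsub>D\<^esub> Idn D (fo I X)) \<cdot>\<^bsub>C\<^esub> fm P (fmul I (fo P Y) X) \<cdot>\<^bsub>C\<^esub> \<eta> (fo P Y \<otimes>\<^sub>o\<^bsub>C\<^esub> X)"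

definition proj1_unit ::
  "('x, 'm) moncat \<Rightarrow> ('y, 'n) moncat \<Rightarrow> ('x, 'm, 'y, 'n) mfunct \<Rightarrow> ('y, 'n, 'x, 'm) funct \<Rightarrow>
   ('x \<Rightarrow> 'm) \<Rightarrow> ('y \<Rightarrow> 'n) \<Rightarrow> 'x \<Rightarrow> 'm" where
  "proj1_unit C D I P \<eta> \<epsilon> X = fm P (run D (fo I X)) \<cdot>\<^bsub>C\<^esub> proj1 C D I P \<eta> \<epsilon> X (unit D)"

definition proj2_unit ::
  "('x, 'm) moncat \<Rightarrow> ('y, 'n) moncat \<Rightarrow> ('x, 'm, 'y, 'n) mfunct \<Rightarrow> ('y, 'n, 'x, 'm) funct \<Rightarrow>
   ('x \<Rightarrow> 'm) \<Rightarrow> ('y \<Rightarrow> 'n) \<Rightarrow> 'x \<Rightarrow> 'm" where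
  "proj2_unit C D I P \<eta> \<epsilon> X = fm P (lun D (fo I X)) \<cdot>\<^bsub>C\<^esub> proj2 C D I P \<eta> \<epsilon> (unit D) X"

locale strong_adjunction = strong_functor C D I
  for C :: "('x, 'm) moncat" (structure) and D :: "('y, 'n) moncat" and I +
  fixes P :: "('y, 'n, 'x, 'm) funct" and \<eta> :: "'x \<Rightarrow> 'm" and \<epsilon> :: "'y \<Rightarrow> 'n"
  assumes adj: "adjunction C D I P \<eta> \<epsilon>"
begin

abbreviation pr1 where "pr1 \<equiv> proj1_unit C D I P \<eta> \<epsilon>"
abbreviation pr2 where "pr2 \<equiv> proj2_unit C D I P \<eta> \<epsilon>"

lemma functor_P: "is_functor D C P"
  using adj by (simp add: adjunction_def)

lemma P_typing [simp]:
  "X \<in> Ob D \<Longrightarrow> fo P X \<in> Ob C" "f \<in> Mor D \<Longrightarrow> fm P f \<in> Mor C"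
  "f \<in> Mor D \<Longrightarrow> Dom C (fm P f) = fo P (Dom D f)" "f \<in> Mor D \<Longrightarrow> Cod C (fm P f) = fo P (Cod D f)"
  using functor_P unfolding is_functor_def by (auto simp: Hom_def)

lemma P_Idn [simp]: "X \<in> Ob D \<Longrightarrow> fm P (Idn D X) = Idn C (fo P X)"
  using functor_P by (simp add: is_functor_def)

lemma P_Cmp:
  "f \<in> Mor D \<Longrightarrow> g \<in> Mor D \<Longrightarrow> Dom D g = Cod D f \<Longrightarrow> fm P (g \<ast> f) = fm P g \<cdot> fm P f"
  using functor_P unfolding is_functor_def by (auto simp: Hom_def)

lemma P_is_iso:
  assumes "is_iso D f"
  shows "is_iso C (fm P f)"
proof -
  have "inverse_mors C (fm P f) (fm P (inv_mor D f))"
    using assms D.is_iso_in_Mor [OF assms]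
    by (simp add: inverse_mors_def Hom_def flip: P_Cmp)
  then show ?thesis by (rule C.is_isoI)
qed

lemma unit_counit_typing [simp]:
  "X \<in> Ob C \<Longrightarrow> \<eta> X \<in> Mor C" "X \<in> Ob C \<Longrightarrow> Dom C (\<eta> X) = X" "X \<in> Ob C \<Longrightarrow> Cod C (\<eta> X) = fo P (fo I X)"
  "Y \<in> Ob D \<Longrightarrow> \<epsilon> Y \<in> Mor D" "Y \<in> Ob D \<Longrightarrow> Dom D (\<epsilon> Y) = fo I (fo P Y)" "Y \<in> Ob D \<Longrightarrow> Cod D (\<epsilon> Y) = Y"
  using adj by (auto simp: adjunction_def nat_transf_def Hom_def comp_funct_def id_funct_def)

lemma \<eta>_natural: "f \<in> Mor C \<Longrightarrow> fm P (fm I f) \<cdot> \<eta> (Dom C f) = \<eta> (Cod C f) \<cdot> f"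
  and \<epsilon>_natural: "g \<in> Mor D \<Longrightarrow> \<epsilon> (Cod D g) \<ast> fm I (fm P g) = g \<ast> \<epsilon> (Dom D g)"
  using adj by (simp_all add: adjunction_def nat_transf_def Hom_def comp_funct_def id_funct_def)

lemma triangle_I: "X \<in> Ob C \<Longrightarrow> \<epsilon> (fo I X) \<ast> fm I (\<eta> X) = Idn D (fo I X)"
  and triangle_P: "Y \<in> Ob D \<Longrightarrow> fm P (\<epsilon> Y) \<cdot> \<eta> (fo P Y) = Idn C (fo P Y)"
  using adj by (simp_all add: adjunction_def)

text \<open>The transpose of \<open>g : I W \<rightarrow> Y\<close> is \<open>P g \<cdot> \<eta> W\<close>. Every structure map of \<open>P\<close> is of this form, so it is
  identified by its composite with \<open>\<epsilon>\<close>.\<close>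

lemma \<epsilon>_transpose:
  assumes "W \<in> Ob C" "g \<in> Mor D" "Dom D g = fo I W" "Y = Cod D g"
  shows "\<epsilon> Y \<ast> fm I (fm P g \<cdot> \<eta> W) = g"
proof -
  have Y: "Cod D g \<in> Ob D" using assms by simp
  have "\<epsilon> Y \<ast> fm I (fm P g) \<ast> fm I (\<eta> W) = (g \<ast> \<epsilon> (fo I W)) \<ast> fm I (\<eta> W)"
    by (rule D.reassoc) (use assms Y \<epsilon>_natural [of g] in simp_all)
  then show ?thesis
    using assms Y by (simp add: triangle_I)
qed

lemma \<epsilon>_unique:
  assumes "f \<in> Mor C" "g \<in> Mor C" "Dom C f = Dom C g" "Y \<in> Ob D" "Cod C f = fo P Y"
    "Cod C g = fo P Y" "\<epsilon> Y \<ast> fm I f = \<epsilon> Y \<ast> fm I g"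
  shows "f = g"
proof -
  have "f = fm P (\<epsilon> Y \<ast> fm I f) \<cdot> \<eta> (Dom C f)"
    if "f \<in> Mor C" "Cod C f = fo P Y" for f
  proof -
    have D: "Dom C f \<in> Ob C" using that by simp
    have "fm P (\<epsilon> Y \<ast> fm I f) \<cdot> \<eta> (Dom C f) = fm P (\<epsilon> Y) \<cdot> \<eta> (fo P Y) \<cdot> f"
      using that D assms(4) \<eta>_natural [of f] by (simp add: P_Cmp)
    also have "\<dots> = Idn C (fo P Y) \<cdot> f"
      by (rule C.reassoc [OF triangle_P]) (use that assms(4) in simp_all)
    finally show ?thesis using that by simp
  qed
  then show ?thesis
    using assms by metis
qed

abbreviation "A \<equiv> fo P (unit D)"
abbreviation "radj_lax \<equiv> right_adjoint_lax C D I P \<eta> \<epsilon>"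
abbreviation "mult_A \<equiv> fm P (lun D (unit D)) \<cdot> fmul radj_lax (unit D) (unit D)"
abbreviation "unit_A \<equiv> fun0 radj_lax"
abbreviation "monad_lax \<equiv> comp_lax C radj_lax (strong_as_lax D I)"

lemma radj_lax_sel [simp]: "fo radj_lax = fo P" "fm radj_lax = fm P"
  by (simp_all add: right_adjoint_lax_def)

text \<open>The counit of the adjunction, as a morphism \<open>P (I X) \<rightarrow> X\<close> of the full image, and the morphism
  \<open>e : A \<rightarrow> 1\<close> that it provides at the unit object.\<close>

definition \<nu> :: "'x \<Rightarrow> 'x \<times> 'n \<times> 'x" where
  "\<nu> X = (fo P (fo I X), \<epsilon> (fo I X), X)"

definition e :: "'x \<times> 'n \<times> 'x" where
  "e = (A, inv_mor D (fun0 I) \<ast> \<epsilon> (unit D), unit C)"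

lemma \<epsilon>_proj1: "X \<in> Ob C \<Longrightarrow> \<epsilon> (fo I X) \<ast> fm I (pr1 X) =
    run D (fo I X) \<ast> (Idn D (fo I X) \<boxtimes> \<epsilon> (unit D)) \<ast> fmul I X A"
  and \<epsilon>_proj2: "X \<in> Ob C \<Longrightarrow> \<epsilon> (fo I X) \<ast> fm I (pr2 X) =
    lun D (fo I X) \<ast> (\<epsilon> (unit D) \<boxtimes> Idn D (fo I X)) \<ast> fmul I A X"
  using \<epsilon>_transpose [of "X \<otimes>\<^sub>o A" "run D (fo I X) \<ast> (Idn D (fo I X) \<boxtimes> \<epsilon> (unit D)) \<ast> fmul I X A" "fo I X"]
    \<epsilon>_transpose [of "A \<otimes>\<^sub>o X" "lun D (fo I X) \<ast> (\<epsilon> (unit D) \<boxtimes> Idn D (fo I X)) \<ast> fmul I A X" "fo I X"]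
  by (simp_all add: proj1_unit_def proj1_def proj2_unit_def proj2_def P_Cmp)

lemma proj_typing [simp]:
  assumes "X \<in> Ob C"
  shows "pr1 X \<in> Mor C" "Dom C (pr1 X) = X \<otimes>\<^sub>o A"
    "Cod C (pr1 X) = fo P (fo I X)"
    "pr2 X \<in> Mor C" "Dom C (pr2 X) = A \<otimes>\<^sub>o X"
    "Cod C (pr2 X) = fo P (fo I X)"
  using assms by (simp_all add: proj1_unit_def proj1_def proj2_unit_def proj2_def)

text \<open>The absorptions along \<open>e\<close> are the transposes of the projection maps.\<close>

lemma absorb_eq:
  assumes "X \<in> Ob C"
  shows "absorb_l E e X = (A \<otimes>\<^sub>o X, \<epsilon> (fo I X) \<ast> fm I (pr2 X), X)"
    and "absorb_r E e X = (X \<otimes>\<^sub>o A, \<epsilon> (fo I X) \<ast> fm I (pr1 X), X)"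
  using assms unfolding \<epsilon>_proj1 [OF assms] \<epsilon>_proj2 [OF assms]
  by (simp_all add: absorb_l_def absorb_r_def e_def fmul_lun)

lemma \<nu>_proj:
  assumes "X \<in> Ob C"
  shows "\<nu> X \<cdot>\<^bsub>E\<^esub> F (pr2 X) = absorb_l E e X"
    and "\<nu> X \<cdot>\<^bsub>E\<^esub> F (pr1 X) = absorb_r E e X"
  using assms by (simp_all add: absorb_eq \<nu>_def full_embed_def)

sublocale strict_extension C E F
  by (rule strict_extension_full_image)

lemma \<nu>_cofree: "cofree (\<lambda>X. fo P (fo I X)) \<nu>"
  unfolding cofree_def
proof (intro ballI conjI impI)
  fix X f g assume "X \<in> Ob C" "f \<in> Mor C" "g \<in> Mor C" "Dom C f = Dom C g"
    "Cod C f = fo P (fo I X)" "Cod C g = fo P (fo I X)" "\<nu> X \<cdot>\<^bsub>E\<^esub> F f = \<nu> X \<cdot>\<^bsub>E\<^esub> F g"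
  then show "f = g"
    by (intro \<epsilon>_unique [of f g "fo I X"]) (simp_all add: \<nu>_def full_embed_def)
qed (simp_all add: \<nu>_def Hom_def)

lemma \<epsilon>_mult: "X \<in> Ob D \<Longrightarrow> Y \<in> Ob D \<Longrightarrow> \<epsilon> (X \<otimes>\<^sub>o\<^bsub>D\<^esub> Y) \<ast> fm I (fmul radj_lax X Y) =
    (\<epsilon> X \<boxtimes> \<epsilon> Y) \<ast> fmul I (fo P X) (fo P Y)"
  and \<epsilon>_munit: "\<epsilon> (unit D) \<ast> fm I unit_A = fun0 I"
  using \<epsilon>_transpose [of "fo P X \<otimes>\<^sub>o fo P Y" "(\<epsilon> X \<boxtimes> \<epsilon> Y) \<ast> fmul I (fo P X) (fo P Y)" "X \<otimes>\<^sub>o\<^bsub>D\<^esub> Y"]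
    \<epsilon>_transpose [of "unit C" "fun0 I" "unit D"]
  by (simp_all add: right_adjoint_lax_def P_Cmp)

lemma radj_lax_typing [simp]:
  "X \<in> Ob D \<Longrightarrow> Y \<in> Ob D \<Longrightarrow> fmul radj_lax X Y \<in> Mor C"
  "X \<in> Ob D \<Longrightarrow> Y \<in> Ob D \<Longrightarrow> Dom C (fmul radj_lax X Y) = fo P X \<otimes>\<^sub>o fo P Y"
  "X \<in> Ob D \<Longrightarrow> Y \<in> Ob D \<Longrightarrow> Cod C (fmul radj_lax X Y) = fo P (X \<otimes>\<^sub>o\<^bsub>D\<^esub> Y)"
  "unit_A \<in> Mor C" "Dom C unit_A = unit C" "Cod C unit_A = A"
  by (simp_all add: right_adjoint_lax_def)

lemma \<epsilon>_mult_A: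
  "\<epsilon> (unit D) \<ast> fm I mult_A = \<epsilon> (unit D) \<ast> lun D (fo I A) \<ast> (\<epsilon> (unit D) \<boxtimes> Idn D (fo I A)) \<ast> fmul I A A"
proof -
  have "\<epsilon> (unit D) \<ast> fm I mult_A = (lun D (unit D) \<ast> \<epsilon> (unit D \<otimes>\<^sub>o\<^bsub>D\<^esub> unit D)) \<ast> fm I (fmul radj_lax (unit D) (unit D))"
    using D.reassoc [OF \<epsilon>_natural [of "lun D (unit D)"], of "fm I (fmul radj_lax (unit D) (unit D))"] by simp
  also have "\<dots> = lun D (unit D) \<ast> (\<epsilon> (unit D) \<boxtimes> \<epsilon> (unit D)) \<ast> fmul I A A"
    by (simp add: \<epsilon>_mult)
  also have "\<dots> = lun D (unit D) \<ast> (Idn D (unit D) \<boxtimes> \<epsilon> (unit D)) \<ast> (\<epsilon> (unit D) \<boxtimes> Idn D (fo I A)) \<ast> fmul I A A"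
    by simp
  also have "\<dots> = (\<epsilon> (unit D) \<ast> lun D (fo I A)) \<ast> (\<epsilon> (unit D) \<boxtimes> Idn D (fo I A)) \<ast> fmul I A A"
    by (rule D.reassoc) (use D.lun_natural [of "\<epsilon> (unit D)"] in simp_all)
  finally show ?thesis by simp
qed

text \<open>In terms of \<open>r : A \<otimes> A \<rightarrow> P (I A)\<close> this is \<open>\<mu> = P(e) r\<close>; both sides have transpose \<open>e (e \<otimes> A)\<close>.\<close>

lemma mult_A_eq: "mult_A = fm P (\<epsilon> (unit D)) \<cdot> pr2 A"
proof (rule \<epsilon>_unique [of _ _ "unit D"])
  have "\<epsilon> (unit D) \<ast> fm I (fm P (\<epsilon> (unit D))) \<ast> fm I (pr2 A) =
      (\<epsilon> (unit D) \<ast> \<epsilon> (fo I A)) \<ast> fm I (pr2 A)"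
    by (rule D.reassoc) (use \<epsilon>_natural [of "\<epsilon> (unit D)"] in simp_all)
  then show "\<epsilon> (unit D) \<ast> fm I mult_A =
      \<epsilon> (unit D) \<ast> fm I (fm P (\<epsilon> (unit D)) \<cdot> pr2 A)"
    unfolding \<epsilon>_mult_A by (simp add: \<epsilon>_proj2)
qed simp_all

text \<open>The structure on \<open>P I\<close> consists of the transposes of the tensor products \<open>\<nu> X \<otimes> \<nu> Y\<close> in the full image.\<close>

lemma cofree_lax_monad: "cofree_lax monad_lax \<nu>"
proof -
  have P_left: "\<epsilon> (Cod D g) \<ast> (fm I (fm P g) \<ast> h) = (g \<ast> \<epsilon> (Dom D g)) \<ast> h"
    if "g \<in> Mor D" "h \<in> Mor D" "Cod D h = fo I (fo P (Dom D g))" for g h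
  proof -
    have [simp]: "Dom D g \<in> Ob D" "Cod D g \<in> Ob D" using that by simp_all
    show ?thesis by (rule D.reassoc [OF \<epsilon>_natural]) (use that in simp_all)
  qed
  have mult_A: "fmul monad_lax X Y \<in> Hom C (fo monad_lax X \<otimes>\<^sub>o fo monad_lax Y)
       (fo monad_lax (X \<otimes>\<^sub>o Y)) \<and> \<nu> (X \<otimes>\<^sub>o Y) \<cdot>\<^bsub>E\<^esub> F (fmul monad_lax X Y) = \<nu> X \<otimes>\<^sub>m\<^bsub>E\<^esub> \<nu> Y"
    if [simp]: "X \<in> Ob C" "Y \<in> Ob C" for X Y
    using P_left [of "inv_mor D (fmul I X Y)" "fm I (fmul radj_lax (fo I X) (fo I Y))"]
    by (simp add: comp_lax_def strong_as_lax_def \<nu>_def full_embed_def Hom_def \<epsilon>_mult)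
  have unit: "fun0 monad_lax \<in> Hom C (unit C) (fo monad_lax (unit C)) \<and>
      \<nu> (unit C) \<cdot>\<^bsub>E\<^esub> F (fun0 monad_lax) = Idn E (unit C)"
    using P_left [of "inv_mor D (fun0 I)" "fm I unit_A"]
    by (simp add: comp_lax_def strong_as_lax_def \<nu>_def full_embed_def Hom_def \<epsilon>_munit)
  have fnc: "is_functor C C monad_lax"
    unfolding is_functor_def using C.cat
    by (auto simp: comp_lax_def strong_as_lax_def right_adjoint_lax_def Hom_def P_Cmp)
  have nat: "\<nu> (Cod C f) \<cdot>\<^bsub>E\<^esub> F (fm monad_lax f) = F f \<cdot>\<^bsub>E\<^esub> \<nu> (Dom C f)" if "f \<in> Mor C" for f
    using that \<epsilon>_natural [of "fm I f"]
    by (simp add: comp_lax_def strong_as_lax_def right_adjoint_lax_def \<nu>_def full_embed_def)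
  show ?thesis
    unfolding cofree_lax_def
    using fnc nat mult_A unit \<nu>_cofree
    by (simp add: comp_lax_def strong_as_lax_def right_adjoint_lax_def)
qed

end

text \<open>The part of the hypotheses that involves the right adjoint only: the projection map is invertible at
  the unit object, and \<open>\<sigma>\<close> compares its two versions.\<close>

locale right_projection = strong_adjunction +
  fixes \<sigma>
  assumes proj2_iso: "X \<in> Ob C \<Longrightarrow> is_iso C (pr2 X)"
    and \<sigma>_Hom': "X \<in> Ob C \<Longrightarrow> \<sigma> X \<in> Hom C (A \<otimes>\<^sub>o X) (X \<otimes>\<^sub>o A)"
    and \<sigma>_iso': "X \<in> Ob C \<Longrightarrow> is_iso C (\<sigma> X)"
    and proj_\<sigma>: "X \<in> Ob C \<Longrightarrow> pr1 X \<cdot> \<sigma> X = pr2 X"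
begin

lemma \<sigma>_typing' [simp]:
  assumes "X \<in> Ob C"
  shows "\<sigma> X \<in> Mor C" "Dom C (\<sigma> X) = A \<otimes>\<^sub>o X" "Cod C (\<sigma> X) = X \<otimes>\<^sub>o A"
  using \<sigma>_Hom' [OF assms] by (auto simp: Hom_def)

lemma proj1_iso:
  assumes X: "X \<in> Ob C"
  shows "is_iso C (pr1 X)"
proof -
  have "pr1 X = pr2 X \<cdot> inv_mor C (\<sigma> X)"
    using X \<sigma>_iso' [OF X] by (simp flip: proj_\<sigma>)
  then show ?thesis
    using X \<sigma>_iso' [OF X] proj2_iso [OF X] by simp
qed

sublocale cofree_monoid C E F A e \<sigma> mult_A unit_A
proof unfold_locales
  fix X assume X: "X \<in> Ob C"
  show "absorb_r E e X \<cdot>\<^bsub>E\<^esub> F (\<sigma> X) = absorb_l E e X"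
    using X arg_cong [OF proj_\<sigma> [OF X], of "fm I"]
    by (simp add: absorb_eq full_embed_def)
next
  show "cofree (\<lambda>X. A \<otimes>\<^sub>o X) (absorb_l E e)"
    unfolding cofree_def
  proof (intro ballI conjI impI)
    fix X f g assume fg: "X \<in> Ob C" "f \<in> Mor C" "g \<in> Mor C" "Dom C f = Dom C g"
      "Cod C f = A \<otimes>\<^sub>o X" "Cod C g = A \<otimes>\<^sub>o X" "absorb_l E e X \<cdot>\<^bsub>E\<^esub> F f = absorb_l E e X \<cdot>\<^bsub>E\<^esub> F g"
    let ?p = "pr2 X"
    have "?p \<cdot> f = ?p \<cdot> g"
      using fg by (intro \<epsilon>_unique [of _ _ "fo I X"]) (simp_all add: absorb_eq full_embed_def)
    then show "f = g"
      by (rule C.iso_cancel_left [rotated -1]) (use fg proj2_iso in simp_all)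
  qed (simp_all add: absorb_eq Hom_def)
next
  show "e \<cdot>\<^bsub>E\<^esub> F mult_A = e \<cdot>\<^bsub>E\<^esub> absorb_l E e A"
    unfolding absorb_eq(1) [OF P_typing(1) [OF D.unit_in_Ob]] using \<epsilon>_mult_A
    by (simp add: \<epsilon>_proj2 e_def full_embed_def)
  show "e \<cdot>\<^bsub>E\<^esub> F unit_A = Idn E (unit C)"
    by (simp add: e_def full_embed_def \<epsilon>_munit)
qed (simp_all add: e_def Hom_def \<sigma>_iso')

end

section \<open>Duality\<close>

context strong_functor
begin

lemma I_inverse_mors: "inverse_mors C f g \<Longrightarrow> inverse_mors D (fm I f) (fm I g)"
  unfolding inverse_mors_def by (auto simp: Hom_def simp flip: I_Cmp)

lemma I_is_iso [simp]: "is_iso C f \<Longrightarrow> is_iso D (fm I f)"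
  and I_inv_mor: "is_iso C f \<Longrightarrow> fm I (inv_mor C f) = inv_mor D (fm I f)"
  by (meson C.inverse_mors_inv_mor I_inverse_mors D.is_isoI,
      metis C.inverse_mors_inv_mor I_inverse_mors D.inv_mor_eqI)

abbreviation "I_op \<equiv> strong_as_lax D I"

lemma functor_opp: "is_functor (opp C) (opp D) I_op"
  unfolding is_functor_def
  by (auto simp: category_opp C.cat D.cat strong_as_lax_def Hom_def)

text \<open>The inverses of the structure isomorphisms make \<open>I\<close> a strong monoidal functor between the opposite
  categories, whose axioms are the inverses of the axioms for \<open>I\<close>.\<close>

lemma strong_monoidal_opp: "strong_monoidal (opp C) (opp D) I_op"
  unfolding strong_monoidal_def colax_monoidal_def
proof (intro conjI ballI allI impI functor_opp)
  fix X X' Y Y' f g assume "f \<in> Hom (opp C) X X'" "g \<in> Hom (opp C) Y Y'"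
  then have f: "f \<in> Mor C" "g \<in> Mor C" and eq: "X = Cod C f" "X' = Dom C f" "Y = Cod C g" "Y' = Dom C g"
    by (auto simp: Hom_def)
  have "fm I (f \<otimes>\<^sub>m g) \<ast> inv_mor D (fmul I X' Y') =
      inv_mor D (fmul I X Y) \<ast> (fm I f \<boxtimes> fm I g)"
    by (rule D.iso_cancel_left [of "fmul I X Y"])
      (use f D.reassoc [OF fmul_natural [of f g], of "inv_mor D (fmul I X' Y')"] in \<open>simp_all add: eq\<close>)
  then show "Cmp (opp D) (tmor (opp D) (fm I_op f) (fm I_op g))
       (fmul I_op X Y) =
      Cmp (opp D) (fmul I_op X' Y') (fm I_op (tmor (opp C) f g))"
    by (simp add: strong_as_lax_def)
next
  fix X Y Z assume "X \<in> Ob (opp C)" "Y \<in> Ob (opp C)" "Z \<in> Ob (opp C)"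
  then have [simp]: "X \<in> Ob C" "Y \<in> Ob C" "Z \<in> Ob C" by simp_all
  have "inv_mor D (fmul I (X \<otimes>\<^sub>o Y) Z) \<ast> (inv_mor D (fmul I X Y) \<boxtimes> Idn D (fo I Z))
       \<ast> iassc D (fo I X) (fo I Y) (fo I Z) =
      fm I (iassc C X Y Z) \<ast> inv_mor D (fmul I X (Y \<otimes>\<^sub>o Z)) \<ast> (Idn D (fo I X) \<boxtimes> inv_mor D (fmul I Y Z))"
    using arg_cong [OF fmul_assc [of X Y Z], of "inv_mor D"]
    by (simp add: D.inv_mor_Cmp D.inv_mor_tmor I_inv_mor)
  then show "Cmp (opp D) (assc (opp D) (fo I_op X) (fo I_op Y) (fo I_op Z))
       (Cmp (opp D) (tmor (opp D) (fmul I_op X Y) (Idn (opp D) (fo I_op Z)))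
         (fmul I_op (tob (opp C) X Y) Z)) =
      Cmp (opp D) (tmor (opp D) (Idn (opp D) (fo I_op X)) (fmul I_op Y Z))
       (Cmp (opp D) (fmul I_op X (tob (opp C) Y Z))
         (fm I_op (assc (opp C) X Y Z)))"
    by (simp add: strong_as_lax_def)
next
  fix X assume "X \<in> Ob (opp C)"
  then have [simp]: "X \<in> Ob C" by simp
  have "fm I (inv_mor C (lun C X)) = inv_mor D (fmul I (unit C) X) \<ast>
      (inv_mor D (fun0 I) \<boxtimes> Idn D (fo I X)) \<ast> inv_mor D (lun D (fo I X))"
    by (simp add: I_inv_mor fmul_lun D.inv_mor_Cmp D.inv_mor_tmor)
  then show "Cmp (opp D) (lun (opp D) (fo I_op X))
       (Cmp (opp D) (tmor (opp D) (fun0 I_op) (Idn (opp D) (fo I_op X)))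
         (fmul I_op (unit (opp C)) X)) =
      fm I_op (lun (opp C) X)"
    by (simp add: strong_as_lax_def)
  have "fm I (inv_mor C (run C X)) = inv_mor D (fmul I X (unit C)) \<ast>
      (Idn D (fo I X) \<boxtimes> inv_mor D (fun0 I)) \<ast> inv_mor D (run D (fo I X))"
    by (simp add: I_inv_mor fmul_lun D.inv_mor_Cmp D.inv_mor_tmor)
  then show "Cmp (opp D) (run (opp D) (fo I_op X))
       (Cmp (opp D) (tmor (opp D) (Idn (opp D) (fo I_op X)) (fun0 I_op))
         (fmul I_op X (unit (opp C)))) =
      fm I_op (run (opp C) X)"
    by (simp add: strong_as_lax_def)
qed (simp_all add: strong_as_lax_def Hom_def)

end

lemma adjunction_opp:
  assumes "adjunction D C P I \<eta> \<epsilon>" "strong_functor C D I"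
  shows "adjunction (opp C) (opp D) (strong_as_lax D I) P \<epsilon> \<eta>"
proof -
  interpret strong_functor C D I by fact
  show ?thesis
    using assms(1) functor_opp category_opp [OF C.cat] category_opp [OF D.cat]
    unfolding adjunction_def is_functor_def nat_transf_def
    by (simp add: strong_as_lax_def comp_funct_def id_funct_def)
qed

lemma functor_oppD:
  assumes "is_functor (opp C) (opp D) G" "category C" "category D"
  shows "is_functor C D G"
  using assms unfolding is_functor_def by simp

text \<open>Each axiom of the lax structure in the opposite category mentions an inverse structure isomorphism,
  which is moved to the other side.\<close>

lemma colax_monoidal_oppI:
  fixes C :: "('x, 'm) moncat" (structure)
  assumes G: "lax_monoidal (opp C) (opp C) G" and C: "monoidal_category C"
  shows "colax_monoidal C C G"
proof -
  interpret moncat_calculus C by unfold_locales (rule C)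
  note ax = G [unfolded lax_monoidal_def opp_sel Hom_opp]
  have fnc: "is_functor C C G"
    using functor_oppD [OF conjunct1 [OF ax] cat cat] .
  have m_Hom: "fmul G X Y \<in> Hom C (fo G (X \<otimes>\<^sub>o Y)) (fo G X \<otimes>\<^sub>o fo G Y)"
    if "X \<in> Ob C" "Y \<in> Ob C" for X Y
    using ax that by blast
  have u_Hom: "fun0 G \<in> Hom C (fo G (unit C)) (unit C)"
    using ax by blast
  have m_natural: "fmul G X Y \<cdot> fm G (f \<otimes>\<^sub>m g) = (fm G f \<otimes>\<^sub>m fm G g) \<cdot> fmul G X' Y'"
    if "f \<in> Hom C X' X" "g \<in> Hom C Y' Y" for X X' Y Y' f g
    using ax that by blast
  have m_assc: "((fmul G X Y \<otimes>\<^sub>m Idn C (fo G Z)) \<cdot> fmul G (X \<otimes>\<^sub>o Y) Z) \<cdot> fm G (iassc C X Y Z) =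
        (iassc C (fo G X) (fo G Y) (fo G Z) \<cdot> (Idn C (fo G X) \<otimes>\<^sub>m fmul G Y Z)) \<cdot> fmul G X (Y \<otimes>\<^sub>o Z)"
    if "X \<in> Ob C" "Y \<in> Ob C" "Z \<in> Ob C" for X Y Z
    using ax that by blast
  have m_unit: "((fun0 G \<otimes>\<^sub>m Idn C (fo G X)) \<cdot> fmul G (unit C) X) \<cdot> fm G (inv_mor C (lun C X)) =
        inv_mor C (lun C (fo G X))"
      "((Idn C (fo G X) \<otimes>\<^sub>m fun0 G) \<cdot> fmul G X (unit C)) \<cdot> fm G (inv_mor C (run C X)) =
        inv_mor C (run C (fo G X))"
    if "X \<in> Ob C" for X
    using ax that by blast+
  have [simp]: "X \<in> Ob C \<Longrightarrow> fo G X \<in> Ob C" "f \<in> Mor C \<Longrightarrow> fm G f \<in> Mor C"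
    "f \<in> Mor C \<Longrightarrow> Dom C (fm G f) = fo G (Dom C f)" "f \<in> Mor C \<Longrightarrow> Cod C (fm G f) = fo G (Cod C f)"
    for X f
    using fnc unfolding is_functor_def by (auto simp: Hom_def)
  have G_Idn [simp]: "X \<in> Ob C \<Longrightarrow> fm G (Idn C X) = Idn C (fo G X)" for X
    using fnc by (simp add: is_functor_def)
  have G_Cmp: "f \<in> Mor C \<Longrightarrow> g \<in> Mor C \<Longrightarrow> Dom C g = Cod C f \<Longrightarrow> fm G (g \<cdot> f) = fm G g \<cdot> fm G f" for f g
    using fnc unfolding is_functor_def by (auto simp: Hom_def)
  have G_inv: "fm G (inv_mor C f) \<cdot> fm G f = Idn C (fo G (Dom C f))" if "is_iso C f" for f
    using that is_iso_in_Mor [OF that] by (simp flip: G_Cmp)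
  have [simp]: "X \<in> Ob C \<Longrightarrow> Y \<in> Ob C \<Longrightarrow> fmul G X Y \<in> Mor C"
    "X \<in> Ob C \<Longrightarrow> Y \<in> Ob C \<Longrightarrow> Dom C (fmul G X Y) = fo G (X \<otimes>\<^sub>o Y)"
    "X \<in> Ob C \<Longrightarrow> Y \<in> Ob C \<Longrightarrow> Cod C (fmul G X Y) = fo G X \<otimes>\<^sub>o fo G Y"
    "fun0 G \<in> Mor C" "Dom C (fun0 G) = fo G (unit C)" "Cod C (fun0 G) = unit C" for X Y
    using m_Hom u_Hom by (auto simp: Hom_def)
  show ?thesis
    unfolding colax_monoidal_def
  proof (intro conjI ballI allI impI fnc)
    fix X X' Y Y' f g assume "f \<in> Hom C X X'" "g \<in> Hom C Y Y'"
    then show "(fm G f \<otimes>\<^sub>m fm G g) \<cdot> fmul G X Y = fmul G X' Y' \<cdot> fm G (f \<otimes>\<^sub>m g)"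
      by (rule m_natural [symmetric])
  next
    fix X Y Z assume [simp]: "X \<in> Ob C" "Y \<in> Ob C" "Z \<in> Ob C"
    let ?a = "assc C (fo G X) (fo G Y) (fo G Z)"
    have "(fmul G X Y \<otimes>\<^sub>m Idn C (fo G Z)) \<cdot> fmul G (X \<otimes>\<^sub>o Y) Z \<cdot> fm G (iassc C X Y Z) =
        iassc C (fo G X) (fo G Y) (fo G Z) \<cdot> (Idn C (fo G X) \<otimes>\<^sub>m fmul G Y Z) \<cdot> fmul G X (Y \<otimes>\<^sub>o Z)"
      using m_assc [of X Y Z] by simp
    then have "?a \<cdot> ((fmul G X Y \<otimes>\<^sub>m Idn C (fo G Z)) \<cdot> fmul G (X \<otimes>\<^sub>o Y) Z \<cdot> fm G (iassc C X Y Z))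
         \<cdot> fm G (assc C X Y Z) =
       ?a \<cdot> (iassc C (fo G X) (fo G Y) (fo G Z) \<cdot> (Idn C (fo G X) \<otimes>\<^sub>m fmul G Y Z) \<cdot> fmul G X (Y \<otimes>\<^sub>o Z))
         \<cdot> fm G (assc C X Y Z)"
      by simp
    then show "?a \<cdot> (fmul G X Y \<otimes>\<^sub>m Idn C (fo G Z)) \<cdot> fmul G (X \<otimes>\<^sub>o Y) Z =
       (Idn C (fo G X) \<otimes>\<^sub>m fmul G Y Z) \<cdot> fmul G X (Y \<otimes>\<^sub>o Z) \<cdot> fm G (assc C X Y Z)"
      by (simp add: G_inv)
  next
    fix X assume [simp]: "X \<in> Ob C"
    have "(fun0 G \<otimes>\<^sub>m Idn C (fo G X)) \<cdot> fmul G (unit C) X \<cdot> fm G (inv_mor C (lun C X)) =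
        inv_mor C (lun C (fo G X))"
      using m_unit [of X] by simp
    then have "lun C (fo G X) \<cdot> ((fun0 G \<otimes>\<^sub>m Idn C (fo G X)) \<cdot> fmul G (unit C) X
        \<cdot> fm G (inv_mor C (lun C X))) \<cdot> fm G (lun C X) =
      lun C (fo G X) \<cdot> inv_mor C (lun C (fo G X)) \<cdot> fm G (lun C X)"
      by simp
    then show "lun C (fo G X) \<cdot> (fun0 G \<otimes>\<^sub>m Idn C (fo G X)) \<cdot> fmul G (unit C) X = fm G (lun C X)"
      by (simp add: G_inv)
    have "(Idn C (fo G X) \<otimes>\<^sub>m fun0 G) \<cdot> fmul G X (unit C) \<cdot> fm G (inv_mor C (run C X)) =
        inv_mor C (run C (fo G X))"
      using m_unit [of X] by simp
    then have "run C (fo G X) \<cdot> ((Idn C (fo G X) \<otimes>\<^sub>m fun0 G) \<cdot> fmul G X (unit C)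
        \<cdot> fm G (inv_mor C (run C X))) \<cdot> fm G (run C X) =
      run C (fo G X) \<cdot> inv_mor C (run C (fo G X)) \<cdot> fm G (run C X)"
      by simp
    then show "run C (fo G X) \<cdot> (Idn C (fo G X) \<otimes>\<^sub>m fun0 G) \<cdot> fmul G X (unit C) = fm G (run C X)"
      by (simp add: G_inv)
  qed (simp_all add: Hom_def)
qed

lemma colax_monoidal_iso_oppI:
  assumes "lax_monoidal_iso (opp C) (opp C) G H \<tau>" "monoidal_category C"
  shows "colax_monoidal_iso C C H G \<tau>"
  using assms colax_monoidal_oppI [of C G] colax_monoidal_oppI [of C H]
  by (simp add: lax_monoidal_iso_def colax_monoidal_iso_def lax_transf_def colax_transf_def
      nat_iso_def nat_transf_def)

lemma comonoid_object_oppI: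
  fixes C :: "('x, 'm) moncat" (structure)
  assumes A: "monoid_object (opp C) A \<delta> \<epsilon>" and C: "monoidal_category C"
  shows "comonoid_object C A \<delta> \<epsilon>"
proof -
  interpret moncat_calculus C by unfold_locales (rule C)
  have [simp]: "A \<in> Ob C" "\<delta> \<in> Mor C" "Dom C \<delta> = A" "Cod C \<delta> = A \<otimes>\<^sub>o A"
    "\<epsilon> \<in> Mor C" "Dom C \<epsilon> = A" "Cod C \<epsilon> = unit C"
    using A by (auto simp: monoid_object_def Hom_def)
  have "(\<delta> \<otimes>\<^sub>m Idn C A) \<cdot> \<delta> = iassc C A A A \<cdot> (Idn C A \<otimes>\<^sub>m \<delta>) \<cdot> \<delta>"
    "(\<epsilon> \<otimes>\<^sub>m Idn C A) \<cdot> \<delta> = inv_mor C (lun C A)" "(Idn C A \<otimes>\<^sub>m \<epsilon>) \<cdot> \<delta> = inv_mor C (run C A)"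
    using A by (simp_all add: monoid_object_def)
  then show ?thesis
    by (simp add: comonoid_object_def Hom_def)
qed

lemma hb_tensor_opp:
  fixes C :: "('x, 'm) moncat" (structure)
  assumes C: "monoidal_category C" and \<sigma>: "half_braiding C X \<sigma>" and \<tau>: "half_braiding C Y \<tau>"
    and Z: "Z \<in> Ob C"
  shows "hb_tensor (opp C) X (\<lambda>Z. inv_mor C (\<sigma> Z)) Y (\<lambda>Z. inv_mor C (\<tau> Z)) Z =
    inv_mor C (hb_tensor C X \<sigma> Y \<tau> Z)"
proof -
  interpret moncat_calculus C by unfold_locales (rule C)
  note [simp] = half_braiding_typing [OF \<sigma>] half_braiding_typing [OF \<tau>] Z
  show ?thesis
    by (simp add: hb_tensor_def inv_mor_Cmp inv_mor_tmor)
qed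

text \<open>Duality yields the condition on a morphism of the center in terms of the inverse half-braidings;
  composing with the half-braidings on both sides gives it the usual form.\<close>

lemma hb_mor_inverse:
  fixes C :: "('x, 'm) moncat" (structure)
  assumes C: "monoidal_category C" and f: "f \<in> Hom C Y X"
    and iso: "\<And>Z. Z \<in> Ob C \<Longrightarrow> is_iso C (\<sigma> Z) \<and> Dom C (\<sigma> Z) = X \<otimes>\<^sub>o Z \<and> Cod C (\<sigma> Z) = Z \<otimes>\<^sub>o X"
      "\<And>Z. Z \<in> Ob C \<Longrightarrow> is_iso C (\<tau> Z) \<and> Dom C (\<tau> Z) = Y \<otimes>\<^sub>o Z \<and> Cod C (\<tau> Z) = Z \<otimes>\<^sub>o Y"
    and comm: "\<And>Z. Z \<in> Ob C \<Longrightarrow> (f \<otimes>\<^sub>m Idn C Z) \<cdot> inv_mor C (\<tau> Z) = inv_mor C (\<sigma> Z) \<cdot> (Idn C Z \<otimes>\<^sub>m f)"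
  shows "hb_mor C Y \<tau> f X \<sigma>"
  unfolding hb_mor_def
proof (intro conjI ballI f)
  interpret moncat_calculus C by unfold_locales (rule C)
  fix Z assume Z: "Z \<in> Ob C"
  have [simp]: "f \<in> Mor C" "Dom C f = Y" "Cod C f = X"
    using f by (auto simp: Hom_def)
  have XY: "X \<in> Ob C" "Y \<in> Ob C"
    using Dom_in_Ob [of f] Cod_in_Ob [of f] by simp_all
  note [simp] = iso(1) [OF Z] iso(2) [OF Z] Z XY is_iso_in_Mor [OF conjunct1 [OF iso(1) [OF Z]]]
    is_iso_in_Mor [OF conjunct1 [OF iso(2) [OF Z]]]
  have "\<sigma> Z \<cdot> ((f \<otimes>\<^sub>m Idn C Z) \<cdot> inv_mor C (\<tau> Z)) \<cdot> \<tau> Z =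
      \<sigma> Z \<cdot> (inv_mor C (\<sigma> Z) \<cdot> (Idn C Z \<otimes>\<^sub>m f)) \<cdot> \<tau> Z"
    by (simp only: comm [OF Z])
  then show "\<sigma> Z \<cdot> (f \<otimes>\<^sub>m Idn C Z) = (Idn C Z \<otimes>\<^sub>m f) \<cdot> \<tau> Z"
    by simp
qed

text \<open>The projection maps of a left adjoint. They are the maps of the right adjoint in the opposite
  categories.\<close>

definition left_proj1 ::
  "('x, 'm) moncat \<Rightarrow> ('y, 'n) moncat \<Rightarrow> ('x, 'm, 'y, 'n) mfunct \<Rightarrow> ('y, 'n, 'x, 'm) funct \<Rightarrow>
   ('y \<Rightarrow> 'n) \<Rightarrow> ('x \<Rightarrow> 'm) \<Rightarrow> 'x \<Rightarrow> 'y \<Rightarrow> 'm" where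
  "left_proj1 C D I P \<eta> \<epsilon> X Y = \<epsilon> (X \<otimes>\<^sub>o\<^bsub>C\<^esub> fo P Y)
     \<cdot>\<^bsub>C\<^esub> fm P (inv_mor D (fmul I X (fo P Y))) \<cdot>\<^bsub>C\<^esub> fm P (Idn D (fo I X) \<otimes>\<^sub>m\<^bsub>D\<^esub> \<eta> Y)"

definition left_proj2 ::
  "('x, 'm) moncat \<Rightarrow> ('y, 'n) moncat \<Rightarrow> ('x, 'm, 'y, 'n) mfunct \<Rightarrow> ('y, 'n, 'x, 'm) funct \<Rightarrow>
   ('y \<Rightarrow> 'n) \<Rightarrow> ('x \<Rightarrow> 'm) \<Rightarrow> 'y \<Rightarrow> 'x \<Rightarrow> 'm" where
  "left_proj2 C D I P \<eta> \<epsilon> Y X = \<epsilon> (fo P Y \<otimes>\<^sub>o\<^bsub>C\<^esub> X)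
     \<cdot>\<^bsub>C\<^esub> fm P (inv_mor D (fmul I (fo P Y) X)) \<cdot>\<^bsub>C\<^esub> fm P (\<eta> Y \<otimes>\<^sub>m\<^bsub>D\<^esub> Idn D (fo I X))"

text \<open>A functor \<open>P\<close> that is left and right adjoint to a strong monoidal functor \<open>I\<close>, such that the
  projection maps of the two adjunctions are mutually inverse at the unit object. These hypotheses
  are invariant under passage to opposite categories.\<close>

locale ambidextrous = strong_functor C D I
  for C :: "('x, 'm) moncat" (structure) and D :: "('y, 'n) moncat" and I +
  fixes P :: "('y, 'n, 'x, 'm) funct"
    and \<eta>l :: "'y \<Rightarrow> 'n" and \<epsilon>l :: "'x \<Rightarrow> 'm" and \<eta>r :: "'x \<Rightarrow> 'm" and \<epsilon>r :: "'y \<Rightarrow> 'n"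
    and \<sigma> :: "'x \<Rightarrow> 'm"
  assumes left_adj: "adjunction D C P I \<eta>l \<epsilon>l"
    and right_adj: "adjunction C D I P \<eta>r \<epsilon>r"
    and special: "Y \<in> Ob D \<Longrightarrow> \<epsilon>r Y \<cdot>\<^bsub>D\<^esub> \<eta>l Y = Idn D Y"
    and proj1_inverse: "X \<in> Ob C \<Longrightarrow> inverse_mors C (proj1 C D I P \<eta>r \<epsilon>r X (unit D))
       (left_proj1 C D I P \<eta>l \<epsilon>l X (unit D))"
    and proj2_inverse: "X \<in> Ob C \<Longrightarrow> inverse_mors C (proj2 C D I P \<eta>r \<epsilon>r (unit D) X)
       (left_proj2 C D I P \<eta>l \<epsilon>l (unit D) X)"
    and \<sigma>_eq: "X \<in> Ob C \<Longrightarrow> \<sigma> X = left_proj1 C D I P \<eta>l \<epsilon>l X (unit D)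
       \<cdot> fm P (inv_mor D (run D (fo I X)) \<cdot>\<^bsub>D\<^esub> lun D (fo I X)) \<cdot> proj2 C D I P \<eta>r \<epsilon>r (unit D) X"
begin

lemma right_projection: "right_projection C D I P \<eta>r \<epsilon>r \<sigma>"
proof -
  interpret strong_adjunction C D I P \<eta>r \<epsilon>r
    by unfold_locales (rule right_adj)
  show ?thesis
  proof unfold_locales
    fix X assume X [simp]: "X \<in> Ob C"
    let ?s = "inv_mor D (run D (fo I X)) \<ast> lun D (fo I X)"
    let ?p1 = "proj1 C D I P \<eta>r \<epsilon>r X (unit D)" and ?l1 = "left_proj1 C D I P \<eta>l \<epsilon>l X (unit D)"
    let ?p2 = "proj2 C D I P \<eta>r \<epsilon>r (unit D) X"
    have p1: "is_iso C ?p1" "inv_mor C ?p1 = ?l1"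
      using proj1_inverse [OF X] C.is_isoI C.inv_mor_eqI by auto
    have p2: "is_iso C ?p2"
      using proj2_inverse [OF X] C.is_isoI by auto
    have [simp]: "?p1 \<in> Mor C" "Dom C ?p1 = X \<otimes>\<^sub>o A" "Cod C ?p1 = fo P (fo I X \<otimes>\<^sub>o\<^bsub>D\<^esub> unit D)"
       "?p2 \<in> Mor C" "Dom C ?p2 = A \<otimes>\<^sub>o X" "Cod C ?p2 = fo P (unit D \<otimes>\<^sub>o\<^bsub>D\<^esub> fo I X)"
      by (simp_all add: proj1_def proj2_def)
    have \<sigma>: "\<sigma> X = inv_mor C ?p1 \<cdot> fm P ?s \<cdot> ?p2"
      by (simp add: \<sigma>_eq p1)
    show "is_iso C (proj2_unit C D I P \<eta>r \<epsilon>r X)"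
      using p2 P_is_iso [of "lun D (fo I X)"] by (simp add: proj2_unit_def)
    show "is_iso C (\<sigma> X)" "\<sigma> X \<in> Hom C (A \<otimes>\<^sub>o X) (X \<otimes>\<^sub>o A)"
      using p1(1) p2 P_is_iso [of ?s] by (simp_all add: \<sigma> Hom_def)
    show "proj1_unit C D I P \<eta>r \<epsilon>r X \<cdot> \<sigma> X = proj2_unit C D I P \<eta>r \<epsilon>r X"
      using p1(1) p2 P_is_iso [of "run D (fo I X)"]
      by (simp add: \<sigma> proj1_unit_def proj2_unit_def P_Cmp
          C.reassoc [OF P_Cmp [of "inv_mor D (run D (fo I X))" "run D (fo I X)", symmetric]])
  qed
qed

sublocale right: right_projection C D I P \<eta>r \<epsilon>r \<sigma>
  by (rule right_projection)

lemma left_typing [simp]: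
  "X \<in> Ob C \<Longrightarrow> \<epsilon>l X \<in> Mor C" "X \<in> Ob C \<Longrightarrow> Cod C (\<epsilon>l X) = X" "X \<in> Ob C \<Longrightarrow> Dom C (\<epsilon>l X) = fo P (fo I X)"
  "Y \<in> Ob D \<Longrightarrow> \<eta>l Y \<in> Mor D" "Y \<in> Ob D \<Longrightarrow> Cod D (\<eta>l Y) = fo I (fo P Y)" "Y \<in> Ob D \<Longrightarrow> Dom D (\<eta>l Y) = Y"
  using left_adj by (auto simp: adjunction_def nat_transf_def Hom_def comp_funct_def id_funct_def)

lemma \<sigma>_typing [simp]:
  assumes "X \<in> Ob C"
  shows "is_iso C (\<sigma> X)" "\<sigma> X \<in> Mor C" "Dom C (\<sigma> X) = right.A \<otimes>\<^sub>o X" "Cod C (\<sigma> X) = X \<otimes>\<^sub>o right.A"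
  using right.\<sigma>_iso [OF assms] right.\<sigma>_Hom [OF assms] by (auto simp: Hom_def)

lemma proj_opp:
  assumes "X \<in> Ob C" "Y \<in> Ob D"
  shows "proj1 (opp C) (opp D) I_op P \<epsilon>l \<eta>l X Y = left_proj1 C D I P \<eta>l \<epsilon>l X Y"
    and "proj2 (opp C) (opp D) I_op P \<epsilon>l \<eta>l Y X = left_proj2 C D I P \<eta>l \<epsilon>l Y X"
    and "left_proj1 (opp C) (opp D) I_op P \<epsilon>r \<eta>r X Y = proj1 C D I P \<eta>r \<epsilon>r X Y"
    and "left_proj2 (opp C) (opp D) I_op P \<epsilon>r \<eta>r Y X = proj2 C D I P \<eta>r \<epsilon>r Y X"
  using assms
  by (simp_all add: proj1_def proj2_def left_proj1_def left_proj2_def strong_as_lax_def)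

text \<open>The inverse of \<open>\<sigma>\<close>, being the composite of the inverse projection maps in reverse order, has the form
  required of \<open>\<sigma>\<close> in the opposite categories.\<close>

lemma ambidextrous_opp:
  "ambidextrous (opp C) (opp D) I_op P \<epsilon>r \<eta>r \<epsilon>l \<eta>l (\<lambda>X. inv_mor C (\<sigma> X))"
proof unfold_locales
  show "monoidal_category (opp C)" "monoidal_category (opp D)"
    by (simp_all add: monoidal_category_opp C.moncat D.moncat)
  show "strong_monoidal (opp C) (opp D) I_op"
    by (rule strong_monoidal_opp)
  show "adjunction (opp C) (opp D) I_op P \<epsilon>l \<eta>l"
    by (rule adjunction_opp [OF left_adj]) unfold_locales
  show "adjunction (opp D) (opp C) P I_op \<epsilon>r \<eta>r"
    using right_adj functor_opp category_opp [OF C.cat] category_opp [OF D.cat]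
    unfolding adjunction_def is_functor_def nat_transf_def
    by (simp add: strong_as_lax_def comp_funct_def id_funct_def)
next
  fix X assume "X \<in> Ob (opp C)"
  then have X [simp]: "X \<in> Ob C" by simp
  let ?s = "inv_mor D (run D (fo I X)) \<ast> lun D (fo I X)"
  let ?p1 = "proj1 C D I P \<eta>r \<epsilon>r X (unit D)" and ?l1 = "left_proj1 C D I P \<eta>l \<epsilon>l X (unit D)"
  let ?p2 = "proj2 C D I P \<eta>r \<epsilon>r (unit D) X" and ?l2 = "left_proj2 C D I P \<eta>l \<epsilon>l (unit D) X"
  have p1: "inverse_mors C ?l1 ?p1" and p2: "inverse_mors C ?p2 ?l2"
    using proj1_inverse [OF X] proj2_inverse [OF X] C.inverse_mors_sym by auto
  have s: "inverse_mors C (fm P ?s) (fm P (inv_mor D ?s))"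
    using right.P_is_iso [of ?s] by (simp add: inverse_mors_def Hom_def flip: right.P_Cmp)
  have "inverse_mors C (?l1 \<cdot> fm P ?s \<cdot> ?p2) ((?l2 \<cdot> fm P (inv_mor D ?s)) \<cdot> ?p1)"
    by (rule C.inverse_mors_Cmp [OF C.inverse_mors_Cmp [OF p2 s] p1])
      (simp_all add: left_proj1_def proj2_def)
  then have "inv_mor C (\<sigma> X) = (?l2 \<cdot> fm P (inv_mor D ?s)) \<cdot> ?p1"
    by (simp add: \<sigma>_eq C.inv_mor_eqI)
  then show "inv_mor C (\<sigma> X) = Cmp (opp C)
       (left_proj1 (opp C) (opp D) I_op P \<epsilon>r \<eta>r X (unit (opp D)))
       (Cmp (opp C) (fm P (Cmp (opp D) (inv_mor (opp D) (run (opp D) (fo I_op X)))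
           (lun (opp D) (fo I_op X))))
         (proj2 (opp C) (opp D) I_op P \<epsilon>l \<eta>l (unit (opp D)) X))"
    by (simp add: proj_opp D.inv_mor_Cmp) (simp add: strong_as_lax_def)
  show "inverse_mors (opp C) (proj1 (opp C) (opp D) I_op P \<epsilon>l \<eta>l X (unit (opp D)))
         (left_proj1 (opp C) (opp D) I_op P \<epsilon>r \<eta>r X (unit (opp D)))"
    "inverse_mors (opp C) (proj2 (opp C) (opp D) I_op P \<epsilon>l \<eta>l (unit (opp D)) X)
         (left_proj2 (opp C) (opp D) I_op P \<epsilon>r \<eta>r (unit (opp D)) X)"
    using p1 p2 C.inverse_mors_sym by (simp_all add: proj_opp)
qed (simp add: special)

end

section \<open>The Frobenius structure and the projection isomorphisms\<close>

lemma strong_as_lax_sel: "fo (strong_as_lax D I) = fo I" "fm (strong_as_lax D I) = fm I"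
  by (simp_all add: strong_as_lax_def)

context ambidextrous
begin

abbreviation "A \<equiv> right.A"
abbreviation "\<mu> \<equiv> right.mult_A"
abbreviation "\<iota> \<equiv> right.unit_A"
abbreviation "ladj_colax \<equiv> left_adjoint_colax C D I P \<eta>l \<epsilon>l"
abbreviation "\<delta> \<equiv> fmul ladj_colax (unit D) (unit D) \<cdot> fm P (inv_mor D (lun D (unit D)))"
abbreviation "\<epsilon> \<equiv> fun0 ladj_colax"

interpretation op: ambidextrous "opp C" "opp D" I_op P \<epsilon>r \<eta>r \<epsilon>l \<eta>l "\<lambda>X. inv_mor C (\<sigma> X)"
  by (rule ambidextrous_opp)

lemma adjoint_structure_opp:
  "X \<in> Ob D \<Longrightarrow> Y \<in> Ob D \<Longrightarrow>
     fmul (right_adjoint_lax (opp C) (opp D) I_op P \<epsilon>l \<eta>l) X Y = fmul ladj_colax X Y"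
  "fun0 (right_adjoint_lax (opp C) (opp D) I_op P \<epsilon>l \<eta>l) = \<epsilon>"
  "X \<in> Ob D \<Longrightarrow> Y \<in> Ob D \<Longrightarrow>
     fmul (left_adjoint_colax (opp C) (opp D) I_op P \<epsilon>r \<eta>r) X Y = fmul right.radj_lax X Y"
  "fun0 (left_adjoint_colax (opp C) (opp D) I_op P \<epsilon>r \<eta>r) = \<iota>"
  by (simp_all add: right_adjoint_lax_def left_adjoint_colax_def strong_as_lax_def)

lemma ladj_colax_typing [simp]:
  "X \<in> Ob D \<Longrightarrow> Y \<in> Ob D \<Longrightarrow> fmul ladj_colax X Y \<in> Mor C"
  "X \<in> Ob D \<Longrightarrow> Y \<in> Ob D \<Longrightarrow> Cod C (fmul ladj_colax X Y) = fo P X \<otimes>\<^sub>o fo P Y"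
  "X \<in> Ob D \<Longrightarrow> Y \<in> Ob D \<Longrightarrow> Dom C (fmul ladj_colax X Y) = fo P (X \<otimes>\<^sub>o\<^bsub>D\<^esub> Y)"
  "\<epsilon> \<in> Mor C" "Dom C \<epsilon> = A" "Cod C \<epsilon> = unit C"
  by (simp_all add: left_adjoint_colax_def)

lemma comonoid: "comonoid_object C A \<delta> \<epsilon>"
  using op.right.monoid by (intro comonoid_object_oppI C.moncat) (simp add: adjoint_structure_opp)

lemma hb_mor_\<delta>: "hb_mor C A \<sigma> \<delta> (A \<otimes>\<^sub>o A) (hb_tensor C A \<sigma> A \<sigma>)"
proof (rule hb_mor_inverse [OF C.moncat])
  fix Z assume Z: "Z \<in> Ob C"
  show "(\<delta> \<otimes>\<^sub>m Idn C Z) \<cdot> inv_mor C (\<sigma> Z) = inv_mor C (hb_tensor C A \<sigma> A \<sigma> Z) \<cdot> (Idn C Z \<otimes>\<^sub>m \<delta>)"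
    using op.right.hb_mor_\<mu> Z
    by (simp add: hb_mor_def adjoint_structure_opp
        hb_tensor_opp [OF C.moncat right.\<sigma>_half_braiding right.\<sigma>_half_braiding])
qed (simp_all add: C.hb_tensor_typing [OF right.\<sigma>_half_braiding right.\<sigma>_half_braiding] Hom_def)

lemma hb_mor_\<epsilon>: "hb_mor C A \<sigma> \<epsilon> (unit C) (hb_unit C)"
proof (rule hb_mor_inverse [OF C.moncat])
  fix Z assume Z: "Z \<in> Ob C"
  show "(\<epsilon> \<otimes>\<^sub>m Idn C Z) \<cdot> inv_mor C (\<sigma> Z) = inv_mor C (hb_unit C Z) \<cdot> (Idn C Z \<otimes>\<^sub>m \<epsilon>)"
    using op.right.hb_mor_\<iota> Z
    by (simp add: hb_mor_def adjoint_structure_opp hb_unit_def C.inv_mor_Cmp)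
qed (simp_all add: Hom_def hb_unit_def)

text \<open>The isomorphism \<open>proj A : A \<otimes> A \<rightarrow> P (I A)\<close> expresses both \<open>\<mu>\<close> and \<open>\<delta>\<close> by values of \<open>P\<close>.\<close>

abbreviation "proj \<equiv> right.pr2"

lemma proj_iso [simp]: "X \<in> Ob C \<Longrightarrow> is_iso C (proj X)"
  by (rule right.proj2_iso)

lemma proj_unit_opp: "X \<in> Ob C \<Longrightarrow> proj2_unit (opp C) (opp D) I_op P \<epsilon>l \<eta>l X = inv_mor C (proj X)"
proof -
  assume X [simp]: "X \<in> Ob C"
  have [simp]: "is_iso C (proj2 C D I P \<eta>r \<epsilon>r (unit D) X)"
    "inv_mor C (proj2 C D I P \<eta>r \<epsilon>r (unit D) X) = left_proj2 C D I P \<eta>l \<epsilon>l (unit D) X"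
    using proj2_inverse [OF X] C.is_isoI C.inv_mor_eqI by auto
  have [simp]: "inv_mor C (fm P (lun D (fo I X))) = fm P (inv_mor D (lun D (fo I X)))"
    by (rule C.inv_mor_eqI) (simp add: inverse_mors_def Hom_def flip: right.P_Cmp)
  have [simp]: "Cod C (proj2 C D I P \<eta>r \<epsilon>r (unit D) X) = fo P (unit D \<otimes>\<^sub>o\<^bsub>D\<^esub> fo I X)"
    by (simp add: proj2_def)
  show ?thesis
    by (simp add: proj2_unit_def [of "opp C"] proj_opp)
      (simp add: proj2_unit_def strong_as_lax_def C.inv_mor_Cmp right.P_is_iso)
qed

lemma \<delta>_eq: "\<delta> = inv_mor C (proj A) \<cdot> fm P (\<eta>l (unit D))"
  using op.right.mult_A_eq by (simp add: adjoint_structure_opp proj_unit_opp)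

text \<open>The isomorphism \<open>proj A\<close> cancels, and \<open>P\<close> is applied to \<open>\<epsilon>r \<cdot> \<eta>l = 1\<close>.\<close>

theorem mult_comult: "\<mu> \<cdot> \<delta> = Idn C A"
proof -
  have "\<mu> \<cdot> \<delta> = fm P (\<epsilon>r (unit D)) \<cdot> fm P (\<eta>l (unit D))"
    unfolding \<delta>_eq right.mult_A_eq by simp
  also have "\<dots> = fm P (\<epsilon>r (unit D) \<ast> \<eta>l (unit D))"
    by (simp add: right.P_Cmp)
  finally show ?thesis
    by (simp add: special)
qed

text \<open>In the full image let \<open>n : 1 \<rightarrow> A\<close> be the unit of the left adjunction. The next lemma says that
  \<open>(e \<otimes> A) \<delta> = n e\<close>, and \<open>\<mu>_\<eta>l\<close> below is the dual equation \<open>\<mu> (n \<otimes> A) = n e\<close>, up to unit isomorphisms.\<close>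

lemma proj_\<delta>: "\<epsilon>r (fo I A) \<ast> fm I (proj A) \<ast> fm I \<delta> = \<eta>l (unit D) \<ast> \<epsilon>r (unit D)"
proof -
  have "\<epsilon>r (fo I A) \<ast> fm I (proj A) \<ast> fm I \<delta> = \<epsilon>r (fo I A) \<ast> fm I (fm P (\<eta>l (unit D)))"
    unfolding \<delta>_eq by (simp add: I_inv_mor)
  also have "\<dots> = \<eta>l (unit D) \<ast> \<epsilon>r (unit D)"
    using right.\<epsilon>_natural [of "\<eta>l (unit D)"] by simp
  finally show ?thesis .
qed

lemma \<eta>l_natural: "g \<in> Mor D \<Longrightarrow> fm I (fm P g) \<ast> \<eta>l (Dom D g) = \<eta>l (Cod D g) \<ast> g"
  using left_adj by (simp_all add: adjunction_def nat_transf_def Hom_def comp_funct_def id_funct_def)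

lemma \<eta>l_proj:
  assumes "X \<in> Ob C"
  shows "fm I (inv_mor C (proj X)) \<ast> \<eta>l (fo I X) =
    inv_mor D (fmul I A X) \<ast> (\<eta>l (unit D) \<boxtimes> Idn D (fo I X)) \<ast> inv_mor D (lun D (fo I X))"
  using op.right.\<epsilon>_proj2 [of X] assms by (simp add: proj_unit_opp) (simp add: strong_as_lax_def)

lemma \<mu>_\<eta>l:
  "fm I \<mu> \<ast> inv_mor D (fmul I A A) \<ast> (\<eta>l (unit D) \<boxtimes> Idn D (fo I A)) =
     \<eta>l (unit D) \<ast> \<epsilon>r (unit D) \<ast> lun D (fo I A)"
proof -
  have "inv_mor D (fmul I A A) \<ast> (\<eta>l (unit D) \<boxtimes> Idn D (fo I A)) =
      (fm I (inv_mor C (proj A)) \<ast> \<eta>l (fo I A)) \<ast> lun D (fo I A)"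
    by (simp only: \<eta>l_proj [OF right.A_Ob]) simp
  then have "fm I \<mu> \<ast> inv_mor D (fmul I A A) \<ast> (\<eta>l (unit D) \<boxtimes> Idn D (fo I A)) =
      fm I (fm P (\<epsilon>r (unit D))) \<ast> \<eta>l (fo I A) \<ast> lun D (fo I A)"
    unfolding right.mult_A_eq by (simp add: I_inv_mor)
  also have "\<dots> = (\<eta>l (unit D) \<ast> \<epsilon>r (unit D)) \<ast> lun D (fo I A)"
    by (rule D.reassoc) (use \<eta>l_natural [of "\<epsilon>r (unit D)"] in simp_all)
  finally show ?thesis by simp
qed

text \<open>Let \<open>k = n e : A \<rightarrow> A\<close> in the full image. After composition with the counit \<open>A \<otimes> A \<rightarrow> A\<close>, the right-hand side
  becomes \<open>k \<mu>\<close> by \<open>proj_\<delta>\<close>, and the left-hand side becomes \<open>\<mu> (k \<otimes> A)\<close>, which equals \<open>k \<mu>\<close> by \<open>\<mu>_\<eta>l\<close>.\<close>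

theorem frobenius_left: "(Idn C A \<otimes>\<^sub>m \<mu>) \<cdot> assc C A A A \<cdot> (\<delta> \<otimes>\<^sub>m Idn C A) = \<delta> \<cdot> \<mu>"
proof -
  let ?E = "full_image C D I" and ?F = "full_embed C I"
  let ?k = "(A, \<eta>l (unit D) \<ast> \<epsilon>r (unit D), A)"
  have k [simp]: "?k \<in> Mor ?E" "Dom ?E ?k = A" "Cod ?E ?k = A"
    by (simp_all add: Hom_def)
  have k_\<delta>: "right.cl A \<cdot>\<^bsub>?E\<^esub> ?F \<delta> = ?k"
    using proj_\<delta> by (simp add: right.absorb_eq full_embed_def del: right.F_Cmp)
  have "fm I \<mu> \<ast> inv_mor D (fmul I A A) \<ast> ((\<eta>l (unit D) \<ast> \<epsilon>r (unit D)) \<boxtimes> Idn D (fo I A)) \<ast> fmul I A A =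
      (fm I \<mu> \<ast> inv_mor D (fmul I A A) \<ast> (\<eta>l (unit D) \<boxtimes> Idn D (fo I A)))
        \<ast> (\<epsilon>r (unit D) \<boxtimes> Idn D (fo I A)) \<ast> fmul I A A"
    by simp
  also have "\<dots> = \<eta>l (unit D) \<ast> (\<epsilon>r (unit D) \<ast> lun D (fo I A)
        \<ast> (\<epsilon>r (unit D) \<boxtimes> Idn D (fo I A)) \<ast> fmul I A A)"
    unfolding \<mu>_\<eta>l by simp
  also have "\<dots> = \<eta>l (unit D) \<ast> \<epsilon>r (unit D) \<ast> fm I \<mu>"
    unfolding right.\<epsilon>_mult_A ..
  finally have k_\<mu>: "?F \<mu> \<cdot>\<^bsub>?E\<^esub> (?k \<otimes>\<^sub>m\<^bsub>?E\<^esub> Idn ?E A) = ?k \<cdot>\<^bsub>?E\<^esub> ?F \<mu>"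
    by (simp add: full_embed_def)
  have "right.cl A \<cdot>\<^bsub>?E\<^esub> ?F ((Idn C A \<otimes>\<^sub>m \<mu>) \<cdot> assc C A A A \<cdot> (\<delta> \<otimes>\<^sub>m Idn C A)) =
     right.cl A \<cdot>\<^bsub>?E\<^esub> (Idn ?E A \<otimes>\<^sub>m\<^bsub>?E\<^esub> ?F \<mu>) \<cdot>\<^bsub>?E\<^esub> assc ?E A A A \<cdot>\<^bsub>?E\<^esub> (?F \<delta> \<otimes>\<^sub>m\<^bsub>?E\<^esub> Idn ?E A)"
    by (simp del: full_image_mor)
  also have "\<dots> = (?F \<mu> \<cdot>\<^bsub>?E\<^esub> right.cl (A \<otimes>\<^sub>o A)) \<cdot>\<^bsub>?E\<^esub> assc ?E A A A \<cdot>\<^bsub>?E\<^esub> (?F \<delta> \<otimes>\<^sub>m\<^bsub>?E\<^esub> Idn ?E A)"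
    by (rule right.E.reassoc [OF right.cl_natural]) (simp_all del: full_image_mor)
  also have "\<dots> = ?F \<mu> \<cdot>\<^bsub>?E\<^esub> (right.cl A \<otimes>\<^sub>m\<^bsub>?E\<^esub> Idn ?E A) \<cdot>\<^bsub>?E\<^esub> (?F \<delta> \<otimes>\<^sub>m\<^bsub>?E\<^esub> Idn ?E A)"
    by (simp add: right.absorb del: full_image_mor right.E.interchange)
  also have "\<dots> = ?F \<mu> \<cdot>\<^bsub>?E\<^esub> (?k \<otimes>\<^sub>m\<^bsub>?E\<^esub> Idn ?E A)"
    using k_\<delta> by (simp del: full_image_mor right.F_Cmp)
  also have "\<dots> = right.cl A \<cdot>\<^bsub>?E\<^esub> ?F (\<delta> \<cdot> \<mu>)"
    using right.E.reassoc [OF k_\<delta>, of "?F \<mu>"] k_\<mu> by (simp del: full_image_mor)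
  finally show ?thesis
    by (intro right.cl_unique [of _ _ A]) (simp_all del: full_image_mor)
qed

text \<open>This is the first Frobenius relation in the opposite category.\<close>

theorem frobenius_right: "(\<mu> \<otimes>\<^sub>m Idn C A) \<cdot> iassc C A A A \<cdot> (Idn C A \<otimes>\<^sub>m \<delta>) = \<delta> \<cdot> \<mu>"
  using ambidextrous.frobenius_left [OF ambidextrous_opp] by (simp add: adjoint_structure_opp)

text \<open>The three functors \<open>A \<otimes> -\<close>, \<open>- \<otimes> A\<close> and \<open>P I\<close> are cofree for the same full image, with counits
  that correspond to each other under the projection maps.\<close>

theorem lax_projections:
  "lax_monoidal_iso C C (ltensor_lax C A \<sigma> \<mu> \<iota>) right.monad_lax proj"
  "lax_monoidal_iso C C (rtensor_lax C A \<sigma> \<mu> \<iota>) right.monad_lax right.pr1"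
  using right.cofree_lax_monoidal_iso [OF right.cofree_lax_ltensor right.cofree_lax_monad, of proj]
    right.cofree_lax_monoidal_iso [OF right.cofree_lax_rtensor right.cofree_lax_monad,
      of "right.pr1"]
  by (simp_all add: right.\<nu>_proj right.proj1_iso Hom_def ltensor_lax_def rtensor_lax_def
      comp_lax_def strong_as_lax_def)

lemma proj1_unit_opp: "X \<in> Ob C \<Longrightarrow> proj1_unit (opp C) (opp D) I_op P \<epsilon>l \<eta>l X =
    inv_mor C (right.pr1 X)"
proof -
  assume X [simp]: "X \<in> Ob C"
  have [simp]: "is_iso C (proj1 C D I P \<eta>r \<epsilon>r X (unit D))"
    "inv_mor C (proj1 C D I P \<eta>r \<epsilon>r X (unit D)) = left_proj1 C D I P \<eta>l \<epsilon>l X (unit D)"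
    using proj1_inverse [OF X] C.is_isoI C.inv_mor_eqI by auto
  have [simp]: "inv_mor C (fm P (run D (fo I X))) = fm P (inv_mor D (run D (fo I X)))"
    by (rule C.inv_mor_eqI) (simp add: inverse_mors_def Hom_def flip: right.P_Cmp)
  have [simp]: "Cod C (proj1 C D I P \<eta>r \<epsilon>r X (unit D)) = fo P (fo I X \<otimes>\<^sub>o\<^bsub>D\<^esub> unit D)"
    by (simp add: proj1_def)
  show ?thesis
    by (simp add: proj1_unit_def [of "opp C"] proj_opp)
      (simp add: proj1_unit_def strong_as_lax_def C.inv_mor_Cmp right.P_is_iso)
qed

text \<open>The counits of the opposite situation are the units of the left adjunction; the isomorphisms
  point in the other direction, so source and target are exchanged.\<close>

theorem colax_projections:
  "colax_monoidal_iso C C (ltensor_colax C A \<sigma> \<delta> \<epsilon>) (comp_colax C ladj_colax I) proj"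
  "colax_monoidal_iso C C (rtensor_colax C A \<sigma> \<delta> \<epsilon>) (comp_colax C ladj_colax I)
     right.pr1"
proof -
  let ?PI = "comp_colax C ladj_colax I"
  have PI: "op.right.cofree_lax ?PI op.right.\<nu>"
    by (rule op.right.cofree_lax_cong [OF op.right.cofree_lax_monad])
      (simp_all add: comp_lax_def comp_colax_def adjoint_structure_opp,
       simp_all add: strong_as_lax_def right_adjoint_lax_def left_adjoint_colax_def)
  have l: "op.right.cofree_lax (ltensor_colax C A \<sigma> \<delta> \<epsilon>) op.right.cl"
    by (rule op.right.cofree_lax_cong [OF op.right.cofree_lax_ltensor])
      (simp_all add: ltensor_lax_def ltensor_colax_def adjoint_structure_opp)
  have r: "op.right.cofree_lax (rtensor_colax C A \<sigma> \<delta> \<epsilon>) op.right.cr"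
    by (rule op.right.cofree_lax_cong [OF op.right.cofree_lax_rtensor])
      (simp_all add: rtensor_lax_def rtensor_colax_def adjoint_structure_opp)
  have "lax_monoidal_iso (opp C) (opp C) ?PI (ltensor_colax C A \<sigma> \<delta> \<epsilon>) proj"
  proof (rule op.right.cofree_lax_monoidal_iso [OF PI l])
    fix X assume "X \<in> Ob (opp C)"
    then have [simp]: "X \<in> Ob C" by simp
    show "Cmp (full_image (opp C) (opp D) I_op) (op.right.cl X)
        (full_embed (opp C) I_op (proj X)) = op.right.\<nu> X"
      using op.right.counit_inverse [OF _ _ _ op.right.\<nu>_proj(1) [of X]]
      by (simp add: proj_unit_opp del: full_image_mor) (simp add: op.right.\<nu>_def Hom_def strong_as_lax_sel)
  qed (simp_all add: Hom_def ltensor_colax_def comp_colax_def left_adjoint_colax_def)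
  then show "colax_monoidal_iso C C (ltensor_colax C A \<sigma> \<delta> \<epsilon>) ?PI proj"
    by (rule colax_monoidal_iso_oppI) (rule C.moncat)
  have "lax_monoidal_iso (opp C) (opp C) ?PI (rtensor_colax C A \<sigma> \<delta> \<epsilon>) right.pr1"
  proof (rule op.right.cofree_lax_monoidal_iso [OF PI r])
    fix X assume "X \<in> Ob (opp C)"
    then have [simp]: "X \<in> Ob C" by simp
    show "Cmp (full_image (opp C) (opp D) I_op) (op.right.cr X)
        (full_embed (opp C) I_op (right.pr1 X)) = op.right.\<nu> X"
      using op.right.counit_inverse [OF _ _ _ op.right.\<nu>_proj(2) [of X]]
      by (simp add: proj1_unit_opp right.proj1_iso del: full_image_mor) (simp add: op.right.\<nu>_def Hom_def strong_as_lax_sel)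
  qed (simp_all add: Hom_def rtensor_colax_def comp_colax_def left_adjoint_colax_def right.proj1_iso)
  then show "colax_monoidal_iso C C (rtensor_colax C A \<sigma> \<delta> \<epsilon>) ?PI right.pr1"
    by (rule colax_monoidal_iso_oppI) (rule C.moncat)
qed

end

section \<open>Frobenius objects in the center\<close>

context moncat_calculus
begin

lemma hb_mor_inv_mor:
  assumes f: "hb_mor C X \<sigma> f Y \<tau>" "is_iso C f" and X: "half_braiding C X \<sigma>" and Y: "half_braiding C Y \<tau>"
  shows "hb_mor C Y \<tau> (inv_mor C f) X \<sigma>"
  unfolding hb_mor_def
proof (intro conjI ballI)
  have [simp]: "f \<in> Mor C" "Dom C f = X" "Cod C f = Y"
    using f(1) by (auto simp: hb_mor_def Hom_def)
  note [simp] = f(2) half_braiding_typing [OF X] half_braiding_typing [OF Y]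
  show "inv_mor C f \<in> Hom C Y X"
    by (simp add: Hom_def)
  fix Z assume Z [simp]: "Z \<in> Ob C"
  have "\<tau> Z \<cdot> (f \<otimes>\<^sub>m Idn C Z) = (Idn C Z \<otimes>\<^sub>m f) \<cdot> \<sigma> Z"
    using f(1) by (simp add: hb_mor_def)
  then have "(Idn C Z \<otimes>\<^sub>m inv_mor C f) \<cdot> (\<tau> Z \<cdot> (f \<otimes>\<^sub>m Idn C Z)) \<cdot> (inv_mor C f \<otimes>\<^sub>m Idn C Z) =
     (Idn C Z \<otimes>\<^sub>m inv_mor C f) \<cdot> ((Idn C Z \<otimes>\<^sub>m f) \<cdot> \<sigma> Z) \<cdot> (inv_mor C f \<otimes>\<^sub>m Idn C Z)"
    by simp
  then show "\<sigma> Z \<cdot> (inv_mor C f \<otimes>\<^sub>m Idn C Z) = (Idn C Z \<otimes>\<^sub>m inv_mor C f) \<cdot> \<tau> Z"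
    by simp
qed

abbreviation center_ob :: "'x \<Rightarrow> ('x \<Rightarrow> 'm) \<Rightarrow> ('x, 'm) cob" where
  "center_ob X \<sigma> \<equiv> (X, restrict \<sigma> (Ob C))"

lemma center_tob_center_ob:
  "center_tob C (center_ob X \<sigma>) (center_ob Y \<tau>) = center_ob (X \<otimes>\<^sub>o Y) (hb_tensor C X \<sigma> Y \<tau>)"
  by (auto simp: center_tob_def hb_tensor_def restrict_def fun_eq_iff)

lemma center_unit_center_ob: "center_unit C = center_ob (unit C) (hb_unit C)"
  by (auto simp: center_unit_def hb_unit_def restrict_def fun_eq_iff)

lemma center_mor:
  assumes "hb_mor C X \<sigma> f Y \<tau>" "half_braiding C X \<sigma>" "half_braiding C Y \<tau>"
  shows "(center_ob X \<sigma>, f, center_ob Y \<tau>) \<in> center_mors C"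
  using assms half_braiding_restrict [OF assms(2)] half_braiding_restrict [OF assms(3)]
  by (simp add: center_mors_def center_obs_def hb_mor_def)

text \<open>The inverse is found among triples, so its source and target are forced and its middle component
  inverts \<open>f\<close>.\<close>

lemma inv_mor_center:
  assumes f: "hb_mor C X \<sigma> f Y \<tau>" "is_iso C f" and X: "half_braiding C X \<sigma>" and Y: "half_braiding C Y \<tau>"
  shows "inv_mor (center C) (center_ob X \<sigma>, f, center_ob Y \<tau>) = (center_ob Y \<tau>, inv_mor C f, center_ob X \<sigma>)"
proof -
  have fXY: "f \<in> Hom C X Y"
    using f(1) by (simp add: hb_mor_def)
  then have [simp]: "f \<in> Mor C" "Dom C f = X" "Cod C f = Y"
    by (auto simp: Hom_def)
  have "inverse_mors (center C) (center_ob X \<sigma>, f, center_ob Y \<tau>) (center_ob Y \<tau>, inv_mor C f, center_ob X \<sigma>)"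
    using f(2) center_mor [OF f(1) X Y] center_mor [OF hb_mor_inv_mor [OF f X Y] Y X]
    by (simp add: inverse_mors_def center_def Hom_def)
  moreover have "g = (center_ob Y \<tau>, inv_mor C f, center_ob X \<sigma>)"
    if "inverse_mors (center C) (center_ob X \<sigma>, f, center_ob Y \<tau>) g" for g
  proof -
    obtain P g' Q where g: "g = (P, g', Q)" by (cases g)
    have PQ: "P = center_ob Y \<tau>" "Q = center_ob X \<sigma>" and m: "(P, g', Q) \<in> center_mors C"
      and e: "g' \<cdot> f = Idn C X" "f \<cdot> g' = Idn C Y"
      using that by (auto simp: g inverse_mors_def center_def Hom_def)
    have "g' \<in> Hom C Y X"
      using m by (auto simp: PQ center_mors_def)
    then have "inverse_mors C f g'"
      using e by (simp add: inverse_mors_def)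
    then show ?thesis
      using inv_mor_eqI by (simp add: g PQ)
  qed
  ultimately show ?thesis
    unfolding inv_mor_def [of "center C"] by (blast intro: the_equality)
qed

text \<open>Equations in the center are equations in \<open>C\<close> between morphisms with matching endpoints.
  Apart from the structure maps being center morphisms, only the inverse associator requires an
  argument, because it is defined by inverting in the center.\<close>

lemma special_commutative_frobenius_center:
  fixes A \<sigma>
  defines "AA \<equiv> A \<otimes>\<^sub>o A" and "\<theta> \<equiv> hb_tensor C A \<sigma> A \<sigma>"
  assumes hb: "half_braiding C A \<sigma>" "half_braiding C AA \<theta>"
      "half_braiding C (AA \<otimes>\<^sub>o A) (hb_tensor C AA \<theta> A \<sigma>)" "half_braiding C (A \<otimes>\<^sub>o AA) (hb_tensor C A \<sigma> AA \<theta>)"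
    and assc: "hb_mor C (AA \<otimes>\<^sub>o A) (hb_tensor C AA \<theta> A \<sigma>) (assc C A A A) (A \<otimes>\<^sub>o AA) (hb_tensor C A \<sigma> AA \<theta>)"
    and mors: "hb_mor C AA \<theta> \<mu> A \<sigma>" "hb_mor C (unit C) (hb_unit C) \<iota> A \<sigma>"
      "hb_mor C A \<sigma> \<delta> AA \<theta>" "hb_mor C A \<sigma> \<epsilon> (unit C) (hb_unit C)"
    and frob: "frobenius_object C A \<mu> \<iota> \<delta> \<epsilon>" and special: "\<mu> \<cdot> \<delta> = Idn C A" and comm: "\<mu> \<cdot> \<sigma> A = \<mu>"
  shows "special_commutative_frobenius (center C) (center_braiding C) (center_ob A \<sigma>)
       (center_tob C (center_ob A \<sigma>) (center_ob A \<sigma>), \<mu>, center_ob A \<sigma>) (center_unit C, \<iota>, center_ob A \<sigma>)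
       (center_ob A \<sigma>, \<delta>, center_tob C (center_ob A \<sigma>) (center_ob A \<sigma>)) (center_ob A \<sigma>, \<epsilon>, center_unit C)"
proof -
  have A [simp]: "A \<in> Ob C" using half_braiding_typing [OF hb(1)] by simp
  note m = center_mor [OF mors(1) hb(2,1)] center_mor [OF mors(2) hb_unit_half_braiding hb(1)]
    center_mor [OF mors(3) hb(1,2)] center_mor [OF mors(4) hb(1) hb_unit_half_braiding]
  have iassc: "inv_mor (center C) (assc (center C) (center_ob A \<sigma>) (center_ob A \<sigma>) (center_ob A \<sigma>)) =
      (center_ob (A \<otimes>\<^sub>o AA) (hb_tensor C A \<sigma> AA \<theta>), iassc C A A A, center_ob (AA \<otimes>\<^sub>o A) (hb_tensor C AA \<theta> A \<sigma>))"
    using inv_mor_center [OF assc _ hb(3,4)]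
    by (simp add: center_def center_tob_center_ob AA_def \<theta>_def)
  have ob: "center_ob A \<sigma> \<in> center_obs C"
    using half_braiding_restrict [OF hb(1)] by (simp add: center_obs_def)
  note f = frob [unfolded frobenius_object_def monoid_object_def comonoid_object_def]
  show ?thesis
    unfolding special_commutative_frobenius_def frobenius_object_def monoid_object_def
      comonoid_object_def iassc
    using f special comm m ob
    by (simp add: center_def center_tob_center_ob center_unit_center_ob center_braiding_def Hom_def
        AA_def \<theta>_def)
qed

end

section \<open>The braided case\<close>

lemma (in moncat_calculus) braiding_natural:
  assumes \<beta>: "braiding C \<beta>" and "f \<in> Mor C" "g \<in> Mor C"
  shows "(g \<otimes>\<^sub>m f) \<cdot> \<beta> (Dom C f) (Dom C g) = \<beta> (Cod C f) (Cod C g) \<cdot> (f \<otimes>\<^sub>m g)"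
proof -
  have "\<forall>X X' Y Y' f g. f \<in> Hom C X X' \<longrightarrow> g \<in> Hom C Y Y' \<longrightarrow>
      (g \<otimes>\<^sub>m f) \<cdot> \<beta> X Y = \<beta> X' Y' \<cdot> (f \<otimes>\<^sub>m g)"
    using \<beta> unfolding braiding_def by blast
  with assms show ?thesis by (simp add: Hom_def)
qed

text \<open>Put \<open>b = run Z \<cdot> \<beta> 1 Z\<close>. The hexagon at \<open>1 \<otimes> 1\<close> and naturality at \<open>lun 1\<close> yield
  \<open>b (lun 1 \<otimes> Z) = b (1 \<otimes> b)\<close> up to an associator, and \<open>b\<close> is invertible.\<close>

lemma (in moncat_calculus) run_braiding_unit:
  assumes \<beta>: "braiding C \<beta>" and Z [simp]: "Z \<in> Ob C"
  shows "run C Z \<cdot> \<beta> (unit C) Z = lun C Z"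
proof -
  let ?I = "unit C"
  have \<beta>_typing [simp]: "is_iso C (\<beta> X Y)" "\<beta> X Y \<in> Mor C" "Dom C (\<beta> X Y) = X \<otimes>\<^sub>o Y" "Cod C (\<beta> X Y) = Y \<otimes>\<^sub>o X"
    if "X \<in> Ob C" "Y \<in> Ob C" for X Y
    using \<beta> that by (auto simp: braiding_def Hom_def)
  let ?b = "run C Z \<cdot> \<beta> ?I Z"
  have "\<beta> ?I Z \<cdot> (lun C ?I \<otimes>\<^sub>m Idn C Z) = (Idn C Z \<otimes>\<^sub>m lun C ?I) \<cdot> \<beta> (?I \<otimes>\<^sub>o ?I) Z"
    using braiding_natural [OF \<beta>, of "lun C ?I" "Idn C Z"] by simp
  also have "\<beta> (?I \<otimes>\<^sub>o ?I) Z = assc C Z ?I ?I \<cdot> (\<beta> ?I Z \<otimes>\<^sub>m Idn C ?I) \<cdot> iassc C ?I Z ?I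
      \<cdot> (Idn C ?I \<otimes>\<^sub>m \<beta> ?I Z) \<cdot> assc C ?I ?I Z"
    using \<beta> unfolding braiding_def by simp
  also have "(Idn C Z \<otimes>\<^sub>m lun C ?I) \<cdot> assc C Z ?I ?I \<cdot> (\<beta> ?I Z \<otimes>\<^sub>m Idn C ?I) \<cdot> iassc C ?I Z ?I
        \<cdot> (Idn C ?I \<otimes>\<^sub>m \<beta> ?I Z) \<cdot> assc C ?I ?I Z =
      (run C Z \<otimes>\<^sub>m Idn C ?I) \<cdot> (\<beta> ?I Z \<otimes>\<^sub>m Idn C ?I) \<cdot> iassc C ?I Z ?I
        \<cdot> (Idn C ?I \<otimes>\<^sub>m \<beta> ?I Z) \<cdot> assc C ?I ?I Z"
    by (rule reassoc [OF triangle]) simp_all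
  finally have "run C Z \<cdot> \<beta> ?I Z \<cdot> (lun C ?I \<otimes>\<^sub>m Idn C Z) =
      run C Z \<cdot> (?b \<otimes>\<^sub>m Idn C ?I) \<cdot> iassc C ?I Z ?I \<cdot> (Idn C ?I \<otimes>\<^sub>m \<beta> ?I Z) \<cdot> assc C ?I ?I Z"
    by simp
  also have "\<dots> = (?b \<cdot> run C (?I \<otimes>\<^sub>o Z)) \<cdot> iassc C ?I Z ?I \<cdot> (Idn C ?I \<otimes>\<^sub>m \<beta> ?I Z) \<cdot> assc C ?I ?I Z"
    by (rule reassoc) (use run_natural [of ?b] in simp_all)
  also have "\<dots> = ?b \<cdot> (Idn C ?I \<otimes>\<^sub>m ?b) \<cdot> assc C ?I ?I Z"
    by (simp flip: run_tob)
  finally have "?b \<cdot> (lun C ?I \<otimes>\<^sub>m Idn C Z) = ?b \<cdot> ((Idn C ?I \<otimes>\<^sub>m ?b) \<cdot> assc C ?I ?I Z)"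
    by simp
  then have "lun C ?I \<otimes>\<^sub>m Idn C Z = (Idn C ?I \<otimes>\<^sub>m ?b) \<cdot> assc C ?I ?I Z"
    by (rule iso_cancel_left [rotated -1]) simp_all
  then have "(Idn C ?I \<otimes>\<^sub>m lun C Z) \<cdot> assc C ?I ?I Z = (Idn C ?I \<otimes>\<^sub>m ?b) \<cdot> assc C ?I ?I Z"
    by (simp add: triangle lun_unit_eq_run_unit)
  then have "Idn C ?I \<otimes>\<^sub>m lun C Z = Idn C ?I \<otimes>\<^sub>m ?b"
    by (rule iso_cancel_right [rotated -1]) simp_all
  then show ?thesis
    by (rule unit_tensor_faithful(1) [rotated -1, symmetric]) simp_all
qed

context right_projection
begin

text \<open>Since \<open>I\<close> is braided, absorbing \<open>A\<close> after \<open>\<beta> A X\<close> is the same as braiding the unit object past \<open>I X\<close> after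
  absorbing \<open>A\<close>, and the braiding with the unit object is trivial.\<close>

theorem \<sigma>_eq_braiding:
  assumes \<beta>: "braiding C \<beta>" and \<beta>': "braiding D \<beta>'" and I: "braided_functor C \<beta> D \<beta>' I"
    and X [simp]: "X \<in> Ob C"
  shows "\<sigma> X = \<beta> A X"
proof (rule cr_unique [of _ _ X])
  have [simp]: "\<beta> A X \<in> Mor C" "Dom C (\<beta> A X) = A \<otimes>\<^sub>o X" "Cod C (\<beta> A X) = X \<otimes>\<^sub>o A"
    using \<beta> by (auto simp: braiding_def Hom_def)
  then show "\<beta> A X \<in> Mor C" "Dom C (\<sigma> X) = Dom C (\<beta> A X)" "Cod C (\<beta> A X) = X \<otimes>\<^sub>o A"
    by simp_all
  have \<beta>'_typing [simp]: "\<beta>' U V \<in> Mor D" "Dom D (\<beta>' U V) = U \<otimes>\<^sub>o\<^bsub>D\<^esub> V" "Cod D (\<beta>' U V) = V \<otimes>\<^sub>o\<^bsub>D\<^esub> U"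
    if "U \<in> Ob D" "V \<in> Ob D" for U V
    using \<beta>' that by (auto simp: braiding_def Hom_def)
  have I_\<beta>: "fmul I X A \<ast> fm I (\<beta> A X) = \<beta>' (fo I A) (fo I X) \<ast> fmul I A X"
    using I by (simp add: braided_functor_def)
  have \<beta>'_natural: "(Idn D (fo I X) \<boxtimes> \<epsilon> (unit D)) \<ast> \<beta>' (fo I A) (fo I X) =
      \<beta>' (unit D) (fo I X) \<ast> (\<epsilon> (unit D) \<boxtimes> Idn D (fo I X))"
    using D.braiding_natural [OF \<beta>', of "\<epsilon> (unit D)" "Idn D (fo I X)"] by simp
  have "\<epsilon> (fo I X) \<ast> fm I (pr1 X) \<ast> fm I (\<beta> A X) =
     (run D (fo I X) \<ast> (Idn D (fo I X) \<boxtimes> \<epsilon> (unit D)) \<ast> fmul I X A) \<ast> fm I (\<beta> A X)"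
    by (rule D.reassoc [OF \<epsilon>_proj1]) simp_all
  also have "\<dots> = run D (fo I X) \<ast> (Idn D (fo I X) \<boxtimes> \<epsilon> (unit D)) \<ast> \<beta>' (fo I A) (fo I X) \<ast> fmul I A X"
    using I_\<beta> by simp
  also have "\<dots> = run D (fo I X) \<ast> (\<beta>' (unit D) (fo I X) \<ast> (\<epsilon> (unit D) \<boxtimes> Idn D (fo I X))) \<ast> fmul I A X"
    using D.reassoc [OF \<beta>'_natural, of "fmul I A X"] by simp
  also have "\<dots> = lun D (fo I X) \<ast> (\<epsilon> (unit D) \<boxtimes> Idn D (fo I X)) \<ast> fmul I A X"
    using D.reassoc [OF D.run_braiding_unit [OF \<beta>'], of "fo I X"
      "(\<epsilon> (unit D) \<boxtimes> Idn D (fo I X)) \<ast> fmul I A X"] by simp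
  finally have "cr X \<cdot>\<^bsub>E\<^esub> F (\<beta> A X) = cl X"
    by (simp add: absorb_eq \<epsilon>_proj2) (simp add: full_embed_def)
  then show "cr X \<cdot>\<^bsub>E\<^esub> F (\<sigma> X) = cr X \<cdot>\<^bsub>E\<^esub> F (\<beta> A X)"
    by (simp only: absorb_\<sigma> X)
qed simp_all

end

theorem (in ambidextrous) special_commutative_frobenius_in_center:
  assumes "\<sigma> \<in> extensional (Ob C)"
  shows "special_commutative_frobenius (center C) (center_braiding C) (A, \<sigma>)
       (center_tob C (A, \<sigma>) (A, \<sigma>), \<mu>, (A, \<sigma>)) (center_unit C, \<iota>, (A, \<sigma>))
       ((A, \<sigma>), \<delta>, center_tob C (A, \<sigma>) (A, \<sigma>)) ((A, \<sigma>), \<epsilon>, center_unit C)"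
proof -
  note h = right.\<sigma>_half_braiding
  note hh = right.hb_tensor_r [OF h]
  have "restrict \<sigma> (Ob C) = \<sigma>"
    using assms by (rule extensional_restrict)
  moreover have "frobenius_object C A \<mu> \<iota> \<delta> \<epsilon>"
    using right.monoid comonoid frobenius_left frobenius_right by (simp add: frobenius_object_def)
  ultimately show ?thesis
    using C.special_commutative_frobenius_center [OF h hh right.hb_tensor_r [OF hh] right.hb_tensor_l [OF hh]
        right.hb_mor_assc right.hb_mor_\<mu> right.hb_mor_\<iota> hb_mor_\<delta> hb_mor_\<epsilon> _ mult_comult right.commutative]
    by simp
qed

section \<open>Green 2-functors\<close>

theorem theorem8p3:
  fixes ic :: bool
    and K :: "('k, 'r) ring_scheme"
    and T :: "('o, 'a, 'c) two_cat"
    and J :: "'a set"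
    and M :: "('o, 'a, 'c, 'k, 'x, 'm) green"
    and i :: 'a and H G :: 'o
    and C :: "('x, 'm) moncat"
    and A :: 'x and \<sigma> :: "'x \<Rightarrow> 'm" and \<mu> \<iota> \<delta> \<epsilon> :: 'm
  assumes "cring K"
    and "spannable_pair T J"
    and "green_2_functor ic K T J M"
    and "i \<in> J" and "i \<in> hom1 T H G"
    and "C = mcat M G"
    and "A = frob_ob T M i"
    and "\<sigma> = frob_sigma T M i"
    and "\<mu> = frob_mult T M i" and "\<iota> = frob_unit T M i"
    and "\<delta> = frob_comult T M i" and "\<epsilon> = frob_counit T M i"
  shows
    "(half_braiding C A \<sigma> \<and>
      (\<forall>\<beta>. braided_green T M \<beta> \<longrightarrow> (\<forall>X\<in>Ob C. \<sigma> X = \<beta> G A X))) \<and>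
     special_commutative_frobenius (center C) (center_braiding C) (A, \<sigma>)
       (center_tob C (A, \<sigma>) (A, \<sigma>), \<mu>, (A, \<sigma>)) (center_unit C, \<iota>, (A, \<sigma>))
       ((A, \<sigma>), \<delta>, center_tob C (A, \<sigma>) (A, \<sigma>)) ((A, \<sigma>), \<epsilon>, center_unit C) \<and>
     (colax_monoidal_iso C C (ltensor_colax C A \<sigma> \<delta> \<epsilon>) (push_pull_colax T M i) (rp2_unit T M i) \<and>
      lax_monoidal_iso C C (ltensor_lax C A \<sigma> \<mu> \<iota>) (push_pull_lax T M i) (rp2_unit T M i) \<and>
      colax_monoidal_iso C C (rtensor_colax C A \<sigma> \<delta> \<epsilon>) (push_pull_colax T M i) (rp1_unit T M i) \<and>
      lax_monoidal_iso C C (rtensor_lax C A \<sigma> \<mu> \<iota>) (push_pull_lax T M i) (rp1_unit T M i))"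
proof -
  let ?D = "mcat M H" and ?I = "pull M i" and ?P = "push M i"
  let ?\<eta>l = "leta M i" and ?\<epsilon>l = "leps M i" and ?\<eta>r = "reta M i" and ?\<epsilon>r = "reps M i"
  have iHG: "i \<in> Arr T" "src T i = H" "trg T i = G"
    using assms(5) by (auto simp: hom1_def)
  have "two_category T"
    using assms(2) by (simp add: spannable_pair_def two_one_category_def)
  then have HG: "H \<in> Obj T" "G \<in> Obj T"
    using iHG by (auto simp: two_category_def)
  note green = assms(3) [unfolded green_2_functor_def]
  have proj: "rp1 T M i X Y = proj1 C ?D ?I ?P ?\<eta>r ?\<epsilon>r X Y" "rp2 T M i Y X = proj2 C ?D ?I ?P ?\<eta>r ?\<epsilon>r Y X"
     "lp1 T M i X Y = left_proj1 C ?D ?I ?P ?\<eta>l ?\<epsilon>l X Y" "lp2 T M i Y X = left_proj2 C ?D ?I ?P ?\<eta>l ?\<epsilon>l Y X" for X Y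
    by (simp_all add: rp1_def rp2_def lp1_def lp2_def proj1_def proj2_def left_proj1_def left_proj2_def
        iHG assms(6))
  have moncat: "monoidal_category C" "monoidal_category ?D"
    using green HG assms(6) by blast+
  have strong: "strong_monoidal C ?D ?I"
    using green assms(5,6) by blast
  have "mackey_2_functor ic K T J M"
    using assms(3) by (simp add: green_2_functor_def)
  note mackey = this [unfolded mackey_2_functor_def, THEN conjunct2, THEN conjunct2, THEN conjunct1,
      rule_format, OF assms(4,5)]
  have adj: "adjunction ?D C ?P ?I ?\<eta>l ?\<epsilon>l" "adjunction C ?D ?I ?P ?\<eta>r ?\<epsilon>r"
    "\<forall>Y\<in>Ob ?D. Cmp ?D (?\<epsilon>r Y) (?\<eta>l Y) = Idn ?D Y"
    using mackey by (simp_all add: assms(6))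
  have inv: "\<forall>X\<in>Ob C. \<forall>Y\<in>Ob ?D. inverse_mors C (rp1 T M i X Y) (lp1 T M i X Y) \<and>
        inverse_mors C (rp2 T M i Y X) (lp2 T M i Y X)"
    using green assms(4,6) iHG by blast
  have unit_H: "unit ?D \<in> Ob ?D"
    using moncat(2) by (simp add: monoidal_category_def)
  have \<sigma>_eq: "\<sigma> X = left_proj1 C ?D ?I ?P ?\<eta>l ?\<epsilon>l X (unit ?D)
       \<cdot>\<^bsub>C\<^esub> fm ?P (Cmp ?D (inv_mor ?D (run ?D (fo ?I X))) (lun ?D (fo ?I X))) \<cdot>\<^bsub>C\<^esub> proj2 C ?D ?I ?P ?\<eta>r ?\<epsilon>r (unit ?D) X"
    if "X \<in> Ob C" for X
    using that assms(6) iHG by (simp add: assms(8) frob_sigma_def proj)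
  \<comment> \<open>All hypotheses on \<open>M\<close> are now in the form of the abstract situation.\<close>
  interpret ambidextrous C ?D ?I ?P ?\<eta>l ?\<epsilon>l ?\<eta>r ?\<epsilon>r \<sigma>
    by unfold_locales (use moncat strong adj inv unit_H \<sigma>_eq in \<open>simp_all add: proj\<close>)
  have ob: "A = fo ?P (unit ?D)"
    by (simp add: assms(7) frob_ob_def iHG)
  have mult: "\<mu> = fm ?P (lun ?D (unit ?D)) \<cdot>\<^bsub>C\<^esub> fmul (right_adjoint_lax C ?D ?I ?P ?\<eta>r ?\<epsilon>r) (unit ?D) (unit ?D)"
    and unit: "\<iota> = fun0 (right_adjoint_lax C ?D ?I ?P ?\<eta>r ?\<epsilon>r)"
    and comult: "\<delta> = fmul (left_adjoint_colax C ?D ?I ?P ?\<eta>l ?\<epsilon>l) (unit ?D) (unit ?D)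
       \<cdot>\<^bsub>C\<^esub> fm ?P (inv_mor ?D (lun ?D (unit ?D)))"
    and counit: "\<epsilon> = fun0 (left_adjoint_colax C ?D ?I ?P ?\<eta>l ?\<epsilon>l)"
    by (simp_all add: assms(6,9-12) frob_mult_def frob_unit_def frob_comult_def frob_counit_def
        push_lax_def push_colax_def iHG)
  have lax: "push_pull_lax T M i = comp_lax C (right_adjoint_lax C ?D ?I ?P ?\<eta>r ?\<epsilon>r) (strong_as_lax ?D ?I)"
    and colax: "push_pull_colax T M i = comp_colax C (left_adjoint_colax C ?D ?I ?P ?\<eta>l ?\<epsilon>l) ?I"
    by (simp_all add: assms(6) push_pull_lax_def push_pull_colax_def push_lax_def push_colax_def iHG)
  have rp: "rp1_unit T M i = proj1_unit C ?D ?I ?P ?\<eta>r ?\<epsilon>r" "rp2_unit T M i = proj2_unit C ?D ?I ?P ?\<eta>r ?\<epsilon>r"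
    by (simp_all add: fun_eq_iff rp1_unit_def rp2_unit_def proj1_unit_def proj2_unit_def proj iHG assms(6))
  have "\<sigma> X = \<beta> G A X" if "braided_green T M \<beta>" "X \<in> Ob C" for \<beta> X
    unfolding ob
  proof (rule right.\<sigma>_eq_braiding)
    show "braiding C (\<beta> G)" "braiding ?D (\<beta> H)" "braided_functor C (\<beta> G) ?D (\<beta> H) ?I"
      using that(1) HG assms(5,6) unfolding braided_green_def by blast+
  qed (rule that)
  moreover have "\<sigma> \<in> extensional (Ob C)"
    by (simp add: assms(6,8) frob_sigma_def iHG)
  ultimately show ?thesis
    unfolding ob mult unit comult counit lax colax rp
    using right.\<sigma>_half_braiding special_commutative_frobenius_in_center lax_projections colax_projections
    by (simp add: ob)
qed

end
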